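(* Let $H$ be a separable real Hilbert space, and let $A$ be a nonnegative self-adjoint linear operator on $H$ with dense domain. Assume that there exist a countable (not necessarily complete) orthonormal system $\{e_{k}\}_{k\in\mathbb{N}}$ in $H$ and a sequence $\{\lambda_{k}\}_{k\in\mathbb{N}}$ of nonnegative real numbers such that $\lambda_{k+1}\geq e^{\lambda_{k}}$ and $Ae_{k}=\lambda_{k}^{2}e_{k}$ for every $k\in\mathbb{N}$. Let $S\subseteq H$ be the closure of the subspace generated by $\{e_{k}\}$. Let $m:[0,+\infty)\to(0,+\infty)$ be a locally Lipschitz continuous function such that $\inf_{\sigma\geq 0}m(\sigma)>0$. Let $\alpha>1/4$, and let $(u_{0},u_{1})\in D(A^{\alpha+1/2})\times D(A^{\alpha})$ with $(u_{0},u_{1})\in S\times S$. Then the Cauchy problem $$u''(t)+m\left(|A^{1/2}u(t)|^{2}\right)Au(t)=0\quad\forall t\geq 0,\qquad u(0)=u_{0},\quad u'(0)=u_{1},$$ admits a unique global solution $$u\in C^{1}\left([0,+\infty);D(A^{\alpha})\right)\cap C^{0}\left([0,+\infty);D(A^{\alpha+1/2})\right).$$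
   Context: $|x|$ and $\langle x,y\rangle$ denote the norm and scalar product of $H$. Powers $A^{\beta}$ ($\beta\geq 0$) are defined by the spectral theorem, and $D(A^{\beta})$ is endowed with the graph norm. Notion of solution: the equation is understood weakly (component-wise): for every $v\in D(A)$ the function $t\mapsto\langle u(t),v\rangle$ is of class $C^{2}$ and $\frac{d^{2}}{dt^{2}}\langle u(t),v\rangle+m(|A^{1/2}u(t)|^{2})\langle u(t),Av\rangle=0$ for all $t\geq 0$. *)

theory Defs
  imports "HOL-Analysis.Analysis"
begin

text \<open>
  A possibly unbounded operator on a real Hilbert space is represented by its graph, so its domain
  is the library's \<open>Domain\<close> and extension of operators is inclusion.
\<close>

type_synonym 'a operator = "('a \<times> 'a) set"

definition op_apply :: "'a operator \<Rightarrow> 'a \<Rightarrow> 'a" where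
  "op_apply T x = (THE y. (x, y) \<in> T)"

definition linear_operator :: "'a::real_inner operator \<Rightarrow> bool" where
  "linear_operator T \<longleftrightarrow> subspace T \<and> single_valued T"

definition densely_defined :: "'a::real_inner operator \<Rightarrow> bool" where
  "densely_defined T \<longleftrightarrow> closure (Domain T) = UNIV"

definition adjoint_operator :: "'a::real_inner operator \<Rightarrow> 'a operator" where
  "adjoint_operator T = {(y, z). \<forall>(x, w)\<in>T. inner w y = inner x z}"

definition self_adjoint :: "'a::real_inner operator \<Rightarrow> bool" where
  "self_adjoint T \<longleftrightarrow> linear_operator T \<and> densely_defined T \<and> adjoint_operator T = T"

definition nonnegative_operator :: "'a::real_inner operator \<Rightarrow> bool" where
  "nonnegative_operator T \<longleftrightarrow> (\<forall>(x, y)\<in>T. inner y x \<ge> 0)"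


definition orthogonal_projection :: "('a::real_inner \<Rightarrow> 'a) \<Rightarrow> bool" where
  "orthogonal_projection P \<longleftrightarrow>
     bounded_linear P \<and> (\<forall>x. P (P x) = P x) \<and> (\<forall>x y. inner (P x) y = inner x (P y))"

definition projection_valued_measure :: "(real set \<Rightarrow> 'a::real_inner \<Rightarrow> 'a) \<Rightarrow> bool" where
  "projection_valued_measure E \<longleftrightarrow>
     (\<forall>B\<in>sets borel. orthogonal_projection (E B)) \<and>
     E UNIV = id \<and>
     (\<forall>B\<in>sets borel. \<forall>C\<in>sets borel. E (B \<inter> C) = E B \<circ> E C) \<and>
     (\<forall>B. range B \<subseteq> sets borel \<and> disjoint_family B \<longrightarrow>
        (\<forall>x. (\<lambda>i::nat. E (B i) x) sums E (\<Union>i. B i) x))"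

definition scalar_measure :: "(real set \<Rightarrow> 'a::real_inner \<Rightarrow> 'a) \<Rightarrow> 'a \<Rightarrow> real measure" where
  "scalar_measure E x = measure_of UNIV (sets borel) (\<lambda>B. ennreal (inner (E B x) x))"

definition spectral_integral_dom ::
    "(real set \<Rightarrow> 'a::real_inner \<Rightarrow> 'a) \<Rightarrow> (real \<Rightarrow> real) \<Rightarrow> 'a set" where
  "spectral_integral_dom E f = {x. integrable (scalar_measure E x) (\<lambda>s. (f s)\<^sup>2)}"

text \<open>
  The operator \<open>\<integral> f dE\<close>, in weak form: \<open>y\<close> is the image of \<open>x\<close> when \<open>\<langle>y, z\<rangle> = \<integral> f d\<langle>E x, z\<rangle>\<close> for all
  \<open>z\<close> in the (dense) domain. The signed measure \<open>\<langle>E x, z\<rangle>\<close> is written by polarization as a difference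
  of the finite positive measures \<open>\<langle>E(x \<plusminus> z), x \<plusminus> z\<rangle>\<close>; \<open>f\<close> is integrable for both of them because it
  is square integrable.
\<close>

definition spectral_integral ::
    "(real set \<Rightarrow> 'a::real_inner \<Rightarrow> 'a) \<Rightarrow> (real \<Rightarrow> real) \<Rightarrow> 'a operator" where
  "spectral_integral E f =
     {(x, y). x \<in> spectral_integral_dom E f \<and>
        (\<forall>z\<in>spectral_integral_dom E f.
           inner y z = ((\<integral>s. f s \<partial>scalar_measure E (x + z)) - (\<integral>s. f s \<partial>scalar_measure E (x - z))) / 4)}"

definition is_spectral_measure ::
    "'a::real_inner operator \<Rightarrow> (real set \<Rightarrow> 'a \<Rightarrow> 'a) \<Rightarrow> bool" where
  "is_spectral_measure A E \<longleftrightarrow> projection_valued_measure E \<and> A = spectral_integral E (\<lambda>s. s)"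

text \<open>
  By the spectral theorem every self-adjoint operator on a Hilbert space has exactly one spectral
  measure. Operators without a spectral measure get the empty graph.
\<close>

definition functional_calculus ::
    "'a::real_inner operator \<Rightarrow> (real \<Rightarrow> real) \<Rightarrow> 'a operator" where
  "functional_calculus A f =
     (if \<exists>E. is_spectral_measure A E
      then spectral_integral (SOME E. is_spectral_measure A E) f else {})"

text \<open>
  Meant for nonnegative self-adjoint \<open>A\<close> and \<open>\<beta> \<ge> 0\<close>; the spectral measure of such an \<open>A\<close> is carried by
  \<open>[0, \<infinity>)\<close>. The case distinction is needed because \<open>0 powr 0 = 0\<close>, whereas \<open>A\<^sup>0\<close> is the identity.
\<close>

definition op_power :: "'a::real_inner operator \<Rightarrow> real \<Rightarrow> 'a operator" where
  "op_power A \<beta> = functional_calculus A (\<lambda>s. if \<beta> = 0 then 1 else s powr \<beta>)"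


definition graph_norm :: "'a::real_inner operator \<Rightarrow> 'a \<Rightarrow> real" where
  "graph_norm T x = sqrt ((norm x)\<^sup>2 + (norm (op_apply T x))\<^sup>2)"

text \<open>
  The spaces \<open>C\<^sup>0([0, \<infinity>); D(T))\<close> and \<open>C\<^sup>1([0, \<infinity>); D(T))\<close>, where \<open>D(T)\<close> carries the graph norm.
\<close>

definition C0_dom :: "'a::real_inner operator \<Rightarrow> (real \<Rightarrow> 'a) \<Rightarrow> bool" where
  "C0_dom T u \<longleftrightarrow>
     (\<forall>t\<ge>0. u t \<in> Domain T) \<and>
     (\<forall>t\<ge>0. ((\<lambda>s. graph_norm T (u s - u t)) \<longlongrightarrow> 0) (at t within {0..}))"

definition C1_dom :: "'a::real_inner operator \<Rightarrow> (real \<Rightarrow> 'a) \<Rightarrow> bool" where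
  "C1_dom T u \<longleftrightarrow>
     (\<forall>t\<ge>0. u t \<in> Domain T) \<and>
     (\<exists>u'. C0_dom T u' \<and>
       (\<forall>t\<ge>0. ((\<lambda>s. graph_norm T ((1 / (s - t)) *\<^sub>R (u s - u t) - u' t)) \<longlongrightarrow> 0)
                 (at t within {0..})))"

definition weak_kirchhoff_solution ::
    "'a::real_inner operator \<Rightarrow> (real \<Rightarrow> real) \<Rightarrow> (real \<Rightarrow> 'a) \<Rightarrow> bool" where
  "weak_kirchhoff_solution A m u \<longleftrightarrow>
     (\<forall>t\<ge>0. u t \<in> Domain (op_power A (1/2))) \<and>
     (\<forall>v\<in>Domain A. \<exists>\<phi>' \<phi>''.
        (\<forall>t\<ge>0. ((\<lambda>s. inner (u s) v) has_real_derivative \<phi>' t) (at t within {0..})) \<and>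
        (\<forall>t\<ge>0. (\<phi>' has_real_derivative \<phi>'' t) (at t within {0..})) \<and>
        continuous_on {0..} \<phi>'' \<and>
        (\<forall>t\<ge>0. \<phi>'' t + m ((norm (op_apply (op_power A (1/2)) (u t)))\<^sup>2)
                          * inner (u t) (op_apply A v) = 0))"

text \<open>Only the values of \<open>u\<close> on \<open>[0, \<infinity>)\<close> matter here.\<close>

definition kirchhoff_solution ::
    "'a::real_inner operator \<Rightarrow> (real \<Rightarrow> real) \<Rightarrow> real \<Rightarrow> 'a \<Rightarrow> 'a \<Rightarrow> (real \<Rightarrow> 'a) \<Rightarrow> bool" where
  "kirchhoff_solution A m \<alpha> u0 u1 u \<longleftrightarrow>
     C1_dom (op_power A \<alpha>) u \<and>
     C0_dom (op_power A (\<alpha> + 1/2)) u \<and>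
     weak_kirchhoff_solution A m u \<and>
     u 0 = u0 \<and>
     (u has_vector_derivative u1) (at 0 within {0..})"

end

theory Submission
  imports Defs
begin

text \<open>
  The powers of an operator without a spectral measure have empty domain, so a spectral measure
  \<open>E\<close> of \<open>A\<close> may be assumed. On \<open>S\<close> the equation becomes the system \<open>u\<^sub>k'' + \<lambda>\<^sub>k\<^sup>2 c u\<^sub>k = 0\<close> with
  \<open>c = m (\<Sum>k. \<lambda>\<^sub>k\<^sup>2 u\<^sub>k\<^sup>2)\<close>. The modes up to \<open>n\<close> have frequency at most \<open>\<lambda>\<^sub>n\<close>, while the energy \<open>F\<close> of
  the modes above \<open>n\<close> starts below \<open>exp (- (4 \<alpha> - 1) \<lambda>\<^sub>n)\<close> up to a constant, because
  \<open>\<lambda>\<^sub>n\<^sub>+\<^sub>1 \<ge> exp \<lambda>\<^sub>n\<close>. Since \<open>F' \<le> C (\<lambda>\<^sub>n + F) F\<close>, the energy \<open>F\<close> stays bounded on a time interval whose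
  length depends only on \<open>\<alpha>\<close>, \<open>m\<close> and the conserved total energy. On it \<open>c\<close> is Lipschitz
  continuous, so each mode keeps its energy up to a constant factor, and the argument can be repeated
  from the end of the interval. These bounds are uniform over data with finitely many modes. A
  stability estimate in the weaker energy with weights \<open>1 / (1 + \<lambda>\<^sub>k)\<close> shows that such solutions
  converge, and that the limit is unique among the solutions with values in \<open>S\<close>. The component of a
  solution orthogonal to \<open>S\<close> satisfies a linear equation with the same coefficient \<open>c\<close>, and
  vanishes on every bounded spectral subspace of \<open>A\<close>.
\<close>

section \<open>Spectral measures\<close>

text \<open>The exponent 1/4 comes from the coefficient: the derivative of
  \<open>|A^(1/2) u|^2\<close> is \<open>2 <A u, u'>\<close>, which costs one factor
  \<open>lam k\<close> more than the energy, that is \<open>|A^(1/4) u'|^2 + |A^(3/4) u|^2\<close>.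
  Data with \<open>\<alpha> > 1/4\<close> have the power \<open>4 \<alpha> - 1\<close> of
  \<open>lam k\<close> to spare, and the gap turns it, for modes above \<open>n\<close>, into an
  exponential in \<open>lam n\<close>. This beats a growth rate that is only linear in
  \<open>lam n\<close>, for a time independent of \<open>n\<close>; so the time steps do not shrink
  when the norms grow. The weight \<open>1 / (1 + lam k)\<close> closes both couplings of the
  stability estimate: the difference of the two sums of \<open>lam_k^2 u_k^2\<close> and the forcing
  \<open>lam_k^2 (c2 - c1) u_k\<close> each need exactly one factor \<open>1 + lam k\<close> on the
  solutions, which is available. Since \<open>m\<close> is only Lipschitz, energies that contain it
  need not be differentiable, and the energy inequalities are for right Dini derivatives. Since
  spectral integrals are given weakly, through polarized measures, no composition rule for them is
  used: facts about them are obtained by comparing measures on Borel sets.\<close>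

lemma norm_polar: "(norm (a + b))\<^sup>2 - (norm (a - b))\<^sup>2 = 4 * inner a (b::'a::real_inner)"
  by (simp add: power2_norm_eq_inner inner_add_left inner_add_right
      inner_diff_left inner_diff_right inner_commute[of b a])

section \<open>Projection-valued measures and their scalar measures\<close>

locale pvm =
  fixes E :: "real set \<Rightarrow> 'a::real_inner \<Rightarrow> 'a"
  assumes pvm: "projection_valued_measure E"
begin

abbreviation \<mu> :: "'a \<Rightarrow> real measure" where "\<mu> x \<equiv> scalar_measure E x"

lemma projection: "B \<in> sets borel \<Longrightarrow> orthogonal_projection (E B)"
  using pvm by (auto simp: projection_valued_measure_def)

lemma bounded_linear_E: "B \<in> sets borel \<Longrightarrow> bounded_linear (E B)"
  using projection by (auto simp: orthogonal_projection_def)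

lemma E_add: "B \<in> sets borel \<Longrightarrow> E B (x + y) = E B x + E B y"
  and E_diff: "B \<in> sets borel \<Longrightarrow> E B (x - y) = E B x - E B y"
  and E_scale: "B \<in> sets borel \<Longrightarrow> E B (r *\<^sub>R x) = r *\<^sub>R E B x"
  using bounded_linear_E[of B]
  by (auto simp: bounded_linear.linear linear_add linear_diff linear_scale)

lemma E_zero [simp]: "B \<in> sets borel \<Longrightarrow> E B 0 = 0"
  using bounded_linear_E[of B] by (simp add: bounded_linear.linear linear_0)

lemma inner_E: "B \<in> sets borel \<Longrightarrow> inner (E B x) y = inner x (E B y)"
  using projection[of B] by (auto simp: orthogonal_projection_def)

lemma E_Int: "B \<in> sets borel \<Longrightarrow> C \<in> sets borel \<Longrightarrow> E (B \<inter> C) x = E B (E C x)"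
  using pvm by (auto simp: projection_valued_measure_def)

lemma E_UNIV [simp]: "E UNIV x = x"
  using pvm by (auto simp: projection_valued_measure_def)

lemma E_idem [simp]: "B \<in> sets borel \<Longrightarrow> E B (E B x) = E B x"
  using E_Int[of B B x] by simp

lemma E_sums:
  assumes "range B \<subseteq> sets borel" "disjoint_family B"
  shows "(\<lambda>i::nat. E (B i) x) sums E (\<Union>i. B i) x"
  using pvm assms unfolding projection_valued_measure_def by blast

lemma E_empty [simp]: "E {} x = 0"
proof -
  have "(\<lambda>i::nat. E {} x) sums E {} x"
    using E_sums[of "\<lambda>_. {}" x] by (simp add: disjoint_family_on_def)
  then have "(\<lambda>i::nat. E {} x) \<longlonglongrightarrow> 0"
    by (meson summable_LIMSEQ_zero sums_summable)
  then show ?thesis by (simp add: LIMSEQ_const_iff)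
qed

lemma inner_E_self: "B \<in> sets borel \<Longrightarrow> inner (E B x) x = (norm (E B x))\<^sup>2"
  using inner_E[of B "E B x" x] by (simp add: power2_norm_eq_inner)

lemma E_sums_norm:
  assumes "range B \<subseteq> sets borel" "disjoint_family B"
  shows "(\<lambda>i::nat. (norm (E (B i) x))\<^sup>2) sums (norm (E (\<Union>i. B i) x))\<^sup>2"
proof -
  have "(\<lambda>i. inner (E (B i) x) x) sums inner (E (\<Union>i. B i) x) x"
    by (rule bounded_linear.sums[OF bounded_linear_inner_left E_sums[OF assms]])
  moreover have "B i \<in> sets borel" for i using assms by auto
  ultimately show ?thesis
    by (simp add: inner_E_self sets.countable_UN)
qed

lemma sets_\<mu> [simp, measurable_cong]: "sets (\<mu> x) = sets borel"
  and space_\<mu> [simp]: "space (\<mu> x) = UNIV"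
proof -
  have "sigma_sets UNIV (sets borel) = sets (borel::real measure)"
    using sets.sigma_sets_eq[of "borel :: real measure"] by simp
  then show "sets (\<mu> x) = sets borel" "space (\<mu> x) = UNIV"
    by (simp_all add: scalar_measure_def space_measure_of_conv sets_measure_of)
qed

text \<open>Strong countable additivity of \<open>E\<close>, paired with the vector, is countable
  additivity of the set function; so \<open>measure_of\<close> returns this function and not its
  default, the zero measure.\<close>

lemma emeasure_\<mu>:
  assumes "B \<in> sets borel"
  shows "emeasure (\<mu> x) B = ennreal ((norm (E B x))\<^sup>2)"
proof -
  have "emeasure (\<mu> x) B = ennreal (inner (E B x) x)"
  proof (rule emeasure_measure_of[OF scalar_measure_def])
    show "sets borel \<subseteq> Pow UNIV" by simp
    show "B \<in> sets (\<mu> x)" using assms by simp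
    show "positive (sets (\<mu> x)) (\<lambda>B. ennreal (inner (E B x) x))"
      by (simp add: positive_def)
    show "countably_additive (sets (\<mu> x)) (\<lambda>B. ennreal (inner (E B x) x))"
    proof (rule countably_additiveI)
      fix B :: "nat \<Rightarrow> real set"
      assume B: "range B \<subseteq> sets (\<mu> x)" "disjoint_family B"
      then have b: "range B \<subseteq> sets borel" "\<And>i. B i \<in> sets borel"
        by (auto simp: image_subset_iff)
      from b(1) have u: "(\<Union>i. B i) \<in> sets borel" by (rule sets.countable_UN)
      have "(\<Sum>i. ennreal ((norm (E (B i) x))\<^sup>2)) = ennreal ((norm (E (\<Union>i. B i) x))\<^sup>2)"
        by (rule suminf_ennreal_eq[OF _ E_sums_norm[OF b(1) B(2)]]) simp
      then show "(\<Sum>i. ennreal (inner (E (B i) x) x)) = ennreal (inner (E (\<Union>i. B i) x) x)"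
        by (simp only: inner_E_self[OF b(2)] inner_E_self[OF u])
    qed
  qed
  then show ?thesis using assms by (simp add: inner_E_self)
qed

sublocale finite_measure "\<mu> x" for x
  by (rule finite_measureI) (simp add: emeasure_\<mu>)

lemma measure_\<mu>: "B \<in> sets borel \<Longrightarrow> measure (\<mu> x) B = (norm (E B x))\<^sup>2"
  by (simp add: measure_def emeasure_\<mu>)

lemma norm_E_le: "B \<in> sets borel \<Longrightarrow> norm (E B x) \<le> norm x"
proof -
  assume B: "B \<in> sets borel"
  have "(norm (E B x))\<^sup>2 \<le> norm (E B x) * norm x"
    using inner_E_self[OF B, of x] norm_cauchy_schwarz[of "E B x" x] by simp
  then show ?thesis
    by (cases "norm (E B x) = 0") (auto simp: power2_eq_square)
qed

text \<open>Identities such as the parallelogram law hold for the measures \<open>\<mu> w\<close> setwise; these two lemmas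
  transfer them to integrals, without forming sums of measures.\<close>

lemma nn_integral_sum_list_mono:
  fixes f :: "real \<Rightarrow> ennreal"
  assumes f: "f \<in> borel_measurable borel" and D: "D \<in> sets borel"
    and le: "\<And>B. B \<in> sets borel \<Longrightarrow> B \<subseteq> D \<Longrightarrow>
      (\<Sum>w\<leftarrow>ws. (norm (E B w))\<^sup>2) \<le> (\<Sum>w\<leftarrow>ws'. (norm (E B w))\<^sup>2)"
  shows "(\<Sum>w\<leftarrow>ws. \<integral>\<^sup>+s. f s * indicator D s \<partial>\<mu> w) \<le> (\<Sum>w\<leftarrow>ws'. \<integral>\<^sup>+s. f s * indicator D s \<partial>\<mu> w)"
  using f
proof (induct f rule: borel_measurable_induct)
  case (cong f g)
  then show ?case by (simp cong: nn_integral_cong)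
next
  case (set A)
  have 1: "(\<integral>\<^sup>+s. indicator A s * indicator D s \<partial>\<mu> w) = ennreal ((norm (E (A \<inter> D) w))\<^sup>2)" for w
    using set D by (simp add: indicator_inter_arith[symmetric] emeasure_\<mu>)
  have 2: "(\<Sum>w\<leftarrow>ws. ennreal ((norm (E B w))\<^sup>2)) = ennreal (\<Sum>w\<leftarrow>ws. (norm (E B w))\<^sup>2)" for ws B
    by (rule sum_list_ennreal) simp
  show ?case unfolding 1 2
    by (intro ennreal_leI le) (use set D in auto)
next
  case (mult u c)
  note [measurable] = mult(2) D
  have 1: "(\<Sum>w\<leftarrow>ws. \<integral>\<^sup>+s. c * u s * indicator D s \<partial>\<mu> w) =
     c * (\<Sum>w\<leftarrow>ws. \<integral>\<^sup>+s. u s * indicator D s \<partial>\<mu> w)" for ws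
  proof -
    have "(\<integral>\<^sup>+s. c * u s * indicator D s \<partial>\<mu> w) = c * (\<integral>\<^sup>+s. u s * indicator D s \<partial>\<mu> w)" for w
      unfolding mult.assoc by (rule nn_integral_cmult) measurable
    then show ?thesis by (simp add: sum_list_const_mult)
  qed
  show ?case unfolding 1 using mult by (intro mult_left_mono) auto
next
  case (add u v)
  note [measurable] = add(1,4) D
  have 1: "(\<Sum>w\<leftarrow>ws. \<integral>\<^sup>+s. (v s + u s) * indicator D s \<partial>\<mu> w) =
     (\<Sum>w\<leftarrow>ws. \<integral>\<^sup>+s. v s * indicator D s \<partial>\<mu> w) + (\<Sum>w\<leftarrow>ws. \<integral>\<^sup>+s. u s * indicator D s \<partial>\<mu> w)" for ws
  proof -
    have "(\<integral>\<^sup>+s. (v s + u s) * indicator D s \<partial>\<mu> w) =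
      (\<integral>\<^sup>+s. v s * indicator D s \<partial>\<mu> w) + (\<integral>\<^sup>+s. u s * indicator D s \<partial>\<mu> w)" for w
      unfolding distrib_right by (rule nn_integral_add) measurable
    then show ?thesis by (simp add: sum_list_addf)
  qed
  show ?case unfolding 1 using add by (intro add_mono) auto
next
  case (seq U)
  have lim: "(\<lambda>i. \<integral>\<^sup>+s. U i s * indicator D s \<partial>\<mu> w) \<longlonglongrightarrow> (\<integral>\<^sup>+s. (SUP i. U i) s * indicator D s \<partial>\<mu> w)"
    for w
  proof -
    have inc: "incseq (\<lambda>i s. U i s * indicator D s)"
      using seq(4) by (auto simp: incseq_def le_fun_def intro: mult_right_mono)
    have "(\<integral>\<^sup>+s. (SUP i. U i) s * indicator D s \<partial>\<mu> w) = (\<integral>\<^sup>+s. (SUP i. U i s * indicator D s) \<partial>\<mu> w)"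
      by (intro nn_integral_cong) (simp add: SUP_mult_right_ennreal image_comp)
    also have "\<dots> = (SUP i. \<integral>\<^sup>+s. U i s * indicator D s \<partial>\<mu> w)"
      using seq(1) D inc by (intro nn_integral_monotone_convergence_SUP) auto
    finally show ?thesis
      using inc by (auto intro!: LIMSEQ_SUP nn_integral_mono simp: incseq_def le_fun_def)
  qed
  have lims: "(\<lambda>i. \<Sum>w\<leftarrow>ws. \<integral>\<^sup>+s. U i s * indicator D s \<partial>\<mu> w) \<longlonglongrightarrow>
     (\<Sum>w\<leftarrow>ws. \<integral>\<^sup>+s. (SUP i. U i) s * indicator D s \<partial>\<mu> w)" for ws
  proof (induct ws)
    case (Cons w ws)
    then show ?case unfolding list.map sum_list.Cons by (rule tendsto_add[OF lim])
  qed simp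
  show ?case
    by (rule LIMSEQ_le[OF lims lims]) (use seq(3) in auto)
qed

lemma integral_sum_list_eq:
  fixes f :: "real \<Rightarrow> real"
  assumes f: "f \<in> borel_measurable borel" and D: "D \<in> sets borel"
    and eq: "\<And>B. B \<in> sets borel \<Longrightarrow> B \<subseteq> D \<Longrightarrow>
      (\<Sum>w\<leftarrow>ws. (norm (E B w))\<^sup>2) = (\<Sum>w\<leftarrow>ws'. (norm (E B w))\<^sup>2)"
    and int: "\<And>w. w \<in> set ws \<union> set ws' \<Longrightarrow> integrable (\<mu> w) (\<lambda>s. f s * indicator D s)"
  shows "(\<Sum>w\<leftarrow>ws. \<integral>s. f s * indicator D s \<partial>\<mu> w) = (\<Sum>w\<leftarrow>ws'. \<integral>s. f s * indicator D s \<partial>\<mu> w)"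
proof -
  note [measurable] = f D
  have pos: "(\<Sum>w\<leftarrow>ws. \<integral>s. g s * indicator D s \<partial>\<mu> w) = (\<Sum>w\<leftarrow>ws'. \<integral>s. g s * indicator D s \<partial>\<mu> w)"
    if g: "g \<in> borel_measurable borel" "\<And>s. g s \<ge> 0"
      and int: "\<And>w. w \<in> set ws \<union> set ws' \<Longrightarrow> integrable (\<mu> w) (\<lambda>s. g s * indicator D s)" for g :: "real \<Rightarrow> real"
  proof -
    have nn: "(\<Sum>w\<leftarrow>ws. \<integral>\<^sup>+s. ennreal (g s) * indicator D s \<partial>\<mu> w) = ennreal (\<Sum>w\<leftarrow>ws. \<integral>s. g s * indicator D s \<partial>\<mu> w)"
      if int: "\<And>w. w \<in> set ws \<Longrightarrow> integrable (\<mu> w) (\<lambda>s. g s * indicator D s)" for ws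
    proof -
      have "(\<integral>\<^sup>+s. ennreal (g s) * indicator D s \<partial>\<mu> w) = ennreal (\<integral>s. g s * indicator D s \<partial>\<mu> w)"
        if "w \<in> set ws" for w
      proof -
        have "(\<integral>\<^sup>+s. ennreal (g s) * indicator D s \<partial>\<mu> w) = (\<integral>\<^sup>+s. ennreal (g s * indicator D s) \<partial>\<mu> w)"
          by (intro nn_integral_cong) (simp add: indicator_def)
        then show ?thesis
          using int[OF that] g(2) by (simp add: nn_integral_eq_integral)
      qed
      then have "(\<Sum>w\<leftarrow>ws. \<integral>\<^sup>+s. ennreal (g s) * indicator D s \<partial>\<mu> w) =
        (\<Sum>w\<leftarrow>ws. ennreal (\<integral>s. g s * indicator D s \<partial>\<mu> w))"
        by (intro arg_cong[where f=sum_list] map_cong) auto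
      then show ?thesis
        using g(2) by (simp add: sum_list_ennreal integral_nonneg_AE)
    qed
    have "(\<Sum>w\<leftarrow>ws. \<integral>\<^sup>+s. ennreal (g s) * indicator D s \<partial>\<mu> w) =
      (\<Sum>w\<leftarrow>ws'. \<integral>\<^sup>+s. ennreal (g s) * indicator D s \<partial>\<mu> w)"
      using g D eq by (intro antisym nn_integral_sum_list_mono) auto
    then have "ennreal (\<Sum>w\<leftarrow>ws. \<integral>s. g s * indicator D s \<partial>\<mu> w) = ennreal (\<Sum>w\<leftarrow>ws'. \<integral>s. g s * indicator D s \<partial>\<mu> w)"
      using int by (simp add: nn)
    then show ?thesis
      using g by (subst (asm) ennreal_inj) (auto intro!: sum_list_nonneg)
  qed
  have intp: "integrable (\<mu> w) (\<lambda>s. max 0 (f s) * indicator D s)" "integrable (\<mu> w) (\<lambda>s. max 0 (- f s) * indicator D s)"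
    if "w \<in> set ws \<union> set ws'" for w
    by (rule Bochner_Integration.integrable_bound[OF int[OF that]]; (measurable | simp add: indicator_def))+
  have split: "(\<Sum>w\<leftarrow>vs. \<integral>s. f s * indicator D s \<partial>\<mu> w) =
     (\<Sum>w\<leftarrow>vs. \<integral>s. max 0 (f s) * indicator D s \<partial>\<mu> w) - (\<Sum>w\<leftarrow>vs. \<integral>s. max 0 (- f s) * indicator D s \<partial>\<mu> w)"
    if "set vs \<subseteq> set ws \<union> set ws'" for vs
    using that
  proof (induct vs)
    case (Cons w vs)
    have "(\<integral>s. f s * indicator D s \<partial>\<mu> w) = (\<integral>s. max 0 (f s) * indicator D s - max 0 (- f s) * indicator D s \<partial>\<mu> w)"
      by (intro Bochner_Integration.integral_cong) (auto simp: indicator_def)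
    also have "\<dots> = (\<integral>s. max 0 (f s) * indicator D s \<partial>\<mu> w) - (\<integral>s. max 0 (- f s) * indicator D s \<partial>\<mu> w)"
      using Cons intp by (intro Bochner_Integration.integral_diff) auto
    finally show ?case using Cons by simp
  qed simp
  show ?thesis
    unfolding split[OF Un_upper1] split[OF Un_upper2]
    using f intp by (intro arg_cong2[where f="(-)"] pos) auto
qed

section \<open>Domains of spectral integrals\<close>

lemma dom_iff:
  assumes "f \<in> borel_measurable borel"
  shows "x \<in> spectral_integral_dom E f \<longleftrightarrow> (\<integral>\<^sup>+s. ennreal ((f s)\<^sup>2) \<partial>\<mu> x) < \<infinity>"
  using assms by (simp add: spectral_integral_dom_def integrable_iff_bounded)

text \<open>Closure properties of the domain follow by comparing measures, without any linearity of
  the integral in the vector. Repeated entries of \<open>xs\<close> act as integer factors.\<close>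

lemma dom_if_norm_le:
  assumes f: "f \<in> borel_measurable borel"
    and xs: "\<And>x. x \<in> set xs \<Longrightarrow> x \<in> spectral_integral_dom E f"
    and le: "\<And>B. B \<in> sets borel \<Longrightarrow> (norm (E B w))\<^sup>2 \<le> (\<Sum>x\<leftarrow>xs. (norm (E B x))\<^sup>2)"
  shows "w \<in> spectral_integral_dom E f"
proof -
  have "(\<Sum>w\<leftarrow>[w]. \<integral>\<^sup>+s. ennreal ((f s)\<^sup>2) * indicator UNIV s \<partial>\<mu> w) \<le>
     (\<Sum>x\<leftarrow>xs. \<integral>\<^sup>+s. ennreal ((f s)\<^sup>2) * indicator UNIV s \<partial>\<mu> x)"
    using f le by (intro nn_integral_sum_list_mono) auto
  also have "\<dots> < \<infinity>"
    using xs by (induct xs) (auto simp: dom_iff[OF f])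
  finally show ?thesis by (simp add: dom_iff[OF f])
qed

lemma dom_add_diff:
  assumes f: "f \<in> borel_measurable borel"
    and x: "x \<in> spectral_integral_dom E f" and z: "z \<in> spectral_integral_dom E f"
  shows "x + z \<in> spectral_integral_dom E f" and "x - z \<in> spectral_integral_dom E f"
proof -
  have par: "(norm (a + b))\<^sup>2 + (norm (a - b))\<^sup>2 = 2 * (norm a)\<^sup>2 + 2 * (norm b)\<^sup>2" for a b :: 'a
    by (simp add: power2_norm_eq_inner inner_simps)
  have "(norm (a + b))\<^sup>2 \<le> 2 * (norm a)\<^sup>2 + 2 * (norm b)\<^sup>2"
    "(norm (a - b))\<^sup>2 \<le> 2 * (norm a)\<^sup>2 + 2 * (norm b)\<^sup>2" for a b :: 'a
    using par[of a b] zero_le_power2[of "norm (a + b)"] zero_le_power2[of "norm (a - b)"] by linarith+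
  note p = this
  have le: "(norm (E B (x + z)))\<^sup>2 \<le> (\<Sum>w\<leftarrow>[x, x, z, z]. (norm (E B w))\<^sup>2)"
    "(norm (E B (x - z)))\<^sup>2 \<le> (\<Sum>w\<leftarrow>[x, x, z, z]. (norm (E B w))\<^sup>2)" if "B \<in> sets borel" for B
    using p[of "E B x" "E B z"] by (simp_all add: E_add[OF that] E_diff[OF that])
  have xz: "w \<in> spectral_integral_dom E f" if "w \<in> set [x, x, z, z]" for w
    using that x z by auto
  show "x + z \<in> spectral_integral_dom E f" "x - z \<in> spectral_integral_dom E f"
    by (rule dom_if_norm_le[OF f xz le(1)] dom_if_norm_le[OF f xz le(2)]; assumption)+
qed

lemma dom_E:
  assumes "f \<in> borel_measurable borel" "x \<in> spectral_integral_dom E f" "C \<in> sets borel"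
  shows "E C x \<in> spectral_integral_dom E f"
proof (rule dom_if_norm_le[OF assms(1), of "[x]"])
  fix B :: "real set" assume B: "B \<in> sets borel"
  then have "E B (E C x) = E C (E B x)"
    using assms(3) by (metis E_Int Int_commute)
  then show "(norm (E B (E C x)))\<^sup>2 \<le> (\<Sum>x\<leftarrow>[x]. (norm (E B x))\<^sup>2)"
    using norm_E_le[OF assms(3), of "E B x"] by (simp add: power_mono)
qed (use assms in auto)

lemma dom_scale:
  assumes "f \<in> borel_measurable borel" "x \<in> spectral_integral_dom E f"
  shows "r *\<^sub>R x \<in> spectral_integral_dom E f"
\<comment> \<open>The factor \<open>r\<^sup>2\<close> is rounded up because multiplicities in the
  list are integers.\<close>
proof (rule dom_if_norm_le[OF assms(1), of "replicate (nat \<lceil>r\<^sup>2\<rceil>) x"])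
  fix B :: "real set" assume B: "B \<in> sets borel"
  have "(norm (E B (r *\<^sub>R x)))\<^sup>2 = r\<^sup>2 * (norm (E B x))\<^sup>2"
    using B by (simp add: E_scale power_mult_distrib)
  also have "\<dots> \<le> real (nat \<lceil>r\<^sup>2\<rceil>) * (norm (E B x))\<^sup>2"
    by (intro mult_right_mono) (auto simp: of_nat_nat le_of_int_ceiling)
  finally show "(norm (E B (r *\<^sub>R x)))\<^sup>2 \<le> (\<Sum>x\<leftarrow>replicate (nat \<lceil>r\<^sup>2\<rceil>) x. (norm (E B x))\<^sup>2)"
    by (simp add: sum_list_replicate)
qed (use assms in auto)

text \<open>The equation \<open>E B z = z\<close> says that the measure of \<open>z\<close> is
  carried by \<open>B\<close>, where \<open>f\<close> is bounded, and this measure is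
  finite.\<close>

lemma dom_bounded:
  assumes f: "f \<in> borel_measurable borel" and B: "B \<in> sets borel"
    and b: "\<And>s. s \<in> B \<Longrightarrow> \<bar>f s\<bar> \<le> b" and z: "E B z = z"
  shows "z \<in> spectral_integral_dom E f"
proof -
  have "norm (E (- B) z) = 0"
    using E_Int[of "- B" B z] B z by simp
  then have "emeasure (\<mu> z) (- B) = 0"
    using B by (simp add: emeasure_\<mu>)
  then have "AE s in \<mu> z. s \<in> B"
    using B by (intro AE_I[of _ _ "- B"]) auto
  then have "AE s in \<mu> z. norm ((f s)\<^sup>2) \<le> b\<^sup>2"
  proof eventually_elim
    case (elim s)
    show ?case using power_mono[OF b[OF elim], of 2] by simp
  qed
  then show ?thesis
    unfolding spectral_integral_dom_def using f
    by (auto intro!: integrable_const_bound)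
qed

lemma integrable_dom:
  assumes f: "f \<in> borel_measurable borel" and x: "x \<in> spectral_integral_dom E f"
    and D: "D \<in> sets borel"
  shows "integrable (\<mu> x) f" and "integrable (\<mu> x) (\<lambda>s. f s * indicator D s)"
proof -
  note [measurable] = f D
  have i: "integrable (\<mu> x) (\<lambda>s. 1 + (f s)\<^sup>2)"
    using x unfolding spectral_integral_dom_def by simp
  have ab: "\<bar>r\<bar> \<le> 1 + r\<^sup>2" for r :: real
    proof -
    have "0 \<le> (\<bar>r\<bar> - 1)\<^sup>2" "0 \<le> \<bar>r\<bar>" by auto
    then show ?thesis unfolding power2_diff by simp
  qed
  show "integrable (\<mu> x) f"
    by (rule Bochner_Integration.integrable_bound[OF i]) (use ab in \<open>auto simp: abs_of_nonneg\<close>)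
  have "\<bar>f s * indicator D s\<bar> \<le> 1 + (f s)\<^sup>2" for s
    using ab[of "f s"] by (auto simp: indicator_def)
  then show "integrable (\<mu> x) (\<lambda>s. f s * indicator D s)"
    by (intro Bochner_Integration.integrable_bound[OF i]) (auto simp: abs_of_nonneg)
qed

lemma integral_split:
  assumes f: "f \<in> borel_measurable borel" and x: "x \<in> spectral_integral_dom E f"
    and D: "D \<in> sets borel"
  shows "(\<integral>s. f s \<partial>\<mu> x) = (\<integral>s. f s * indicator D s \<partial>\<mu> x) + (\<integral>s. f s * indicator (- D) s \<partial>\<mu> x)"
proof -
  have "(\<integral>s. f s \<partial>\<mu> x) = (\<integral>s. f s * indicator D s + f s * indicator (- D) s \<partial>\<mu> x)"
    by (intro Bochner_Integration.integral_cong) (auto simp: indicator_def)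
  also have "\<dots> = (\<integral>s. f s * indicator D s \<partial>\<mu> x) + (\<integral>s. f s * indicator (- D) s \<partial>\<mu> x)"
    using D by (intro Bochner_Integration.integral_add integrable_dom f x) auto
  finally show ?thesis .
qed

section \<open>Localization, bounds and algebra of spectral integrals\<close>

lemma spectral_integral_domD: "(x, y) \<in> spectral_integral E f \<Longrightarrow> x \<in> spectral_integral_dom E f"
  by (auto simp: spectral_integral_def)

lemma spectral_integralD:
  assumes "(x, y) \<in> spectral_integral E f" "z \<in> spectral_integral_dom E f"
  shows "4 * inner y z = (\<integral>s. f s \<partial>\<mu> (x + z)) - (\<integral>s. f s \<partial>\<mu> (x - z))"
  using assms by (auto simp: spectral_integral_def)

text \<open>Outside \<open>B\<close> the vector \<open>z\<close> is invisible, so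
  \<open>x + z\<close> and \<open>x - z\<close> have the same measure there and the two
  contributions cancel in the polarized difference.\<close>

lemma inner_spectral_integral:
  assumes f: "f \<in> borel_measurable borel" and xy: "(x, y) \<in> spectral_integral E f"
    and z: "z \<in> spectral_integral_dom E f" and B: "B \<in> sets borel" and Bz: "E B z = z"
  shows "4 * inner y z =
    (\<integral>s. f s * indicator B s \<partial>\<mu> (x + z)) - (\<integral>s. f s * indicator B s \<partial>\<mu> (x - z))"
proof -
  note x = spectral_integral_domD[OF xy]
  note d = dom_add_diff[OF f x z]
  have "E C z = 0" if "C \<in> sets borel" "C \<subseteq> - B" for C
  proof -
    have "C \<inter> B = {}" using that by auto
    then show ?thesis using E_Int[OF that(1) B, of z] Bz by simp
  qed
  then have "(\<Sum>w\<leftarrow>[x + z]. \<integral>s. f s * indicator (- B) s \<partial>\<mu> w) = (\<Sum>w\<leftarrow>[x - z]. \<integral>s. f s * indicator (- B) s \<partial>\<mu> w)"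
    using B by (intro integral_sum_list_eq f) (auto simp: E_add E_diff intro!: integrable_dom f d)
  moreover note spectral_integralD[OF xy z]
  ultimately show ?thesis
    by (simp add: integral_split[OF f d(1) B] integral_split[OF f d(2) B])
qed

lemma abs_integral_indicator_le:
  assumes f: "f \<in> borel_measurable borel" and x: "x \<in> spectral_integral_dom E f"
    and B: "B \<in> sets borel" and b: "\<And>s. s \<in> B \<Longrightarrow> \<bar>f s\<bar> \<le> b"
  shows "\<bar>\<integral>s. f s * indicator B s \<partial>\<mu> x\<bar> \<le> b * (norm (E B x))\<^sup>2"
proof -
  have "\<bar>\<integral>s. f s * indicator B s \<partial>\<mu> x\<bar> \<le> (\<integral>s. \<bar>f s * indicator B s\<bar> \<partial>\<mu> x)"
    by (rule integral_abs_bound)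
  also have "\<dots> \<le> (\<integral>s. b * indicator B s \<partial>\<mu> x)"
  proof (rule integral_mono)
    show "integrable (\<mu> x) (\<lambda>s. \<bar>f s * indicator B s\<bar>)"
      by (rule integrable_abs[OF integrable_dom(2)[OF f x B]])
    show "integrable (\<mu> x) (\<lambda>s. b * indicator B s)"
      using B by (intro integrable_mult_right integrable_real_indicator) (auto simp: emeasure_\<mu>)
  qed (use b in \<open>auto simp: indicator_def\<close>)
  finally show ?thesis using B by (simp add: measure_\<mu>)
qed

text \<open>The weak definition offers only quadratic quantities. Testing with
  \<open>z = r E B y\<close> and bounding both measures on \<open>B\<close> gives a quadratic
  inequality in \<open>r\<close>, which is then optimized.\<close>

lemma norm_E_spectral_integral_le:
  assumes f: "f \<in> borel_measurable borel" and xy: "(x, y) \<in> spectral_integral E f"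
    and B: "B \<in> sets borel" and b: "\<And>s. s \<in> B \<Longrightarrow> \<bar>f s\<bar> \<le> b" "b > 0"
  shows "norm (E B y) \<le> b * norm (E B x)"
proof -
  define X Y where "X = norm (E B x)" and "Y = norm (E B y)"
  have main: "r * Y\<^sup>2 \<le> b * (X\<^sup>2 + r\<^sup>2 * Y\<^sup>2) / 2" for r
  proof -
    define z where "z = r *\<^sub>R E B y"
    have Bz: "E B z = z" using B by (simp add: z_def E_scale)
    have z: "z \<in> spectral_integral_dom E f" by (rule dom_bounded[OF f B b(1) Bz])
    note d = dom_add_diff[OF f spectral_integral_domD[OF xy] z]
    have "4 * (r * Y\<^sup>2) = 4 * inner y z"
      using B by (simp add: z_def Y_def inner_E_self[symmetric] inner_commute)
    also have "\<dots> \<le> b * (norm (E B (x + z)))\<^sup>2 + b * (norm (E B (x - z)))\<^sup>2"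
      using abs_integral_indicator_le[OF f d(1) B b(1)] abs_integral_indicator_le[OF f d(2) B b(1)]
      unfolding inner_spectral_integral[OF f xy z B Bz] by linarith
    also have "\<dots> = b * (2 * X\<^sup>2 + 2 * (norm z)\<^sup>2)"
      using B by (simp add: E_add E_diff Bz X_def power2_norm_eq_inner inner_simps algebra_simps)
    also have "(norm z)\<^sup>2 = r\<^sup>2 * Y\<^sup>2"
      by (simp add: z_def Y_def power_mult_distrib)
    finally show ?thesis by (simp add: algebra_simps)
  qed
  have "Y \<le> b * X"
  proof (cases "Y = 0")
    case False
    then have Y: "Y > 0" by (simp add: Y_def)
    show ?thesis
    \<comment> \<open>The best parameter is \<open>r = X / Y\<close>. For \<open>X = 0\<close> it
      degenerates, and \<open>r = 1 / b\<close> already forces \<open>Y = 0\<close>.\<close>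
    proof (cases "X = 0")
      case True
      then have "Y\<^sup>2 / b \<le> Y\<^sup>2 / b / 2"
        using main[of "1 / b"] b(2) by (simp add: power2_eq_square divide_simps)
      then show ?thesis using Y b(2) by (simp add: field_simps)
    next
      case False
      then have X: "X > 0" by (simp add: X_def)
      have "X * Y \<le> b * X * X"
        using main[of "X / Y"] Y by (simp add: power2_eq_square field_simps)
      then show ?thesis using X by (simp add: mult.assoc mult.left_commute)
    qed
  qed (use b in \<open>simp add: X_def\<close>)
  then show ?thesis by (simp add: X_def Y_def)
qed

text \<open>The test vector is \<open>E B x\<close>: on subsets of \<open>B\<close>, the vector
  \<open>x + E B x\<close> has the measure of \<open>2 *\<^sub>R x\<close>, and
  \<open>x - E B x\<close> has measure zero.\<close>

lemma inner_E_spectral_integral: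
  assumes f: "f \<in> borel_measurable borel" and xy: "(x, y) \<in> spectral_integral E f"
    and B: "B \<in> sets borel"
  shows "4 * inner y (E B x) = (\<integral>s. f s * indicator B s \<partial>\<mu> (2 *\<^sub>R x))"
proof -
  note x = spectral_integral_domD[OF xy]
  note z = dom_E[OF f x B]
  note d = dom_add_diff[OF f x z]
  have c: "E C (E B x) = E C x" if "C \<in> sets borel" "C \<subseteq> B" for C
    using that E_Int[OF that(1) B, of x] by (simp add: Int_absorb2)
  have 1: "(\<Sum>w\<leftarrow>[x + E B x]. \<integral>s. f s * indicator B s \<partial>\<mu> w) = (\<Sum>w\<leftarrow>[2 *\<^sub>R x]. \<integral>s. f s * indicator B s \<partial>\<mu> w)"
    using B by (intro integral_sum_list_eq f)
      (auto simp: E_add E_diff E_scale c scaleR_2 intro!: integrable_dom f d x dom_add_diff)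
  have 2: "(\<Sum>w\<leftarrow>[x - E B x]. \<integral>s. f s * indicator B s \<partial>\<mu> w) = (\<Sum>w\<leftarrow>[]. \<integral>s. f s * indicator B s \<partial>\<mu> w)"
    using B by (intro integral_sum_list_eq f) (auto simp: E_diff c intro!: integrable_dom f d)
  show ?thesis
    using inner_spectral_integral[OF f xy z B] B 1 2 by simp
qed

lemma norm_E_spectral_integral_ge:
  assumes f: "f \<in> borel_measurable borel" and xy: "(x, y) \<in> spectral_integral E f"
    and B: "B \<in> sets borel" and a: "\<And>s. s \<in> B \<Longrightarrow> a \<le> f s"
  shows "a * norm (E B x) \<le> norm (E B y)"
proof -
  have x2: "2 *\<^sub>R x \<in> spectral_integral_dom E f"
    by (rule dom_scale[OF f spectral_integral_domD[OF xy]])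
  have "4 * a * (norm (E B x))\<^sup>2 = (\<integral>s. a * indicator B s \<partial>\<mu> (2 *\<^sub>R x))"
    using B by (simp add: measure_\<mu> E_scale power_mult_distrib)
  also have "\<dots> \<le> (\<integral>s. f s * indicator B s \<partial>\<mu> (2 *\<^sub>R x))"
  proof (rule integral_mono)
    show "integrable (\<mu> (2 *\<^sub>R x)) (\<lambda>s. f s * indicator B s)"
      by (rule integrable_dom(2)[OF f x2 B])
    show "integrable (\<mu> (2 *\<^sub>R x)) (\<lambda>s. a * indicator B s)"
      using B by (intro integrable_mult_right integrable_real_indicator) (auto simp: emeasure_\<mu>)
  qed (use a in \<open>auto simp: indicator_def\<close>)
  also have "\<dots> = 4 * inner (E B y) (E B x)"
    using inner_E_spectral_integral[OF f xy B] inner_E[OF B, of y "E B x"] B by simp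
  finally have "a * (norm (E B x))\<^sup>2 \<le> inner (E B y) (E B x)" by simp
  also have "\<dots> \<le> norm (E B y) * norm (E B x)" by (rule norm_cauchy_schwarz)
  finally show ?thesis
    by (cases "norm (E B x) = 0") (auto simp: power2_eq_square mult.assoc[symmetric])
qed

text \<open>A comparison of two functions of the operator, done on layers
  \<open>j \<le> f < j + 1\<close>. There \<open>f \<le> j + 1\<close> and
  \<open>g \<ge> j - 1\<close>, hence
  \<open>|E y| \<le> 2 |E x| + (j - 1) |E x| \<le> 2 |E x| + |E y'|\<close>. The constants 8 and 2
  come from squaring this, and the layers are orthogonal.\<close>

lemma norm_spectral_integral_le:
  assumes f: "f \<in> borel_measurable borel" and g: "g \<in> borel_measurable borel"
    and xy: "(x, y) \<in> spectral_integral E f" and xy': "(x, y') \<in> spectral_integral E g"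
    and fg: "\<And>s. 0 \<le> f s" "\<And>s. f s \<le> 1 + g s"
  shows "(norm y)\<^sup>2 \<le> 8 * (norm x)\<^sup>2 + 2 * (norm y')\<^sup>2"
proof -
  define B where "B j = f -` {real j..<real j + 1}" for j :: nat
  have B: "B j \<in> sets borel" for j
    using measurable_sets_borel[OF f, of "{real j..<real j + 1}"] by (simp add: B_def)
  have rB: "range B \<subseteq> sets borel" using B by auto
  have dB: "disjoint_family B"
    unfolding disjoint_family_on_def
  proof (intro ballI impI)
    fix m n :: nat assume "m \<noteq> n"
    then have "real m + 1 \<le> real n \<or> real n + 1 \<le> real m" by linarith
    then show "B m \<inter> B n = {}" by (auto simp: B_def)
  qed
  have UB: "(\<Union>j. B j) = UNIV"
  proof -
    have "s \<in> B (nat \<lfloor>f s\<rfloor>)" for s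
      using fg(1)[of s] by (simp add: B_def of_nat_nat)
    then show ?thesis by blast
  qed
  have sums: "(\<lambda>j. (norm (E (B j) w))\<^sup>2) sums (norm w)\<^sup>2" for w
    using E_sums_norm[OF rB dB, of w] UB by simp
  have le: "(norm (E (B j) y))\<^sup>2 \<le> 8 * (norm (E (B j) x))\<^sup>2 + 2 * (norm (E (B j) y'))\<^sup>2" for j
  proof -
    let ?x = "norm (E (B j) x)" and ?y' = "norm (E (B j) y')"
    have "norm (E (B j) y) \<le> (real j + 1) * ?x"
      by (rule norm_E_spectral_integral_le[OF f xy B]) (use fg(1) in \<open>auto simp: B_def\<close>)
    moreover have "(real j - 1) * ?x \<le> ?y'"
    proof (rule norm_E_spectral_integral_ge[OF g xy' B])
      fix s assume "s \<in> B j"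
      then show "real j - 1 \<le> g s" using fg(2)[of s] by (auto simp: B_def)
    qed
    ultimately have "norm (E (B j) y) \<le> 2 * ?x + ?y'" by (simp add: algebra_simps)
    then have "(norm (E (B j) y))\<^sup>2 \<le> (2 * ?x + ?y')\<^sup>2" by (intro power_mono) auto
    also have "\<dots> \<le> 8 * ?x\<^sup>2 + 2 * ?y'\<^sup>2"
      using zero_le_power2[of "2 * ?x - ?y'"] by (simp add: power2_eq_square algebra_simps)
    finally show ?thesis .
  qed
  show ?thesis
    by (rule sums_le[OF le sums sums_add[OF sums_mult[OF sums] sums_mult[OF sums]]])
qed

text \<open>The layers \<open>D\<close> partition the line and the first \<open>n\<close> of them
  lie in the \<open>n\<close>-th cutoff set. So the squared error is at most the tail
  \<open>T n\<close> of the convergent series of the squared norms of the layers of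
  \<open>x\<close>.\<close>

lemma E_cutoff_tendsto:
  assumes f: "f \<in> borel_measurable borel"
  shows "(\<lambda>n. E {s. \<bar>f s\<bar> \<le> real n} x) \<longlonglongrightarrow> x"
proof -
  define C where "C n = {s. \<bar>f s\<bar> \<le> real n}" for n
  define D where "D n = {s. real n \<le> \<bar>f s\<bar> \<and> \<bar>f s\<bar> < real n + 1}" for n
  have [measurable]: "C n \<in> sets borel" "D n \<in> sets borel" for n
    using f unfolding C_def D_def by measurable
  have rD: "range D \<subseteq> sets borel" by auto
  have dD: "disjoint_family D"
    unfolding disjoint_family_on_def
  proof (intro ballI impI)
    fix m n :: nat assume "m \<noteq> n"
    then have "real m + 1 \<le> real n \<or> real n + 1 \<le> real m" by linarith
    then show "D m \<inter> D n = {}" by (auto simp: D_def)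
  qed
  have UD: "(\<Union>n. D n) = UNIV"
  proof -
    have "s \<in> D (nat \<lfloor>\<bar>f s\<bar>\<rfloor>)" for s
      by (simp add: D_def of_nat_nat)
    then show ?thesis by blast
  qed
  define T where "T n = (norm x)\<^sup>2 - (\<Sum>i<n. (norm (E (D i) x))\<^sup>2)" for n
  have lim: "T \<longlonglongrightarrow> 0"
  proof -
    have "(\<lambda>n. \<Sum>i<n. (norm (E (D i) x))\<^sup>2) \<longlonglongrightarrow> (norm x)\<^sup>2"
      using E_sums_norm[OF rD dD, of x] UD by (simp add: sums_def)
    from tendsto_diff[OF tendsto_const[of "(norm x)\<^sup>2"] this] show ?thesis
      unfolding T_def by simp
  qed
  have le: "(norm (E (C n) x - x))\<^sup>2 \<le> T n" for n
  proof -
    have sub: "(\<Sum>i<n. (norm (E (D i) x))\<^sup>2) \<le> (norm (E (C n) x))\<^sup>2"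
    proof -
      have "(\<Sum>i<n. (norm (E (D i) x))\<^sup>2) = (\<Sum>i<n. measure (\<mu> x) (D i))"
        by (simp add: measure_\<mu>)
      also have "\<dots> = measure (\<mu> x) (\<Union>i<n. D i)"
        using dD by (intro finite_measure_finite_Union[symmetric]) (auto simp: disjoint_family_on_def)
      also have "\<dots> \<le> measure (\<mu> x) (C n)"
      proof (rule finite_measure_mono)
        show "(\<Union>i<n. D i) \<subseteq> C n"
        proof
          fix s assume "s \<in> (\<Union>i<n. D i)"
          then obtain i where "i < n" "\<bar>f s\<bar> < real i + 1" by (auto simp: D_def)
          then show "s \<in> C n" by (auto simp: C_def)
        qed
      qed simp
      finally show ?thesis by (simp add: measure_\<mu>)
    qed
    have "(norm (E (C n) x - x))\<^sup>2 = (norm x)\<^sup>2 - (norm (E (C n) x))\<^sup>2"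
      using inner_E_self[of "C n" x]
      by (simp add: power2_norm_eq_inner inner_diff_left inner_diff_right inner_commute)
    with sub show ?thesis by (simp add: T_def)
  qed
  have "(\<lambda>n. (norm (E (C n) x - x))\<^sup>2) \<longlonglongrightarrow> 0"
    by (rule tendsto_sandwich[OF _ _ tendsto_const lim]) (use le in auto)
  then have "(\<lambda>n. norm (E (C n) x - x)) \<longlonglongrightarrow> 0"
    using tendsto_real_sqrt by fastforce
  then show ?thesis
    unfolding C_def by (simp add: LIM_zero_iff tendsto_norm_zero_iff)
qed

text \<open>The weak definition determines \<open>y\<close> only against the domain. This is enough
  because all cutoffs of \<open>y - y'\<close> lie in the domain and converge to
  \<open>y - y'\<close>.\<close>

lemma spectral_integral_unique:
  assumes f: "f \<in> borel_measurable borel"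
    and xy: "(x, y) \<in> spectral_integral E f" and xy': "(x, y') \<in> spectral_integral E f"
  shows "y = y'"
proof -
  have C: "{s. \<bar>f s\<bar> \<le> real n} \<in> sets borel" for n using f by measurable
  have "inner (y - y') (E {s. \<bar>f s\<bar> \<le> real n} (y - y')) = 0" for n
  proof -
    have "E {s. \<bar>f s\<bar> \<le> real n} (y - y') \<in> spectral_integral_dom E f"
      by (rule dom_bounded[OF f C, of _ "real n"]) (use C in auto)
    then have "inner y (E {s. \<bar>f s\<bar> \<le> real n} (y - y')) = inner y' (E {s. \<bar>f s\<bar> \<le> real n} (y - y'))"
      using spectral_integralD[OF xy] spectral_integralD[OF xy'] by fastforce
    then show ?thesis by (simp add: inner_diff_left)
  qed
  moreover have "(\<lambda>n. inner (y - y') (E {s. \<bar>f s\<bar> \<le> real n} (y - y'))) \<longlonglongrightarrow> inner (y - y') (y - y')"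
    by (intro tendsto_intros E_cutoff_tendsto f)
  ultimately show ?thesis by (simp add: LIMSEQ_const_iff)
qed

lemma spectral_integral_diff:
  assumes f: "f \<in> borel_measurable borel"
    and xy: "(x, y) \<in> spectral_integral E f" and xy': "(x', y') \<in> spectral_integral E f"
  shows "(x - x', y - y') \<in> spectral_integral E f"
proof -
  note x = spectral_integral_domD[OF xy] and x' = spectral_integral_domD[OF xy']
  \<comment> \<open>Additivity of the polarization, with negative terms moved across: both sides
    become sums of three squared norms, as the comparison of measures requires.\<close>
  have six: "(norm (a - b + c))\<^sup>2 + ((norm (a - c))\<^sup>2 + (norm (b + c))\<^sup>2) =
    (norm (a - b - c))\<^sup>2 + ((norm (a + c))\<^sup>2 + (norm (b - c))\<^sup>2)" for a b c :: 'a
    using norm_polar[of "a - b" c] norm_polar[of a c] norm_polar[of b c] by (simp add: inner_diff_left)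
  have "inner (y - y') z = ((\<integral>s. f s \<partial>\<mu> (x - x' + z)) - (\<integral>s. f s \<partial>\<mu> (x - x' - z))) / 4"
    if z: "z \<in> spectral_integral_dom E f" for z
  proof -
    have "(\<Sum>w\<leftarrow>[x - x' + z, x - z, x' + z]. \<integral>s. f s * indicator UNIV s \<partial>\<mu> w) =
       (\<Sum>w\<leftarrow>[x - x' - z, x + z, x' - z]. \<integral>s. f s * indicator UNIV s \<partial>\<mu> w)"
    proof (rule integral_sum_list_eq[OF f])
      fix B :: "real set" assume "B \<in> sets borel"
      then show "(\<Sum>w\<leftarrow>[x - x' + z, x - z, x' + z]. (norm (E B w))\<^sup>2) =
        (\<Sum>w\<leftarrow>[x - x' - z, x + z, x' - z]. (norm (E B w))\<^sup>2)"
        by (simp add: E_add E_diff six)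
    next
      fix w assume "w \<in> set [x - x' + z, x - z, x' + z] \<union> set [x - x' - z, x + z, x' - z]"
      then have "w \<in> spectral_integral_dom E f"
        using x x' z by (auto intro!: dom_add_diff f)
      then show "integrable (\<mu> w) (\<lambda>s. f s * indicator UNIV s)"
        by (intro integrable_dom f) auto
    qed simp
    moreover note spectral_integralD[OF xy z] spectral_integralD[OF xy' z]
    ultimately show ?thesis by (simp add: inner_diff_left)
  qed
  then show ?thesis
    using dom_add_diff(2)[OF f x x'] by (auto simp: spectral_integral_def)
qed

text \<open>The projection can be moved from \<open>x\<close> to the test vector: on
  \<open>B\<close>, the vectors \<open>x + E B z\<close> and \<open>E B x + z\<close> have the same
  measure, likewise with minus signs, and off \<open>B\<close> the measures of
  \<open>E B x + z\<close> and \<open>E B x - z\<close> agree and cancel.\<close>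

lemma spectral_integral_E:
  assumes f: "f \<in> borel_measurable borel" and xy: "(x, y) \<in> spectral_integral E f"
    and B: "B \<in> sets borel"
  shows "(E B x, E B y) \<in> spectral_integral E f"
proof -
  note x = spectral_integral_domD[OF xy]
  note x' = dom_E[OF f x B]
  have "inner (E B y) z = ((\<integral>s. f s \<partial>\<mu> (E B x + z)) - (\<integral>s. f s \<partial>\<mu> (E B x - z))) / 4"
    if z: "z \<in> spectral_integral_dom E f" for z
  proof -
    note z' = dom_E[OF f z B]
    have CB: "E C (E B w) = E C w" if "C \<in> sets borel" "C \<subseteq> B" for C w
      using that E_Int[OF that(1) B, of w] by (simp add: Int_absorb2)
    have CB': "E C (E B w) = 0" if "C \<in> sets borel" "C \<subseteq> - B" for C w
    proof -
      have "C \<inter> B = {}" using that by auto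
      then show ?thesis using E_Int[OF that(1) B, of w] by simp
    qed
    note d = dom_add_diff[OF f x z'] dom_add_diff[OF f x' z]
    have p: "(\<Sum>w\<leftarrow>[x + E B z]. \<integral>s. f s * indicator B s \<partial>\<mu> w) = (\<Sum>w\<leftarrow>[E B x + z]. \<integral>s. f s * indicator B s \<partial>\<mu> w)"
      "(\<Sum>w\<leftarrow>[x - E B z]. \<integral>s. f s * indicator B s \<partial>\<mu> w) = (\<Sum>w\<leftarrow>[E B x - z]. \<integral>s. f s * indicator B s \<partial>\<mu> w)"
      "(\<Sum>w\<leftarrow>[E B x + z]. \<integral>s. f s * indicator (- B) s \<partial>\<mu> w) = (\<Sum>w\<leftarrow>[E B x - z]. \<integral>s. f s * indicator (- B) s \<partial>\<mu> w)"
      using B d by (intro integral_sum_list_eq f; auto simp: E_add E_diff CB CB' intro!: integrable_dom f)+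
    have "4 * inner (E B y) z = 4 * inner y (E B z)" using B by (simp add: inner_E)
    also have "\<dots> = (\<integral>s. f s \<partial>\<mu> (E B x + z)) - (\<integral>s. f s \<partial>\<mu> (E B x - z))"
      using inner_spectral_integral[OF f xy z' B] B p
      by (simp add: integral_split[OF f d(3) B] integral_split[OF f d(4) B])
    finally show ?thesis by simp
  qed
  then show ?thesis using x' by (auto simp: spectral_integral_def)
qed

end

section \<open>Rapidly growing eigenvalues and powers of the operator\<close>

locale orthonormal_sequence =
  fixes e :: "nat \<Rightarrow> 'a::{real_inner, complete_space}"
  assumes orth: "inner (e i) (e j) = (if i = j then 1 else 0)"
begin

definition S :: "'a set" where "S = closure (span (range e))"

definition synth :: "(nat \<Rightarrow> real) \<Rightarrow> 'a" where "synth a = (\<Sum>k. a k *\<^sub>R e k)"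

lemma inner_sum_e: "finite F \<Longrightarrow> inner (\<Sum>k\<in>F. a k *\<^sub>R e k) (e j) = (if j \<in> F then a j else 0)"
  by (simp add: inner_sum_left orth if_distrib[where f="(*) _"] cong: if_cong)

lemma norm_sum_e: "finite F \<Longrightarrow> (norm (\<Sum>k\<in>F. a k *\<^sub>R e k))\<^sup>2 = (\<Sum>k\<in>F. (a k)\<^sup>2)"
  unfolding power2_norm_eq_inner
  by (simp add: inner_sum_right inner_sum_e power2_eq_square cong: sum.cong)

text \<open>Completing the square. With the Fourier coefficients as \<open>a\<close> this yields
  Bessel's inequality, with other \<open>a\<close> the best approximation property.\<close>

lemma norm_best_approx:
  assumes "finite F"
  shows "(norm (x - (\<Sum>k\<in>F. a k *\<^sub>R e k)))\<^sup>2 =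
    (norm x)\<^sup>2 - (\<Sum>k\<in>F. (inner x (e k))\<^sup>2) + (\<Sum>k\<in>F. (inner x (e k) - a k)\<^sup>2)"
proof -
  have "(norm (x - (\<Sum>k\<in>F. a k *\<^sub>R e k)))\<^sup>2 =
    (norm x)\<^sup>2 - 2 * inner x (\<Sum>k\<in>F. a k *\<^sub>R e k) + (norm (\<Sum>k\<in>F. a k *\<^sub>R e k))\<^sup>2"
    by (simp add: power2_norm_eq_inner inner_diff_left inner_diff_right inner_commute)
  also have "inner x (\<Sum>k\<in>F. a k *\<^sub>R e k) = (\<Sum>k\<in>F. a k * inner x (e k))"
    by (simp add: inner_sum_right)
  also have "(norm (\<Sum>k\<in>F. a k *\<^sub>R e k))\<^sup>2 = (\<Sum>k\<in>F. (a k)\<^sup>2)"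
    by (rule norm_sum_e[OF assms])
  finally show ?thesis
    by (simp add: power2_diff sum.distrib sum_subtractf sum_distrib_left mult.assoc mult.left_commute mult.commute)
qed

lemma bessel: "(\<Sum>k<n. (inner x (e k))\<^sup>2) \<le> (norm x)\<^sup>2"
proof -
  have "0 \<le> (norm (x - (\<Sum>k<n. inner x (e k) *\<^sub>R e k)))\<^sup>2" by simp
  then show ?thesis by (subst (asm) norm_best_approx) auto
qed

lemma summable_coeff: "summable (\<lambda>k. (inner x (e k))\<^sup>2)"
  using bessel by (intro summableI_nonneg_bounded) auto

lemma sums_synth:
  assumes "summable (\<lambda>k. (a k)\<^sup>2)"
  shows "(\<lambda>k. a k *\<^sub>R e k) sums synth a"
proof -
  define s where "s n = (\<Sum>k<n. a k *\<^sub>R e k)" for n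
  have "Cauchy s"
  proof (rule CauchyI')
    fix \<epsilon> :: real assume "\<epsilon> > 0"
    then have "\<epsilon>\<^sup>2 > 0" by simp
    with assms obtain N where N: "\<And>m n. m \<ge> N \<Longrightarrow> \<bar>\<Sum>k=m..<n. (a k)\<^sup>2\<bar> < \<epsilon>\<^sup>2"
      unfolding summable_Cauchy by (metis real_norm_def)
    show "\<exists>M. \<forall>m\<ge>M. \<forall>n>m. dist (s m) (s n) < \<epsilon>"
    proof (intro exI allI impI)
      fix m n assume mn: "m \<ge> N" "m < n"
      have "s n - s m = (\<Sum>k=m..<n. a k *\<^sub>R e k)"
        using mn unfolding s_def
        by (subst sum_diff[symmetric]) (auto intro!: arg_cong2[where f=sum] simp: set_eq_iff)
      then have "(norm (s n - s m))\<^sup>2 < \<epsilon>\<^sup>2"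
        using N[OF mn(1), of n] by (simp add: norm_sum_e)
      then show "dist (s m) (s n) < \<epsilon>"
        using \<open>\<epsilon> > 0\<close> by (simp add: dist_norm norm_minus_commute power2_less_imp_less)
    qed
  qed
  then have "convergent s" by (rule Cauchy_convergent)
  then have "summable (\<lambda>k. a k *\<^sub>R e k)"
    by (simp add: summable_iff_convergent s_def[abs_def])
  then show ?thesis unfolding synth_def by (rule summable_sums)
qed

lemma sums_in_S:
  assumes "(\<lambda>k. a k *\<^sub>R e k) sums x"
  shows "x \<in> S"
  unfolding S_def closure_sequential
  using assms unfolding sums_def
  by (intro exI[of _ "\<lambda>n. \<Sum>k<n. a k *\<^sub>R e k"]) (auto intro!: span_sum span_scale intro: span_base)

lemma sums_inner:
  assumes "(\<lambda>k. a k *\<^sub>R e k) sums x"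
  shows "(\<lambda>k. a k * inner (e k) z) sums inner x z"
  using bounded_linear.sums[OF bounded_linear_inner_left assms, of z] by simp

lemma sums_coeff:
  assumes "(\<lambda>k. a k *\<^sub>R e k) sums x"
  shows "inner x (e j) = a j"
proof -
  have "(\<lambda>k. a k * inner (e k) (e j)) sums inner x (e j)"
    by (rule sums_inner[OF assms])
  moreover have "(\<lambda>k. a k * inner (e k) (e j)) sums (\<Sum>k\<in>{j}. a k * inner (e k) (e j))"
    by (rule sums_finite) (auto simp: orth)
  ultimately show ?thesis using sums_unique2 by (fastforce simp: orth)
qed

lemma synth_in_S: "summable (\<lambda>k. (a k)\<^sup>2) \<Longrightarrow> synth a \<in> S"
  by (rule sums_in_S[OF sums_synth])

lemma inner_synth: "summable (\<lambda>k. (a k)\<^sup>2) \<Longrightarrow> inner (synth a) (e j) = a j"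
  by (rule sums_coeff[OF sums_synth])

text \<open>Some finite combination of the \<open>e k\<close> is close to \<open>x\<close>, and the
  Fourier sums that contain its index set are at least as close.\<close>

lemma sums_S:
  assumes "x \<in> S"
  shows "(\<lambda>k. inner x (e k) *\<^sub>R e k) sums x"
proof -
  define s where "s n = (\<Sum>k<n. inner x (e k) *\<^sub>R e k)" for n
  have "s \<longlonglongrightarrow> x"
  proof (rule LIMSEQ_I)
    fix \<epsilon> :: real assume \<epsilon>: "\<epsilon> > 0"
    with assms obtain y where y: "y \<in> span (range e)" "dist y x < \<epsilon>"
      unfolding S_def closure_approachable by blast
    from y(1) obtain F a where F: "finite F" "F \<subseteq> range e" "y = (\<Sum>v\<in>F. a v *\<^sub>R v)"
      by (auto simp: span_explicit)
    obtain I where I: "finite I" "F = e ` I"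
      using finite_subset_image[OF F(1,2)] by blast
    have inj: "inj e"
      by (rule injI) (metis orth zero_neq_one)
    obtain N where N: "I \<subseteq> {..<N}" using I(1) finite_nat_iff_bounded by blast
    show "\<exists>N. \<forall>n\<ge>N. norm (s n - x) < \<epsilon>"
    proof (intro exI allI impI)
      fix n assume n: "n \<ge> N"
      \<comment> \<open>Padding with zeros puts the combination on the index range of the Fourier
        sum, so that \<open>norm_best_approx\<close> applies to both.\<close>
      define b where "b k = (if k \<in> I then a (e k) else 0)" for k
      have "y = (\<Sum>k\<in>I. a (e k) *\<^sub>R e k)"
        unfolding F(3) I(2) using inj by (subst sum.reindex) (auto intro: inj_on_subset)
      also have "\<dots> = (\<Sum>k<n. b k *\<^sub>R e k)"
        using N n by (intro sum.mono_neutral_cong_left) (auto simp: b_def)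
      finally have "(norm (x - y))\<^sup>2 = (norm x)\<^sup>2 - (\<Sum>k<n. (inner x (e k))\<^sup>2) + (\<Sum>k<n. (inner x (e k) - b k)\<^sup>2)"
        by (simp add: norm_best_approx)
      moreover have "(norm (x - s n))\<^sup>2 = (norm x)\<^sup>2 - (\<Sum>k<n. (inner x (e k))\<^sup>2)"
        unfolding s_def by (simp add: norm_best_approx)
      ultimately have "(norm (x - s n))\<^sup>2 \<le> (norm (x - y))\<^sup>2"
        by (simp add: sum_nonneg)
      then have "norm (x - s n) \<le> norm (x - y)" by (rule power2_le_imp_le) simp
      then show "norm (s n - x) < \<epsilon>" using y(2) by (simp add: dist_norm norm_minus_commute)
    qed
  qed
  then show ?thesis by (simp add: sums_def s_def[abs_def])
qed

lemma synth_coeff: "x \<in> S \<Longrightarrow> synth (\<lambda>k. inner x (e k)) = x"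
  using sums_S[of x] by (simp add: synth_def sums_iff)

lemma inner_S_sums: "x \<in> S \<Longrightarrow> (\<lambda>k. inner x (e k) * inner z (e k)) sums inner x z"
  using sums_inner[OF sums_S[of x], of z] by (simp add: inner_commute)

lemma norm_S_sums: "x \<in> S \<Longrightarrow> (\<lambda>k. (inner x (e k))\<^sup>2) sums (norm x)\<^sup>2"
  using inner_S_sums[of x x] by (simp add: power2_eq_square[symmetric] power2_norm_eq_inner)

lemma norm_synth_sums: "summable (\<lambda>k. (a k)\<^sup>2) \<Longrightarrow> (\<lambda>k. (a k)\<^sup>2) sums (norm (synth a))\<^sup>2"
  using norm_S_sums[OF synth_in_S, of a] by (simp add: inner_synth)

lemma synth_diff:
  assumes "summable (\<lambda>k. (a k)\<^sup>2)" "summable (\<lambda>k. (b k)\<^sup>2)"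
  shows "synth a - synth b = synth (\<lambda>k. a k - b k)"
  using sums_diff[OF sums_synth[OF assms(1)] sums_synth[OF assms(2)]]
  by (simp add: synth_def scaleR_diff_left[symmetric] sums_iff)

lemma synth_scale:
  assumes "summable (\<lambda>k. (a k)\<^sup>2)"
  shows "r *\<^sub>R synth a = synth (\<lambda>k. r * a k)"
  using bounded_linear.sums[OF bounded_linear_scaleR_right sums_synth[OF assms], of r]
  by (simp add: synth_def sums_iff)

end

context pvm
begin

text \<open>Testing against \<open>E B x\<close> shows that the integral of \<open>s - l\<close>
  over \<open>B\<close> vanishes. If \<open>s - l\<close> has a strict sign on \<open>B\<close>,
  then \<open>B\<close> is a null set; this applies to the two open half-lines beside
  \<open>l\<close>.\<close>

lemma E_eigenvector:
  assumes "(x, l *\<^sub>R x) \<in> spectral_integral E (\<lambda>s. s)"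
  shows "E {l} x = x"
proof -
  have z: "E B x = 0" if B: "B \<in> sets borel" and sg: "(\<forall>s\<in>B. s > l) \<or> (\<forall>s\<in>B. s < l)" for B
  proof -
    let ?M = "\<mu> (2 *\<^sub>R x)"
    have x2: "2 *\<^sub>R x \<in> spectral_integral_dom E (\<lambda>s. s)"
      by (rule dom_scale[OF _ spectral_integral_domD[OF assms]]) simp
    have i1: "integrable ?M (\<lambda>s. s * indicator B s)"
      by (rule integrable_dom(2)[OF _ x2 B]) simp
    have i2: "integrable ?M (\<lambda>s. l * indicator B s)"
      using B by (intro integrable_mult_right integrable_real_indicator) (auto simp: emeasure_\<mu>)
    have "(\<integral>s. s * indicator B s \<partial>?M) = 4 * (l * inner x (E B x))"
      using inner_E_spectral_integral[OF _ assms B] by simp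
    also have "inner x (E B x) = (norm (E B x))\<^sup>2"
      using inner_E_self[OF B, of x] by (simp add: inner_commute)
    also have "4 * (l * (norm (E B x))\<^sup>2) = (\<integral>s. l * indicator B s \<partial>?M)"
      using B by (simp add: measure_\<mu> E_scale power_mult_distrib)
    finally have "(\<integral>s. (s - l) * indicator B s \<partial>?M) = 0"
      using i1 i2 by (simp add: left_diff_distrib Bochner_Integration.integral_diff)
    moreover have i: "integrable ?M (\<lambda>s. (s - l) * indicator B s)"
      using i1 i2 by (simp add: left_diff_distrib)
    ultimately have "AE s in ?M. s \<notin> B"
      using sg
    proof (elim disjE)
      assume 0: "(\<integral>s. (s - l) * indicator B s \<partial>?M) = 0" and pos: "\<forall>s\<in>B. s > l"
      have "AE s in ?M. 0 \<le> (s - l) * indicator B s"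
        using pos by (intro AE_I2) (auto simp: indicator_def less_imp_le)
      from integral_nonneg_eq_0_iff_AE[OF i this] 0
      have "AE s in ?M. (s - l) * indicator B s = 0" by simp
      then show ?thesis by eventually_elim (use pos in \<open>auto simp: indicator_def split: if_splits\<close>)
    next
      assume 0: "(\<integral>s. (s - l) * indicator B s \<partial>?M) = 0" and neg: "\<forall>s\<in>B. s < l"
      have "AE s in ?M. 0 \<le> - ((s - l) * indicator B s)"
        using neg by (intro AE_I2) (auto simp: indicator_def less_imp_le)
      from integral_nonneg_eq_0_iff_AE[OF integrable_minus[OF i] this] 0
      have "AE s in ?M. (s - l) * indicator B s = 0" by simp
      then show ?thesis by eventually_elim (use neg in \<open>auto simp: indicator_def split: if_splits\<close>)
    qed
    then have "emeasure ?M B = 0"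
      using B by (simp add: AE_iff_measurable[of B] )
    then show ?thesis using B by (simp add: emeasure_\<mu> E_scale)
  qed
  have "E ({l} \<union> ({..<l} \<union> {l<..})) x = E {l} x"
  proof -
    \<comment> \<open>Finite additivity is recovered from the countable one by padding with empty
      sets.\<close>
    have f: "(\<lambda>i. E (binaryset {l} ({..<l} \<union> {l<..}) i) x) sums E (\<Union>i. binaryset {l} ({..<l} \<union> {l<..}) i) x"
      by (rule E_sums) (auto simp: binaryset_def disjoint_family_on_def)
    have f': "(\<lambda>i. E (binaryset {..<l} {l<..} i) x) sums E (\<Union>i. binaryset {..<l} {l<..} i) x"
      by (rule E_sums) (auto simp: binaryset_def disjoint_family_on_def)
    have "E ({..<l} \<union> {l<..}) x = E {..<l} x + E {l<..} x"
      using sums_unique2[OF f' sums_finite[of "{0, 1}"]] by (simp add: UN_binaryset_eq binaryset_def)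
    also have "\<dots> = 0" by (simp add: z)
    finally show ?thesis
      using sums_unique2[OF f sums_finite[of "{0, 1}"]] by (simp add: UN_binaryset_eq binaryset_def)
  qed
  moreover have "{l} \<union> ({..<l} \<union> {l<..}) = (UNIV :: real set)" by auto
  ultimately show ?thesis by (metis E_UNIV)
qed

end

section \<open>The eigenvalue gap\<close>

locale gap_spectrum =
  fixes lam :: "nat \<Rightarrow> real"
  assumes lam_nonneg: "lam k \<ge> 0" and lam_Suc: "lam (Suc k) \<ge> exp (lam k)"
begin

lemma lam_less: "lam k < lam (Suc k)"
  using lam_Suc[of k] exp_ge_add_one_self[of "lam k"] by linarith

lemma lam_strict_mono: "strict_mono lam"
  using lam_less by (rule strict_monoI_Suc)

lemma lam_mono: "i \<le> j \<Longrightarrow> lam i \<le> lam j"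
  using lam_strict_mono by (simp add: strict_mono_less_eq)

lemma lam_sq_eq_iff: "(lam i)\<^sup>2 = (lam j)\<^sup>2 \<longleftrightarrow> i = j"
  using lam_strict_mono by (simp add: power2_eq_iff_nonneg lam_nonneg strict_mono_eq)

lemma lam_ge: "real k \<le> lam k"
proof (induct k)
  case (Suc k)
  then have "real k + 1 \<le> lam (Suc k)"
    using lam_Suc[of k] exp_ge_add_one_self[of "lam k"] by linarith
  then show ?case by simp
qed (simp add: lam_nonneg)

end

section \<open>Spectral integrals on the eigenvectors and on \<open>S\<close>\<close>

locale spectral_setting = pvm E + orthonormal_sequence e + gap_spectrum lam
  for E :: "real set \<Rightarrow> 'a::{real_inner, complete_space} \<Rightarrow> 'a" and e :: "nat \<Rightarrow> 'a" and lam :: "nat \<Rightarrow> real" +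
  fixes A :: "'a operator"
  assumes A_eq: "A = spectral_integral E (\<lambda>s. s)"
    and eig: "(e k, (lam k)\<^sup>2 *\<^sub>R e k) \<in> A"
begin

lemma E_point: "E {(lam k)\<^sup>2} (e k) = e k"
  using E_eigenvector eig[of k] by (simp add: A_eq)

definition spec where "spec = range (\<lambda>k. (lam k)\<^sup>2)"

lemma spec_borel [measurable]: "spec \<in> sets borel"
  unfolding spec_def by (rule sets.countable) simp_all

lemma E_spec_compl:
  assumes x: "x \<in> S" and C: "C \<in> sets borel" "C \<subseteq> - spec"
  shows "E C x = 0"
proof -
  have "E C (e k) = 0" for k
  proof -
    have "C \<inter> {(lam k)\<^sup>2} = {}" using C by (auto simp: spec_def)
    then show ?thesis using E_Int[OF C(1), of "{(lam k)\<^sup>2}" "e k"] by (simp add: E_point)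
  qed
  then have "(\<lambda>k. E C (inner x (e k) *\<^sub>R e k)) = (\<lambda>k. 0)"
    using C by (simp add: E_scale)
  moreover have "(\<lambda>k. E C (inner x (e k) *\<^sub>R e k)) sums E C x"
    by (rule bounded_linear.sums[OF bounded_linear_E[OF C(1)] sums_S[OF x]])
  ultimately show ?thesis using sums_unique2 sums_zero by metis
qed

lemma E_e:
  assumes C: "C \<in> sets borel"
  shows "E C (e k) = (if (lam k)\<^sup>2 \<in> C then e k else 0)"
proof -
  have "E C (e k) = E (C \<inter> {(lam k)\<^sup>2}) (e k)"
    using E_Int[OF C, of "{(lam k)\<^sup>2}" "e k"] by (simp add: E_point)
  also have "C \<inter> {(lam k)\<^sup>2} = (if (lam k)\<^sup>2 \<in> C then {(lam k)\<^sup>2} else {})" by auto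
  finally show ?thesis by (simp add: E_point)
qed

lemma E_point_S:
  assumes x: "x \<in> S"
  shows "E {(lam k)\<^sup>2} x = inner x (e k) *\<^sub>R e k"
proof -
  have "(\<lambda>j. E {(lam k)\<^sup>2} (inner x (e j) *\<^sub>R e j)) sums E {(lam k)\<^sup>2} x"
    by (rule bounded_linear.sums[OF bounded_linear_E sums_S[OF x]]) simp
  moreover have "(\<lambda>j. E {(lam k)\<^sup>2} (inner x (e j) *\<^sub>R e j)) sums
    (\<Sum>j\<in>{k}. E {(lam k)\<^sup>2} (inner x (e j) *\<^sub>R e j))"
    by (rule sums_finite) (auto simp: E_scale E_e lam_sq_eq_iff)
  ultimately show ?thesis
    using sums_unique2 by (fastforce simp: E_scale E_point)
qed

lemma integral_point:
  "(\<integral>s. f s * indicator {p} s \<partial>\<mu> w) = f p * (norm (E {p} w))\<^sup>2" for f :: "real \<Rightarrow> real"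
proof -
  have "(\<integral>s. f s * indicator {p} s \<partial>\<mu> w) = (\<integral>s. f p * indicator {p} s \<partial>\<mu> w)"
    by (intro Bochner_Integration.integral_cong) (auto simp: indicator_def)
  then show ?thesis by (simp add: measure_\<mu>)
qed

text \<open>As \<open>f\<close> may change sign, the passage from finitely many eigenvalues to all
  of them is by dominated convergence with majorant \<open>\<bar>f\<bar>\<close>.\<close>

lemma integral_points_tendsto:
  assumes f: "f \<in> borel_measurable borel" and w: "w \<in> spectral_integral_dom E f"
  shows "(\<lambda>n. \<Sum>k<n. f ((lam k)\<^sup>2) * (norm (E {(lam k)\<^sup>2} w))\<^sup>2) \<longlonglongrightarrow> (\<integral>s. f s * indicator spec s \<partial>\<mu> w)"
proof -
  note [measurable] = f
  define P where "P n = (\<lambda>k. (lam k)\<^sup>2) ` {..<n}" for n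
  have [measurable]: "P n \<in> sets borel" for n
    unfolding P_def by (rule sets.countable) (simp_all add: countable_finite)
  have ind: "f s * indicator (P n) s = (\<Sum>k<n. f s * indicator {(lam k)\<^sup>2} s)" for n s
  proof -
    have "indicator (P n) s = (\<Sum>k<n. indicator {(lam k)\<^sup>2} s :: real)"
      unfolding P_def
      by (subst indicator_UN_disjoint[symmetric])
        (auto simp: disjoint_family_on_def lam_sq_eq_iff indicator_def)
    then show ?thesis by (simp add: sum_distrib_left)
  qed
  have "(\<Sum>k<n. f ((lam k)\<^sup>2) * (norm (E {(lam k)\<^sup>2} w))\<^sup>2) = (\<integral>s. f s * indicator (P n) s \<partial>\<mu> w)" for n
    unfolding ind integral_point[symmetric]
    by (rule Bochner_Integration.integral_sum[symmetric]) (auto intro!: integrable_dom f w)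
  moreover have "(\<lambda>n. \<integral>s. f s * indicator (P n) s \<partial>\<mu> w) \<longlonglongrightarrow> (\<integral>s. f s * indicator spec s \<partial>\<mu> w)"
  proof (rule integral_dominated_convergence)
    show "integrable (\<mu> w) (\<lambda>s. \<bar>f s\<bar>)"
      using integrable_dom(1)[OF f w sets.empty_sets] by (rule integrable_abs)
    show "AE s in \<mu> w. (\<lambda>n. f s * indicator (P n) s) \<longlonglongrightarrow> f s * indicator spec s"
    proof (rule AE_I2)
      fix s
      have "\<forall>\<^sub>F n in sequentially. indicator (P n) s = (indicator spec s :: real)"
      proof (cases "s \<in> spec")
        case True
        then obtain k where "s = (lam k)\<^sup>2" by (auto simp: spec_def)
        then have "s \<in> P n" if "n \<ge> Suc k" for n using that by (auto simp: P_def)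
        then show ?thesis using True by (auto simp: eventually_sequentially intro!: exI[of _ "Suc k"])
      next
        case False
        then have "s \<notin> P n" for n by (auto simp: P_def spec_def)
        then show ?thesis using False by simp
      qed
      then show "(\<lambda>n. f s * indicator (P n) s) \<longlonglongrightarrow> f s * indicator spec s"
        by (intro tendsto_mult tendsto_const tendsto_eventually) auto
    qed
  qed (auto simp: indicator_def)
  ultimately show ?thesis by simp
qed

text \<open>The test vector \<open>e k\<close> sees only the atom at \<open>(lam k)\<^sup>2\<close>.
  The vector \<open>x\<close> may lie outside \<open>S\<close>, which matters for a competing
  solution whose values are not yet known to be in \<open>S\<close>.\<close>

lemma coeff_spectral_integral:
  assumes f: "f \<in> borel_measurable borel" and xy: "(x, y) \<in> spectral_integral E f"
  shows "inner y (e k) = f ((lam k)\<^sup>2) * inner x (e k)"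
proof -
  let ?p = "(lam k)\<^sup>2"
  have ek: "e k \<in> spectral_integral_dom E f"
    by (rule dom_bounded[OF f, of "{?p}" "\<bar>f ?p\<bar>"]) (auto simp: E_point)
  have "4 * inner y (e k) = f ?p * ((norm (E {?p} (x + e k)))\<^sup>2 - (norm (E {?p} (x - e k)))\<^sup>2)"
    using inner_spectral_integral[OF f xy ek, of "{?p}"]
    by (simp add: E_point integral_point right_diff_distrib)
  also have "(norm (E {?p} (x + e k)))\<^sup>2 - (norm (E {?p} (x - e k)))\<^sup>2 = 4 * inner (E {?p} x) (e k)"
    by (simp add: E_add E_diff E_point norm_polar)
  also have "inner (E {?p} x) (e k) = inner x (e k)"
    by (simp add: inner_E E_point)
  finally show ?thesis by simp
qed

text \<open>The measure of \<open>x\<close> lives on the countable set \<open>spec\<close>, so its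
  second moment is the given series. In the polarized difference only \<open>spec\<close>
  contributes, since off \<open>spec\<close> the measures of \<open>x + z\<close> and
  \<open>x - z\<close> agree; on \<open>spec\<close> each atom contributes a product of
  coefficients.\<close>

lemma S_spectral_integral:
  assumes f: "f \<in> borel_measurable borel" and x: "x \<in> S"
    and sm: "summable (\<lambda>k. (f ((lam k)\<^sup>2) * inner x (e k))\<^sup>2)"
  shows "(x, synth (\<lambda>k. f ((lam k)\<^sup>2) * inner x (e k))) \<in> spectral_integral E f"
proof -
  note [measurable] = f
  let ?p = "\<lambda>k. (lam k)\<^sup>2"
  let ?y = "synth (\<lambda>k. f (?p k) * inner x (e k))"
  have xd: "x \<in> spectral_integral_dom E f"
  proof -
    have "emeasure (\<mu> x) (- spec) = 0"
      using E_spec_compl[OF x, of "- spec"] by (simp add: emeasure_\<mu>)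
    then have "AE s in \<mu> x. s \<in> spec"
      by (intro AE_I[of _ _ "- spec"]) auto
    then have "AE s in \<mu> x. ennreal ((f s)\<^sup>2) = (\<Sum>k. ennreal ((f (?p k))\<^sup>2) * indicator {?p k} s)"
    proof eventually_elim
      case (elim s)
      then obtain j where j: "s = ?p j" by (auto simp: spec_def)
      have "(\<Sum>k. ennreal ((f (?p k))\<^sup>2) * indicator {?p k} s) = (\<Sum>k\<in>{j}. ennreal ((f (?p k))\<^sup>2) * indicator {?p k} s)"
        by (rule suminf_finite) (auto simp: j lam_sq_eq_iff indicator_def)
      then show ?case by (simp add: j)
    qed
    then have "(\<integral>\<^sup>+s. ennreal ((f s)\<^sup>2) \<partial>\<mu> x) = (\<integral>\<^sup>+s. (\<Sum>k. ennreal ((f (?p k))\<^sup>2) * indicator {?p k} s) \<partial>\<mu> x)"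
      by (rule nn_integral_cong_AE)
    also have "\<dots> = (\<Sum>k. \<integral>\<^sup>+s. ennreal ((f (?p k))\<^sup>2) * indicator {?p k} s \<partial>\<mu> x)"
      by (rule nn_integral_suminf) simp
    also have "\<dots> = (\<Sum>k. ennreal ((f (?p k) * inner x (e k))\<^sup>2))"
      by (simp add: nn_integral_cmult_indicator emeasure_\<mu> E_point_S[OF x] ennreal_mult[symmetric]
          power_mult_distrib orth norm_eq_sqrt_inner)
    also have "\<dots> = ennreal (\<Sum>k. (f (?p k) * inner x (e k))\<^sup>2)"
      by (rule suminf_ennreal2) (use sm in auto)
    finally show ?thesis by (simp add: dom_iff[OF f])
  qed
  moreover have "inner ?y z = ((\<integral>s. f s \<partial>\<mu> (x + z)) - (\<integral>s. f s \<partial>\<mu> (x - z))) / 4"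
    if z: "z \<in> spectral_integral_dom E f" for z
  proof -
    note d = dom_add_diff[OF f xd z]
    have "(\<Sum>w\<leftarrow>[x + z]. \<integral>s. f s * indicator (- spec) s \<partial>\<mu> w) = (\<Sum>w\<leftarrow>[x - z]. \<integral>s. f s * indicator (- spec) s \<partial>\<mu> w)"
    proof (rule integral_sum_list_eq[OF f])
      fix B :: "real set" assume B: "B \<in> sets borel" "B \<subseteq> - spec"
      show "(\<Sum>w\<leftarrow>[x + z]. (norm (E B w))\<^sup>2) = (\<Sum>w\<leftarrow>[x - z]. (norm (E B w))\<^sup>2)"
        using E_spec_compl[OF x B] by (simp add: E_add[OF B(1)] E_diff[OF B(1)])
    next
      fix w assume "w \<in> set [x + z] \<union> set [x - z]"
      then have "w \<in> spectral_integral_dom E f" using d by auto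
      then show "integrable (\<mu> w) (\<lambda>s. f s * indicator (- spec) s)"
        by (rule integrable_dom(2)[OF f]) simp
    qed simp
    then have d1: "(\<integral>s. f s \<partial>\<mu> (x + z)) - (\<integral>s. f s \<partial>\<mu> (x - z)) =
      (\<integral>s. f s * indicator spec s \<partial>\<mu> (x + z)) - (\<integral>s. f s * indicator spec s \<partial>\<mu> (x - z))"
      by (simp add: integral_split[OF f d(1) spec_borel] integral_split[OF f d(2) spec_borel])
    have d2: "(\<lambda>n. 4 * (\<Sum>k<n. f (?p k) * inner x (e k) * inner (e k) z)) \<longlonglongrightarrow>
      (\<integral>s. f s * indicator spec s \<partial>\<mu> (x + z)) - (\<integral>s. f s * indicator spec s \<partial>\<mu> (x - z))"
    proof -
      have "f (?p k) * (norm (E {?p k} (x + z)))\<^sup>2 - f (?p k) * (norm (E {?p k} (x - z)))\<^sup>2 =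
         4 * (f (?p k) * inner x (e k) * inner (e k) z)" for k
      proof -
        have "(norm (E {?p k} (x + z)))\<^sup>2 - (norm (E {?p k} (x - z)))\<^sup>2 = 4 * inner (E {?p k} x) (E {?p k} z)"
          by (simp add: E_add E_diff norm_polar)
        also have "inner (E {?p k} x) (E {?p k} z) = inner (E {?p k} (E {?p k} x)) z"
          by (simp only: inner_E[OF borel_singleton[OF sets.empty_sets]])
        also have "\<dots> = inner x (e k) * inner (e k) z"
          by (simp add: E_point_S[OF x] E_scale E_point)
        finally show ?thesis by (simp only: right_diff_distrib[symmetric] mult_ac)
      qed
      then have "4 * (\<Sum>k<n. f (?p k) * inner x (e k) * inner (e k) z) =
        (\<Sum>k<n. f (?p k) * (norm (E {?p k} (x + z)))\<^sup>2) - (\<Sum>k<n. f (?p k) * (norm (E {?p k} (x - z)))\<^sup>2)" for n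
        by (simp only: sum_subtractf[symmetric] sum_distrib_left)
      then show ?thesis
        using tendsto_diff[OF integral_points_tendsto[OF f d(1)] integral_points_tendsto[OF f d(2)]] by simp
    qed
    have d3: "(\<lambda>n. 4 * (\<Sum>k<n. f (?p k) * inner x (e k) * inner (e k) z)) \<longlonglongrightarrow> 4 * inner ?y z"
      using sums_inner[OF sums_synth[OF sm], of z] unfolding sums_def by (rule tendsto_mult_left)
    show ?thesis using LIMSEQ_unique[OF d2 d3] d1 by simp
  qed
  ultimately show ?thesis by (auto simp: spectral_integral_def)
qed

end

section \<open>Differential inequalities and ordinary differential systems\<close>

text \<open>The upper right Dini derivative of \<open>f\<close> at \<open>t\<close> is at most
  \<open>d\<close>. The form with \<open>\<epsilon>\<close> avoids limits superior and adds up like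
  an ordinary derivative.\<close>

definition dini_le :: "(real \<Rightarrow> real) \<Rightarrow> real \<Rightarrow> real \<Rightarrow> bool" where
  "dini_le f d t \<longleftrightarrow> (\<forall>\<epsilon>>0. \<forall>\<^sub>F s in at_right t. f s \<le> f t + (d + \<epsilon>) * (s - t))"

lemma dini_leD: "dini_le f d t \<Longrightarrow> \<epsilon> > 0 \<Longrightarrow> \<forall>\<^sub>F s in at_right t. f s \<le> f t + (d + \<epsilon>) * (s - t)"
  by (simp add: dini_le_def)

lemma dini_le_mono:
  assumes "dini_le f d t" "d \<le> d'"
  shows "dini_le f d' t"
  unfolding dini_le_def
proof (intro allI impI)
  fix \<epsilon> :: real assume "\<epsilon> > 0"
  from dini_leD[OF assms(1) this] eventually_at_right_less[of t]
  show "\<forall>\<^sub>F s in at_right t. f s \<le> f t + (d' + \<epsilon>) * (s - t)"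
  proof eventually_elim
    case (elim s)
    have "(d + \<epsilon>) * (s - t) \<le> (d' + \<epsilon>) * (s - t)"
      using elim assms(2) by (intro mult_right_mono) auto
    then show ?case using elim by linarith
  qed
qed

lemma dini_le_deriv:
  assumes "(f has_real_derivative d) (at_right t)"
  shows "dini_le f d t"
  unfolding dini_le_def
proof (intro allI impI)
  fix \<epsilon> :: real assume "\<epsilon> > 0"
  from assms have "((\<lambda>s. (f s - f t) / (s - t)) \<longlongrightarrow> d) (at_right t)"
    by (simp add: has_field_derivative_iff)
  from order_tendstoD(2)[OF this, of "d + \<epsilon>"] \<open>\<epsilon> > 0\<close>
  have "\<forall>\<^sub>F s in at_right t. (f s - f t) / (s - t) < d + \<epsilon>" by simp
  with eventually_at_right_less[of t]
  show "\<forall>\<^sub>F s in at_right t. f s \<le> f t + (d + \<epsilon>) * (s - t)"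
  proof eventually_elim
    case (elim s)
    then have "f s - f t < (d + \<epsilon>) * (s - t)" by (simp add: divide_less_eq)
    then show ?case by linarith
  qed
qed

lemma dini_le_add:
  assumes "dini_le f d t" "dini_le g d' t"
  shows "dini_le (\<lambda>s. f s + g s) (d + d') t"
  unfolding dini_le_def
proof (intro allI impI)
  fix \<epsilon> :: real assume "\<epsilon> > 0"
  then have "\<epsilon> / 2 > 0" by simp
  from dini_leD[OF assms(1) this] dini_leD[OF assms(2) this]
  show "\<forall>\<^sub>F s in at_right t. f s + g s \<le> f t + g t + (d + d' + \<epsilon>) * (s - t)"
  proof eventually_elim
    case (elim s)
    have "(d + d' + \<epsilon>) * (s - t) = (d + \<epsilon> / 2) * (s - t) + (d' + \<epsilon> / 2) * (s - t)"
      by (simp add: field_simps)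
    then show ?case using elim by linarith
  qed
qed

lemma dini_le_const: "dini_le (\<lambda>s. c) 0 t"
  by (rule dini_le_deriv) (auto intro!: derivative_eq_intros)

lemma dini_le_cmult:
  assumes "dini_le f d t" "c \<ge> 0"
  shows "dini_le (\<lambda>s. c * f s) (c * d) t"
proof (cases "c = 0")
  case True
  then show ?thesis using dini_le_const[of 0 t] by simp
next
  case False
  with assms(2) have c: "c > 0" by simp
  show ?thesis unfolding dini_le_def
  proof (intro allI impI)
    fix \<epsilon> :: real assume "\<epsilon> > 0"
    with c have "\<epsilon> / c > 0" by simp
    from dini_leD[OF assms(1) this]
    show "\<forall>\<^sub>F s in at_right t. c * f s \<le> c * f t + (c * d + \<epsilon>) * (s - t)"
    proof eventually_elim
      case (elim s)
      then have "c * f s \<le> c * (f t + (d + \<epsilon> / c) * (s - t))" using c by (intro mult_left_mono) auto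
      also have "\<dots> = c * f t + (c * d + \<epsilon>) * (s - t)" using c by (simp add: field_simps)
      finally show ?case .
    qed
  qed
qed

lemma dini_le_sum:
  assumes "finite I" "\<And>i. i \<in> I \<Longrightarrow> dini_le (f i) (d i) t"
  shows "dini_le (\<lambda>s. \<Sum>i\<in>I. f i s) (\<Sum>i\<in>I. d i) t"
  using assms by (induct I rule: finite_induct) (auto intro: dini_le_const dini_le_add)

text \<open>A product rule at a zero of the first factor: there \<open>g\<close> needs to be only
  continuous from the right, and no lower bound on the increments of \<open>c\<close> is required
  because \<open>g\<close> is nonnegative.\<close>

lemma dini_le_zero_mult:
  assumes c: "dini_le c K t" "K \<ge> 0" and g: "(g \<longlongrightarrow> g t) (at_right t)" "\<And>s. g s \<ge> 0"
  shows "dini_le (\<lambda>s. (c s - c t) * g s) (K * g t) t"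
  unfolding dini_le_def
proof (intro allI impI)
  fix \<epsilon> :: real assume "\<epsilon> > 0"
  have "((\<lambda>\<eta>. (K + \<eta>) * (g t + \<eta>)) \<longlongrightarrow> (K + 0) * (g t + 0)) (at_right 0)"
    by (intro tendsto_intros)
  from order_tendstoD(2)[OF this, of "K * g t + \<epsilon>"] \<open>\<epsilon> > 0\<close>
  have "\<forall>\<^sub>F \<eta> in at_right 0. (K + \<eta>) * (g t + \<eta>) < K * g t + \<epsilon>" by simp
  then have "\<forall>\<^sub>F \<eta> in at_right 0. 0 < \<eta> \<and> (K + \<eta>) * (g t + \<eta>) < K * g t + \<epsilon>"
    using eventually_at_right_less[of 0] by eventually_elim simp
  then obtain \<eta> where \<eta>: "0 < \<eta>" "(K + \<eta>) * (g t + \<eta>) < K * g t + \<epsilon>"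
    using eventually_happens[of _ "at_right (0::real)"] by (auto simp: trivial_limit_at_right_real)
  have "\<forall>\<^sub>F s in at_right t. g s < g t + \<eta>"
    using order_tendstoD(2)[OF g(1), of "g t + \<eta>"] \<eta>(1) by simp
  with dini_leD[OF c(1) \<eta>(1)] eventually_at_right_less[of t]
  show "\<forall>\<^sub>F s in at_right t. (c s - c t) * g s \<le> (c t - c t) * g t + (K * g t + \<epsilon>) * (s - t)"
  proof eventually_elim
    case (elim s)
    have "(c s - c t) * g s \<le> ((K + \<eta>) * (s - t)) * g s"
      using elim g(2) by (intro mult_right_mono) auto
    also have "\<dots> \<le> ((K + \<eta>) * (s - t)) * (g t + \<eta>)"
      using elim c(2) \<eta>(1) by (intro mult_left_mono) auto
    also have "\<dots> = (K + \<eta>) * (g t + \<eta>) * (s - t)" by simp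
    also have "\<dots> \<le> (K * g t + \<epsilon>) * (s - t)"
      using \<eta>(2) elim by (intro mult_right_mono) auto
    finally show ?case by simp
  qed
qed

text \<open>Take the last time \<open>T\<close> up to \<open>t\<close> with
  \<open>f \<le> g\<close>. Just after \<open>T\<close> the inequality still holds, by continuity if
  it is strict at \<open>T\<close> and by \<open>touch\<close> otherwise, which contradicts the
  choice of \<open>T\<close>.\<close>

lemma barrier:
  fixes f g :: "real \<Rightarrow> real"
  assumes cont: "continuous_on {a..b} f" "continuous_on {a..b} g" and a: "f a \<le> g a"
    and touch: "\<And>t. a \<le> t \<Longrightarrow> t < b \<Longrightarrow> f t = g t \<Longrightarrow> \<forall>\<^sub>F s in at_right t. f s \<le> g s"
    and t: "t \<in> {a..b}"
  shows "f t \<le> g t"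
proof (rule ccontr)
  assume neg: "\<not> f t \<le> g t"
  define A where "A = {s \<in> {a..t}. f s \<le> g s}"
  have "closed A" unfolding A_def
    by (intro closed_Collect_le continuous_on_closed_Collect_le continuous_on_subset[OF cont(1)]
        continuous_on_subset[OF cont(2)]) (use t in auto)
  moreover have A: "a \<in> A" "bdd_above A" using a t by (auto simp: A_def bdd_above_def)
  ultimately have T: "Sup A \<in> A" using closed_contains_Sup[of A] by auto
  define T where "T = Sup A"
  have T1: "a \<le> T" "T \<le> t" "f T \<le> g T" using T by (auto simp: A_def T_def)
  with neg have Tt: "T < t" by (cases "T = t") auto
  have above: "f s > g s" if "T < s" "s \<le> t" for s
  proof (rule ccontr)
    assume "\<not> f s > g s"
    then have "s \<in> A" using that T1 by (auto simp: A_def)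
    then have "s \<le> T" unfolding T_def using A(2) by (rule cSup_upper)
    then show False using that by simp
  qed
  have "continuous_on {T..t} f" "continuous_on {T..t} g"
    using T1 t by (auto intro: continuous_on_subset[OF cont(1)] continuous_on_subset[OF cont(2)])
  then have lim: "(f \<longlongrightarrow> f T) (at_right T)" "(g \<longlongrightarrow> g T) (at_right T)"
    using Tt at_within_Icc_at_right[OF Tt] by (force simp: continuous_on_def)+
  have "\<forall>\<^sub>F s in at_right T. f s \<le> g s"
  proof (cases "f T = g T")
    case True
    then show ?thesis using touch T1 Tt t by auto
  next
    case False
    then have "((\<lambda>s. g s - f s) \<longlongrightarrow> g T - f T) (at_right T)" "g T - f T > 0"
      using T1 by (auto intro!: tendsto_intros lim)
    from order_tendstoD(1)[OF this] show ?thesis by eventually_elim simp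
  qed
  moreover have "\<forall>\<^sub>F s in at_right T. s < t" using Tt by (rule eventually_at_rightI[rotated]) auto
  ultimately have "\<forall>\<^sub>F s in at_right T. False"
    using eventually_at_right_less[of T] by eventually_elim (use above in force)
  then show False by (simp add: trivial_limit_at_right_real)
qed

text \<open>The growth condition is asked only where \<open>f\<close> meets the exponential. There
  the value of \<open>f\<close> is known, so that a nonlinear estimate may be used as if the bound
  to be proved were already available.\<close>

lemma dini_barrier:
  fixes f :: "real \<Rightarrow> real"
  assumes cont: "continuous_on {a..b} f" and a: "f a \<le> G"
    and touch: "\<And>t. a \<le> t \<Longrightarrow> t < b \<Longrightarrow> f t = G * exp (C * (t - a)) \<Longrightarrow> \<exists>d<C * f t. dini_le f d t"
    and t: "t \<in> {a..b}"
  shows "f t \<le> G * exp (C * (t - a))"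
proof (rule barrier[OF cont _ _ _ t])
  let ?g = "\<lambda>t. G * exp (C * (t - a))"
  show "continuous_on {a..b} ?g" by (intro continuous_intros)
  fix t assume t: "a \<le> t" "t < b" "f t = ?g t"
  then obtain d where d: "d < C * f t" "dini_le f d t" using touch by blast
  define \<epsilon> where "\<epsilon> = (C * f t - d) / 2"
  have \<epsilon>: "\<epsilon> > 0" using d by (simp add: \<epsilon>_def)
  have "((\<lambda>t. - ?g t) has_real_derivative (- (C * f t))) (at_right t)"
    unfolding t(3) by (auto intro!: derivative_eq_intros)
  from dini_leD[OF dini_le_deriv[OF this] \<epsilon>] dini_leD[OF d(2) \<epsilon>]
  show "\<forall>\<^sub>F s in at_right t. f s \<le> ?g s"
  proof eventually_elim
    case (elim s)
    have "(- (C * f t) + \<epsilon>) * (s - t) + (d + \<epsilon>) * (s - t) = 0"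
      by (simp add: \<epsilon>_def field_simps)
    then show ?case using elim t(3) by linarith
  qed
qed (use a in simp)

text \<open>Raising both the initial value and the rate by \<open>\<epsilon>\<close> makes the
  comparison strict at contact points; then \<open>\<epsilon>\<close> tends to 0.\<close>

lemma dini_gronwall:
  fixes f :: "real \<Rightarrow> real"
  assumes cont: "continuous_on {a..b} f" and f: "\<And>t. f t \<ge> 0"
    and dini: "\<And>t. a \<le> t \<Longrightarrow> t < b \<Longrightarrow> dini_le f (C * f t) t"
    and t: "t \<in> {a..b}"
  shows "f t \<le> f a * exp (C * (t - a))"
proof -
  have le: "f t \<le> (f a + \<epsilon>) * exp ((C + \<epsilon>) * (t - a))" if \<epsilon>: "\<epsilon> > 0" for \<epsilon>
  proof (rule dini_barrier[OF cont _ _ t])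
    fix t assume t: "a \<le> t" "t < b" "f t = (f a + \<epsilon>) * exp ((C + \<epsilon>) * (t - a))"
    have "f a + \<epsilon> > 0" using f[of a] \<epsilon> by linarith
    then have "f t > 0" unfolding t(3) by simp
    then have "C * f t < (C + \<epsilon>) * f t" using \<epsilon> by simp
    then show "\<exists>d<(C + \<epsilon>) * f t. dini_le f d t" using dini[OF t(1,2)] by blast
  qed (use \<epsilon> in simp)
  have ev: "\<forall>\<^sub>F \<epsilon> in at_right 0. f t \<le> (f a + \<epsilon>) * exp ((C + \<epsilon>) * (t - a))"
    using eventually_at_right_less[of "0::real"] by eventually_elim (rule le)
  have "((\<lambda>\<epsilon>. (f a + \<epsilon>) * exp ((C + \<epsilon>) * (t - a))) \<longlongrightarrow> (f a + 0) * exp ((C + 0) * (t - a))) (at_right 0)"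
    by (intro tendsto_intros)
  from tendsto_lowerbound[OF this ev] show ?thesis by (simp add: trivial_limit_at_right_real)
qed

text \<open>Freeze the coefficient at time \<open>t\<close>: the energy with \<open>c t\<close> is
  differentiable and its terms in \<open>l\<close> cancel, leaving only the forcing
  \<open>r\<close>. The rest, \<open>(c s - c t) l (u s)^2\<close>, vanishes at \<open>t\<close> and
  is covered by \<open>dini_le_zero_mult\<close>.\<close>

lemma energy_dini:
  assumes u: "(u has_real_derivative v t) (at_right t)"
    and v: "(v has_real_derivative (r - l * c t * u t)) (at_right t)"
    and c: "dini_le c K t" "K \<ge> 0" and l: "l \<ge> 0"
  shows "dini_le (\<lambda>s. (v s)\<^sup>2 + c s * l * (u s)\<^sup>2) (2 * v t * r + K * (l * (u t)\<^sup>2)) t"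
proof -
  have "((\<lambda>s. (v s)\<^sup>2 + c t * l * (u s)\<^sup>2) has_real_derivative 2 * v t * r) (at_right t)"
    by (rule derivative_eq_intros u v refl)+ (simp add: algebra_simps)
  then have 1: "dini_le (\<lambda>s. (v s)\<^sup>2 + c t * l * (u s)\<^sup>2) (2 * v t * r) t"
    by (rule dini_le_deriv)
  have "(u \<longlongrightarrow> u t) (at_right t)"
    using DERIV_continuous[OF u] by (simp add: continuous_within)
  then have "dini_le (\<lambda>s. (c s - c t) * (l * (u s)\<^sup>2)) (K * (l * (u t)\<^sup>2)) t"
    using l by (intro dini_le_zero_mult c tendsto_intros) auto
  from dini_le_add[OF 1 this] show ?thesis by (simp add: algebra_simps)
qed

lemma at_within_atLeast_mono:
  assumes "(f has_real_derivative d) (at t within {0..})" "t \<ge> (0::real)"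
  shows "(f has_real_derivative d) (at_right t)"
  using assms by (auto intro: has_field_derivative_subset)

section \<open>Limits of differentiable functions and Picard iteration\<close>

lemma derivative_uniform_limit:
  fixes F G :: "nat \<Rightarrow> real \<Rightarrow> real"
  assumes der: "\<And>n t. t \<ge> 0 \<Longrightarrow> (F n has_real_derivative G n t) (at t within {0..})"
    and unif: "\<And>T. T \<ge> 0 \<Longrightarrow> uniform_limit {0..T} G g sequentially"
    and lim: "\<And>t. t \<ge> 0 \<Longrightarrow> (\<lambda>n. F n t) \<longlonglongrightarrow> f t"
    and t: "t \<ge> 0"
  shows "(f has_real_derivative g t) (at t within {0..})"
proof -
  \<comment> \<open>With \<open>t\<close> strictly below the right end, the filter within
    \<open>{0..T}\<close> is the one within \<open>{0..}\<close>.\<close>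
  define T where "T = t + 1"
  have "\<exists>h. \<forall>x\<in>{0..T}. (\<lambda>n. F n x) \<longlonglongrightarrow> h x \<and> (h has_derivative (\<lambda>y. g x * y)) (at x within {0..T})"
  proof (rule has_derivative_sequence[where f=F and f'="\<lambda>n x y. G n x * y" and g'="\<lambda>x y. g x * y"
        and ?x0.0=t and l="f t"])
    show "(F n has_derivative (\<lambda>y. G n x * y)) (at x within {0..T})" if "x \<in> {0..T}" for n x
      using has_field_derivative_subset[OF der[of x n], of "{0..T}"] that
      by (auto simp: has_field_derivative_def)
    show "(\<lambda>n. F n t) \<longlonglongrightarrow> f t" by (rule lim[OF t])
    fix \<epsilon> :: real assume \<epsilon>: "\<epsilon> > 0"
    have "T \<ge> 0" using t by (simp add: T_def)
    from uniform_limitD[OF unif[OF this] \<epsilon>]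
    show "\<forall>\<^sub>F n in sequentially. \<forall>x\<in>{0..T}. \<forall>h. norm (G n x * h - g x * h) \<le> \<epsilon> * norm h"
    proof eventually_elim
      case (elim n)
      show ?case
      proof (intro ballI allI)
        fix x h :: real assume "x \<in> {0..T}"
        then have "\<bar>G n x - g x\<bar> \<le> \<epsilon>" using elim by (auto simp: dist_real_def less_imp_le)
        then have "\<bar>G n x - g x\<bar> * \<bar>h\<bar> \<le> \<epsilon> * \<bar>h\<bar>" by (intro mult_right_mono) auto
        then show "norm (G n x * h - g x * h) \<le> \<epsilon> * norm h"
          by (simp add: left_diff_distrib[symmetric] abs_mult)
      qed
    qed
  qed (use t in \<open>auto simp: T_def\<close>)
  then obtain h where h: "\<And>x. x \<in> {0..T} \<Longrightarrow> (\<lambda>n. F n x) \<longlonglongrightarrow> h x"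
    "\<And>x. x \<in> {0..T} \<Longrightarrow> (h has_real_derivative g x) (at x within {0..T})"
    unfolding has_field_derivative_def by blast
  have "f x = h x" if "x \<in> {0..T}" for x
    using LIMSEQ_unique[OF lim h(1)] that by auto
  then have "(f has_real_derivative g t) (at t within {0..T})"
    using h(2)[of t] t
    by (subst has_field_derivative_cong_eventually[where g=h])
      (auto simp: eventually_at_filter T_def intro!: always_eventually)
  moreover have "at t within {0..T} = at t within {0..}"
    by (rule at_within_nhd[of t "{..<T}"]) (auto simp: T_def)
  ultimately show ?thesis by simp
qed

lemma uniform_limit_lim:
  fixes f :: "nat \<Rightarrow> real \<Rightarrow> real"
  assumes "\<And>\<epsilon>. \<epsilon> > 0 \<Longrightarrow> \<exists>N. \<forall>m\<ge>N. \<forall>n\<ge>N. \<forall>x\<in>X. \<bar>f m x - f n x\<bar> < \<epsilon>"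
  shows "uniform_limit X f (\<lambda>x. lim (\<lambda>n. f n x)) sequentially"
proof -
  have "uniformly_Cauchy_on X f"
    unfolding uniformly_Cauchy_on_def dist_real_def using assms by meson
  then show ?thesis
    using Cauchy_uniformly_convergent uniformly_convergent_uniform_limit_iff by blast
qed

text \<open>Measured against \<open>exp (2 K t)\<close>, each Picard step halves the distance, so
  the iterates converge on the whole half-line and no local solutions have to be continued. Only
  coordinates in \<open>I\<close> enter the Lipschitz condition, the others are arbitrary.\<close>

lemma picard_finite:
  fixes f :: "('i \<Rightarrow> real) \<Rightarrow> 'i \<Rightarrow> real"
  assumes I: "finite I" and K: "K > 0"
    and lip: "\<And>x y i \<delta>. i \<in> I \<Longrightarrow> (\<And>j. j \<in> I \<Longrightarrow> \<bar>x j - y j\<bar> \<le> \<delta>) \<Longrightarrow> \<bar>f x i - f y i\<bar> \<le> K * \<delta>"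
  shows "\<exists>X. \<forall>i\<in>I. X i 0 = x0 i \<and>
    (\<forall>t\<ge>0. (X i has_real_derivative f (\<lambda>j. X j t) i) (at t within {0..}))"
proof -
  define P :: "nat \<Rightarrow> 'i \<Rightarrow> real \<Rightarrow> real" where "P = rec_nat (\<lambda>i t. x0 i) (\<lambda>_ p i t. x0 i + integral {0..t} (\<lambda>s. f (\<lambda>j. p j s) i))"
  have P0: "P 0 = (\<lambda>i t. x0 i)"
    and PS: "P (Suc n) = (\<lambda>i t. x0 i + integral {0..t} (\<lambda>s. f (\<lambda>j. P n j s) i))" for n
    by (simp_all add: P_def)
  have contf: "continuous_on A (\<lambda>s. f (\<lambda>j. x j s) i)"
    if i: "i \<in> I" and x: "\<And>j. j \<in> I \<Longrightarrow> continuous_on A (x j)" for x i and A :: "real set"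
    unfolding continuous_on_def
  proof (intro ballI tendstoI)
    fix t and \<epsilon> :: real assume t: "t \<in> A" and \<epsilon>: "\<epsilon> > 0"
    define \<delta> where "\<delta> = \<epsilon> / (2 * K)"
    have \<delta>: "\<delta> > 0" "K * \<delta> < \<epsilon>" using \<epsilon> K by (simp_all add: \<delta>_def)
    have "\<forall>\<^sub>F s in at t within A. dist (x j s) (x j t) < \<delta>" if "j \<in> I" for j
      using x[OF that] t \<delta>(1) by (auto simp: continuous_on_def intro: tendstoD)
    then have "\<forall>\<^sub>F s in at t within A. \<forall>j\<in>I. dist (x j s) (x j t) < \<delta>"
      by (intro eventually_ball_finite[OF I] ballI)
    then show "\<forall>\<^sub>F s in at t within A. dist (f (\<lambda>j. x j s) i) (f (\<lambda>j. x j t) i) < \<epsilon>"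
    proof eventually_elim
      case (elim s)
      have "\<bar>f (\<lambda>j. x j s) i - f (\<lambda>j. x j t) i\<bar> \<le> K * \<delta>"
        using elim by (intro lip i) (auto simp: dist_real_def less_imp_le)
      then show ?case using \<delta> by (simp add: dist_real_def)
    qed
  qed
  have der: "(P (Suc n) i has_real_derivative f (\<lambda>j. P n j t) i) (at t within {0..})"
    if c: "\<And>j. j \<in> I \<Longrightarrow> continuous_on {0..} (P n j)" and i: "i \<in> I" and t: "t \<ge> 0" for n i t
  proof -
    have "continuous_on {0..t + 1} (\<lambda>s. f (\<lambda>j. P n j s) i)"
      by (intro contf i continuous_on_subset[OF c]) auto
    from integral_has_real_derivative[OF this, of t] t
    have "(P (Suc n) i has_real_derivative f (\<lambda>j. P n j t) i) (at t within {0..t + 1})"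
      unfolding PS by (auto intro!: derivative_eq_intros)
    moreover have "at t within {0..t + 1} = at t within {0..}"
      by (rule at_within_nhd[of t "{..<t + 1}"]) auto
    ultimately show ?thesis by simp
  qed
  have cont: "continuous_on {0..} (P n i)" if "i \<in> I" for n i
    using that
  proof (induct n arbitrary: i)
    case (Suc n)
    show ?case
      by (rule DERIV_continuous_on[OF der[OF Suc(1) Suc(2)]]) auto
  qed (simp add: P0)
  \<comment> \<open>Chosen so that \<open>\<bar>f x0 i\<bar> \<le> 2 K M\<close> for all
    \<open>i\<close> in \<open>I\<close>; with \<open>2 K t \<le> exp (2 K t)\<close> this starts
    the induction.\<close>
  define M where "M = (\<Sum>i\<in>I. \<bar>f x0 i\<bar>) / (2 * K)"
  have M: "M \<ge> 0" using K by (simp add: M_def sum_nonneg)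
  have step: "\<bar>P (Suc n) i t - P n i t\<bar> \<le> 2 * M * exp (2 * K * t) / 2 ^ n" if "i \<in> I" "t \<ge> 0" for n i t
    using that
  proof (induct n arbitrary: i t)
    case 0
    have "P (Suc 0) i t - P 0 i t = t * f x0 i"
      using 0 by (simp add: PS P0)
    then have "\<bar>P (Suc 0) i t - P 0 i t\<bar> = t * \<bar>f x0 i\<bar>" using 0 by (simp add: abs_mult)
    also have "\<dots> \<le> t * (2 * K * M)"
      using 0 K I member_le_sum[of i I "\<lambda>i. \<bar>f x0 i\<bar>"] by (intro mult_left_mono) (auto simp: M_def)
    also have "\<dots> = M * (2 * K * t)" by simp
    also have "\<dots> \<le> M * exp (2 * K * t)"
      using exp_ge_add_one_self[of "2 * K * t"] M by (intro mult_left_mono) linarith+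
    also have "\<dots> \<le> 2 * M * exp (2 * K * t) / 2 ^ 0" using M by simp
    finally show ?case .
  next
    case (Suc n)
    define h where "h = (\<lambda>s. 2 * M * exp (2 * K * s) / 2 ^ n)"
    define H where "H = (\<lambda>s. M * exp (2 * K * s) / (K * 2 ^ n))"
    have hH: "(h has_integral H t - H 0) {0..t}"
    proof (rule fundamental_theorem_of_calculus[OF Suc(3)])
      fix s
      show "(H has_vector_derivative h s) (at s within {0..t})"
        unfolding H_def h_def has_real_derivative_iff_has_vector_derivative[symmetric]
        using K by (auto intro!: derivative_eq_intros)
    qed
    let ?f = "\<lambda>n s. f (\<lambda>j. P n j s) i"
    have int: "?f n integrable_on {0..t}" for n
      by (intro integrable_continuous_real contf Suc(2) continuous_on_subset[OF cont]) auto
    have "P (Suc (Suc n)) i t - P (Suc n) i t = integral {0..t} (?f (Suc n)) - integral {0..t} (?f n)"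
      unfolding PS by simp
    also have "\<dots> = integral {0..t} (\<lambda>s. ?f (Suc n) s - ?f n s)"
      by (rule integral_diff[OF int int, symmetric])
    also have "norm \<dots> \<le> integral {0..t} (\<lambda>s. K * h s)"
    proof (rule integral_norm_bound_integral)
      show "(\<lambda>s. ?f (Suc n) s - ?f n s) integrable_on {0..t}" by (rule integrable_diff[OF int int])
      show "(\<lambda>s. K * h s) integrable_on {0..t}"
        using has_integral_mult_right[OF hH] by (rule has_integral_integrable)
      fix s assume "s \<in> {0..t}"
      then show "norm (?f (Suc n) s - ?f n s) \<le> K * h s"
        unfolding real_norm_def h_def using Suc(1) by (intro lip Suc(2)) auto
    qed
    also have "\<dots> = K * (H t - H 0)"
      using has_integral_mult_right[OF hH] by (rule integral_unique)
    also have "\<dots> \<le> K * H t"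
    proof (rule mult_left_mono)
      have "H 0 \<ge> 0" using K M by (simp add: H_def)
      then show "H t - H 0 \<le> H t" by simp
    qed (use K in simp)
    also have "\<dots> = 2 * M * exp (2 * K * t) / 2 ^ Suc n" using K by (simp add: H_def)
    finally show ?case by simp
  qed
  define X where "X i t = lim (\<lambda>n. P n i t)" for i t
  have unif: "uniform_limit {0..T} (\<lambda>n. P n i) (X i) sequentially" if i: "i \<in> I" for i T
    unfolding X_def
  proof (rule uniform_limit_lim)
    fix \<epsilon> :: real assume "\<epsilon> > 0"
    define B where "B = 2 * M * exp (2 * K * \<bar>T\<bar>)"
    have "summable (\<lambda>n. B * (1 / 2) ^ n)" by (intro summable_mult summable_geometric) simp
    then obtain N where N: "\<And>m n. m \<ge> N \<Longrightarrow> norm (\<Sum>k=m..<n. B * (1 / 2) ^ k) < \<epsilon>"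
      using \<open>\<epsilon> > 0\<close> unfolding summable_Cauchy by blast
    have le: "\<bar>P n i t - P m i t\<bar> < \<epsilon>" if mn: "m \<ge> N" "m \<le> n" and t: "t \<in> {0..T}" for m n t
    proof -
      have "P n i t - P m i t = (\<Sum>k=m..<n. P (Suc k) i t - P k i t)"
        using sum_Suc_diff'[OF mn(2), of "\<lambda>k. P k i t"] by simp
      also have "\<bar>\<dots>\<bar> \<le> (\<Sum>k=m..<n. \<bar>P (Suc k) i t - P k i t\<bar>)" by (rule sum_abs)
      also have "\<dots> \<le> (\<Sum>k=m..<n. B * (1 / 2) ^ k)"
      proof (rule sum_mono)
        fix k
        have "\<bar>P (Suc k) i t - P k i t\<bar> \<le> 2 * M * exp (2 * K * t) / 2 ^ k"
          using t by (intro step i) auto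
        also have "\<dots> \<le> B / 2 ^ k"
          unfolding B_def using t K M by (intro divide_right_mono mult_left_mono) auto
        finally show "\<bar>P (Suc k) i t - P k i t\<bar> \<le> B * (1 / 2) ^ k" by (simp add: power_divide)
      qed
      also have "\<dots> < \<epsilon>" using N[OF mn(1), of n] by simp
      finally show ?thesis .
    qed
    show "\<exists>N. \<forall>m\<ge>N. \<forall>n\<ge>N. \<forall>t\<in>{0..T}. \<bar>P m i t - P n i t\<bar> < \<epsilon>"
    proof (intro exI allI impI ballI)
      fix m n t assume "m \<ge> N" "n \<ge> N" "t \<in> {0..T}"
      then show "\<bar>P m i t - P n i t\<bar> < \<epsilon>"
        using le[of m n t] le[of n m t] by (cases "m \<le> n") (auto simp: abs_minus_commute)
    qed
  qed
  have lim: "(\<lambda>n. P n i t) \<longlonglongrightarrow> X i t" if "i \<in> I" "t \<ge> 0" for i t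
    by (rule tendsto_uniform_limitI[OF unif[OF that(1), of t]]) (use that in auto)
  have "(X i has_real_derivative f (\<lambda>j. X j t) i) (at t within {0..})" if i: "i \<in> I" and t: "t \<ge> 0" for i t
  proof (rule derivative_uniform_limit[where F="\<lambda>n. P (Suc n) i" and G="\<lambda>n t. f (\<lambda>j. P n j t) i", OF _ _ _ t])
    fix T :: real assume "T \<ge> 0"
    show "uniform_limit {0..T} (\<lambda>n t. f (\<lambda>j. P n j t) i) (\<lambda>t. f (\<lambda>j. X j t) i) sequentially"
    proof (rule uniform_limitI)
      fix \<epsilon> :: real assume \<epsilon>: "\<epsilon> > 0"
      define \<delta> where "\<delta> = \<epsilon> / (2 * K)"
      have \<delta>: "\<delta> > 0" "K * \<delta> < \<epsilon>" using \<epsilon> K by (simp_all add: \<delta>_def)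
      have "\<forall>\<^sub>F n in sequentially. \<forall>j\<in>I. \<forall>t\<in>{0..T}. dist (P n j t) (X j t) < \<delta>"
        by (rule eventually_ball_finite[OF I]) (use uniform_limitD[OF unif \<delta>(1)] in auto)
      then show "\<forall>\<^sub>F n in sequentially. \<forall>t\<in>{0..T}. dist (f (\<lambda>j. P n j t) i) (f (\<lambda>j. X j t) i) < \<epsilon>"
      proof eventually_elim
        case (elim n)
        show ?case
        proof
          fix t assume "t \<in> {0..T}"
          then have "\<bar>f (\<lambda>j. P n j t) i - f (\<lambda>j. X j t) i\<bar> \<le> K * \<delta>"
            using elim by (intro lip i) (auto simp: dist_real_def less_imp_le)
          then show "dist (f (\<lambda>j. P n j t) i) (f (\<lambda>j. X j t) i) < \<epsilon>"
            using \<delta> by (simp add: dist_real_def)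
        qed
      qed
    qed
  qed (use der cont i LIMSEQ_Suc[OF lim] in auto)
  moreover have "X i 0 = x0 i" if "i \<in> I" for i
  proof -
    have "P n i 0 = x0 i" for n by (cases n) (simp_all add: P0 PS)
    then show ?thesis using lim[OF that, of 0] by (simp add: LIMSEQ_const_iff)
  qed
  ultimately show ?thesis by blast
qed

section \<open>Galerkin approximation\<close>

text \<open>The problem in coordinates. The exponent \<open>p\<close> stands for
  \<open>4 \<alpha>\<close>: the summability of the data says that the coefficient sequences of
  \<open>A^\<alpha> u1\<close> and \<open>A^(\<alpha> + 1/2) u0\<close> are square summable. The
  normalization \<open>\<nu> \<le> 1\<close> allows one constant to serve for kinetic and potential
  energy.\<close>

locale kirchhoff = gap_spectrum lam for lam :: "nat \<Rightarrow> real" +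
  fixes m :: "real \<Rightarrow> real" and \<nu> p :: real and a b :: "nat \<Rightarrow> real"
  assumes nu: "0 < \<nu>" "\<nu> \<le> 1" and m_ge: "s \<ge> 0 \<Longrightarrow> \<nu> \<le> m s"
    and m_lip: "R \<ge> 0 \<Longrightarrow> \<exists>L\<ge>0. \<forall>x\<in>{0..R}. \<forall>y\<in>{0..R}. \<bar>m x - m y\<bar> \<le> L * \<bar>x - y\<bar>"
    and p: "p > 1"
    and data: "summable (\<lambda>k. lam k powr p * ((b k)\<^sup>2 + (lam k)\<^sup>2 * (a k)\<^sup>2))"
begin

definition en :: "nat \<Rightarrow> real \<Rightarrow> real \<Rightarrow> real" where
  "en k x y = y\<^sup>2 + (lam k)\<^sup>2 * x\<^sup>2"

definition sg :: "nat \<Rightarrow> (nat \<Rightarrow> real \<Rightarrow> real) \<Rightarrow> real \<Rightarrow> real" where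
  "sg N u t = (\<Sum>k<N. (lam k)\<^sup>2 * (u k t)\<^sup>2)"

definition sd :: "nat \<Rightarrow> (nat \<Rightarrow> real \<Rightarrow> real) \<Rightarrow> (nat \<Rightarrow> real \<Rightarrow> real) \<Rightarrow> real \<Rightarrow> real" where
  "sd N u v t = (\<Sum>k<N. 2 * (lam k)\<^sup>2 * u k t * v k t)"

text \<open>The potential part carries the actual coefficient, so that along solutions only the
  variation of the coefficient contributes to the growth.\<close>

definition wen :: "(nat \<Rightarrow> real) \<Rightarrow> nat \<Rightarrow> (nat \<Rightarrow> real \<Rightarrow> real) \<Rightarrow> (nat \<Rightarrow> real \<Rightarrow> real) \<Rightarrow> real \<Rightarrow> real" where
  "wen w N u v t = (\<Sum>k<N. w k * ((v k t)\<^sup>2 + m (sg N u t) * (lam k)\<^sup>2 * (u k t)\<^sup>2))"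

text \<open>The functions are indexed by all modes and vanish from \<open>N\<close> on, so that
  approximations of different size can be subtracted. The bound \<open>R\<close> is part of the
  notion in order to be chosen once for all \<open>N\<close>.\<close>

definition galerkin :: "real \<Rightarrow> nat \<Rightarrow> (nat \<Rightarrow> real \<Rightarrow> real) \<Rightarrow> (nat \<Rightarrow> real \<Rightarrow> real) \<Rightarrow> bool" where
  "galerkin R N u v \<longleftrightarrow>
    (\<forall>k. \<forall>t\<ge>0. (u k has_real_derivative v k t) (at t within {0..})) \<and>
    (\<forall>k. \<forall>t\<ge>0. (v k has_real_derivative - ((lam k)\<^sup>2 * m (sg N u t) * u k t)) (at t within {0..})) \<and>
    (\<forall>k\<ge>N. \<forall>t. u k t = 0 \<and> v k t = 0) \<and>
    (\<forall>k<N. u k 0 = a k \<and> v k 0 = b k) \<and>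
    (\<forall>t\<ge>0. sg N u t \<le> R \<and> (\<Sum>k<N. (v k t)\<^sup>2) \<le> R)"

lemma en_nonneg: "en k x y \<ge> 0" by (simp add: en_def)

lemma sg_nonneg: "sg N u t \<ge> 0" by (simp add: sg_def sum_nonneg)

lemma m_pos: "s \<ge> 0 \<Longrightarrow> m s > 0" using m_ge[of s] nu by linarith

lemma data': "summable (\<lambda>k. lam k powr p * en k (a k) (b k))"
  using data by (simp add: en_def)

lemma summable_en: "summable (\<lambda>k. (1 + lam k) * en k (a k) (b k))" "summable (\<lambda>k. en k (a k) (b k))"
proof -
  \<comment> \<open>Mode 0 is left out because \<open>lam 0\<close> may be smaller than 1, even
    0.\<close>
  have le: "1 + lam k \<le> 2 * lam k powr p" if "k \<ge> 1" for k
  proof -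
    have "1 \<le> lam k" using lam_ge[of k] that by linarith
    then have "lam k powr 1 \<le> lam k powr p" using p by (intro powr_mono) auto
    then show ?thesis using \<open>1 \<le> lam k\<close> by simp
  qed
  have s2: "summable (\<lambda>k. 2 * (lam k powr p * en k (a k) (b k)))"
    by (rule summable_mult[OF data'])
  show 1: "summable (\<lambda>k. (1 + lam k) * en k (a k) (b k))"
  proof (rule summable_comparison_test'[OF s2])
    fix k :: nat assume k: "1 \<le> k"
    have "(1 + lam k) * en k (a k) (b k) \<le> 2 * lam k powr p * en k (a k) (b k)"
      by (intro mult_right_mono le k en_nonneg)
    then show "norm ((1 + lam k) * en k (a k) (b k)) \<le> 2 * (lam k powr p * en k (a k) (b k))"
      using lam_nonneg[of k] by (simp add: abs_mult abs_of_nonneg en_nonneg mult.assoc)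
  qed
  show "summable (\<lambda>k. en k (a k) (b k))"
  proof (rule summable_comparison_test'[OF 1, of 0])
    fix k :: nat
    show "norm (en k (a k) (b k)) \<le> (1 + lam k) * en k (a k) (b k)"
      using mult_right_mono[of 1 "1 + lam k" "en k (a k) (b k)"] lam_nonneg[of k]
      by (simp add: abs_of_nonneg en_nonneg)
  qed
qed

lemma m_cont: "continuous_on {0..} m"
  unfolding continuous_on_def
proof
  fix t :: real assume t: "t \<in> {0..}"
  obtain L where L: "L \<ge> 0" "\<And>x y. x \<in> {0..t + 1} \<Longrightarrow> y \<in> {0..t + 1} \<Longrightarrow> \<bar>m x - m y\<bar> \<le> L * \<bar>x - y\<bar>"
    using m_lip[of "t + 1"] t by auto
  have "L-lipschitz_on {0..t + 1} m"
    by (rule lipschitz_onI) (use L in \<open>auto simp: dist_real_def\<close>)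
  then have "continuous_on {0..t + 1} m" by (rule lipschitz_on_continuous_on)
  then have "(m \<longlongrightarrow> m t) (at t within {0..t + 1})" using t by (auto simp: continuous_on_def)
  moreover have "at t within {0..t + 1} = at t within {0..}"
    by (rule at_within_nhd[of t "{..<t + 1}"]) (use t in auto)
  ultimately show "(m \<longlongrightarrow> m t) (at t within {0..})" by simp
qed

lemma m_upper:
  assumes "R \<ge> 0"
  obtains \<mu> where "\<mu> \<ge> 1" "\<And>s. 0 \<le> s \<Longrightarrow> s \<le> R \<Longrightarrow> m s \<le> \<mu>"
proof -
  have "compact (m ` {0..R})"
    by (intro compact_continuous_image continuous_on_subset[OF m_cont]) auto
  then have "bounded (m ` {0..R})" by (rule compact_imp_bounded)
  then obtain B where B: "\<forall>x\<in>m ` {0..R}. norm x \<le> B" unfolding bounded_iff by blast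
  have "m s \<le> max 1 B" if "0 \<le> s" "s \<le> R" for s
  proof -
    have "norm (m s) \<le> B" using B that by simp
    then show ?thesis by simp
  qed
  then show thesis by (intro that[of "max 1 B"]) auto
qed

text \<open>The truncation \<open>m (min s R)\<close> makes the finite system globally Lipschitz.\<close>

lemma cutoff_lipschitz:
  fixes x y :: "nat \<Rightarrow> real"
  assumes R: "R \<ge> 0" and L: "L \<ge> 0" "\<And>x y. x \<in> {0..R} \<Longrightarrow> y \<in> {0..R} \<Longrightarrow> \<bar>m x - m y\<bar> \<le> L * \<bar>x - y\<bar>"
    and \<mu>: "\<And>s. 0 \<le> s \<Longrightarrow> s \<le> R \<Longrightarrow> m s \<le> \<mu>"
    and \<delta>: "\<And>j. j < N \<Longrightarrow> \<bar>x j - y j\<bar> \<le> \<delta>" and k: "k < N"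
  defines "\<Sigma> \<equiv> \<lambda>x. \<Sum>j<N. (lam j)\<^sup>2 * (x j)\<^sup>2"
  shows "\<bar>(lam k)\<^sup>2 * m (min (\<Sigma> x) R) * x k - (lam k)\<^sup>2 * m (min (\<Sigma> y) R) * y k\<bar>
    \<le> ((lam N)\<^sup>2 * \<mu> + 2 * L * R * real N * (lam N)\<^sup>2) * \<delta>"
proof -
  have \<Sigma>0: "\<Sigma> x \<ge> 0" for x by (simp add: \<Sigma>_def sum_nonneg)
  \<comment> \<open>Assume that \<open>y\<close> has the smaller sum, and let the increment of
    \<open>m\<close> multiply \<open>y k\<close>. If this increment is not zero then the sum of
    \<open>y\<close> is below \<open>R\<close>, which bounds \<open>lam k * y k\<close> by
    \<open>sqrt R\<close>; so no bound on \<open>x\<close> is needed.\<close>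
  have main: "\<bar>(lam k)\<^sup>2 * m (min (\<Sigma> x) R) * x k - (lam k)\<^sup>2 * m (min (\<Sigma> y) R) * y k\<bar>
    \<le> ((lam N)\<^sup>2 * \<mu> + 2 * L * R * real N * (lam N)\<^sup>2) * \<delta>"
    if le: "\<Sigma> y \<le> \<Sigma> x" and \<delta>: "\<And>j. j < N \<Longrightarrow> \<bar>x j - y j\<bar> \<le> \<delta>" for x y
  proof -
    have \<delta>0: "\<delta> \<ge> 0" using \<delta>[OF k] by linarith
    have lk: "lam k \<le> lam N" "0 \<le> lam k" "0 \<le> lam N" using lam_mono[of k N] k lam_nonneg by auto
    define X where "X = L2_set (\<lambda>j. lam j * x j) {..<N}"
    define Y where "Y = L2_set (\<lambda>j. lam j * y j) {..<N}"
    define \<rho> where "\<rho> = sqrt R"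
    have XY: "X\<^sup>2 = \<Sigma> x" "Y\<^sup>2 = \<Sigma> y" "0 \<le> X" "0 \<le> Y"
      by (simp_all add: X_def Y_def L2_set_def \<Sigma>_def power_mult_distrib sum_nonneg)
    have \<rho>: "\<rho>\<^sup>2 = R" "\<rho> \<ge> 0" using R by (auto simp: \<rho>_def)
    have YX: "Y \<le> X" by (rule power2_le_imp_le) (use le XY in auto)
    have "X \<le> L2_set (\<lambda>j. lam j * y j) {..<N} + L2_set (\<lambda>j. lam j * (x j - y j)) {..<N}"
    proof -
      have "(\<lambda>j. lam j * x j) = (\<lambda>j. lam j * y j + lam j * (x j - y j))"
        by (simp add: right_diff_distrib)
      then show ?thesis
        unfolding X_def using L2_set_triangle_ineq[of "\<lambda>j. lam j * y j" "\<lambda>j. lam j * (x j - y j)" "{..<N}"]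
        by simp
    qed
    also have "L2_set (\<lambda>j. lam j * (x j - y j)) {..<N} \<le> (\<Sum>j<N. \<bar>lam j * (x j - y j)\<bar>)"
      by (rule L2_set_le_sum_abs)
    also have "\<dots> \<le> (\<Sum>j<N. lam N * \<delta>)"
    proof (rule sum_mono)
      fix j assume "j \<in> {..<N}"
      then show "\<bar>lam j * (x j - y j)\<bar> \<le> lam N * \<delta>"
        using \<delta>[of j] lam_mono[of j N] lam_nonneg[of j] by (auto simp: abs_mult intro!: mult_mono)
    qed
    finally have diff: "X - Y \<le> real N * (lam N * \<delta>)" by (simp add: Y_def)
    have t1: "\<bar>(lam k)\<^sup>2 * m (min (\<Sigma> x) R) * (x k - y k)\<bar> \<le> (lam N)\<^sup>2 * \<mu> * \<delta>"
    proof -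
      have mm: "0 \<le> m (min (\<Sigma> x) R)" "m (min (\<Sigma> x) R) \<le> \<mu>"
        using \<mu>[of "min (\<Sigma> x) R"] m_pos[of "min (\<Sigma> x) R"] \<Sigma>0[of x] R by auto
      have "(lam k)\<^sup>2 * m (min (\<Sigma> x) R) * \<bar>x k - y k\<bar> \<le> (lam N)\<^sup>2 * \<mu> * \<delta>"
        using mm lk \<delta>[OF k] by (intro mult_mono power_mono mult_nonneg_nonneg) auto
      then show ?thesis using mm by (simp add: abs_mult)
    qed
    have t2: "\<bar>(lam k)\<^sup>2 * (m (min (\<Sigma> x) R) - m (min (\<Sigma> y) R)) * y k\<bar> \<le> 2 * L * R * real N * (lam N)\<^sup>2 * \<delta>"
    proof (cases "\<Sigma> y \<ge> R")
      case True
      then have "min (\<Sigma> x) R = min (\<Sigma> y) R" using le by simp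
      then show ?thesis using L(1) R \<delta>0 by simp
    next
      case False
      then have yR: "\<Sigma> y < R" by simp
      have Y\<rho>: "Y \<le> \<rho>" by (rule power2_le_imp_le) (use yR XY \<rho> in auto)
      have "\<bar>m (min (\<Sigma> x) R) - m (min (\<Sigma> y) R)\<bar> \<le> L * \<bar>min (\<Sigma> x) R - min (\<Sigma> y) R\<bar>"
        using \<Sigma>0[of x] \<Sigma>0[of y] R by (intro L) auto
      also have "\<bar>min (\<Sigma> x) R - min (\<Sigma> y) R\<bar> \<le> 2 * \<rho> * (X - Y)"
      proof (cases "\<Sigma> x \<le> R")
        case True
        have "X \<le> \<rho>" by (rule power2_le_imp_le) (use True XY \<rho> in auto)
        have "\<bar>min (\<Sigma> x) R - min (\<Sigma> y) R\<bar> = (X + Y) * (X - Y)"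
          using True yR le XY by (simp add: power2_eq_square algebra_simps)
        also have "\<dots> \<le> 2 * \<rho> * (X - Y)" using YX Y\<rho> \<open>X \<le> \<rho>\<close> by (intro mult_right_mono) auto
        finally show ?thesis .
      next
        case False
        have "\<rho> \<le> X" by (rule power2_le_imp_le) (use False XY \<rho> in auto)
        have "\<bar>min (\<Sigma> x) R - min (\<Sigma> y) R\<bar> = (\<rho> + Y) * (\<rho> - Y)"
          using False yR XY \<rho> by (simp add: power2_eq_square algebra_simps)
        also have "\<dots> \<le> 2 * \<rho> * (X - Y)" using XY Y\<rho> \<open>\<rho> \<le> X\<close> by (intro mult_mono) auto
        finally show ?thesis .
      qed
      also have "\<dots> \<le> 2 * \<rho> * (real N * (lam N * \<delta>))" using diff \<rho> by (intro mult_left_mono) auto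
      finally have dm: "\<bar>m (min (\<Sigma> x) R) - m (min (\<Sigma> y) R)\<bar> \<le> L * (2 * \<rho> * (real N * (lam N * \<delta>)))"
        using L(1) by (simp add: mult_left_mono)
      have "\<bar>lam k * y k\<bar> \<le> L2_set (\<lambda>j. lam j * y j) {..<N}"
        using member_le_L2_set[of "{..<N}" k "\<lambda>j. \<bar>lam j * y j\<bar>"] k by (simp add: L2_set_def power_mult_distrib abs_mult)
      then have yk: "\<bar>lam k * y k\<bar> \<le> \<rho>" using Y\<rho> by (simp add: Y_def)
      have "\<bar>(lam k)\<^sup>2 * (m (min (\<Sigma> x) R) - m (min (\<Sigma> y) R)) * y k\<bar> =
        lam k * (\<bar>m (min (\<Sigma> x) R) - m (min (\<Sigma> y) R)\<bar> * \<bar>lam k * y k\<bar>)"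
        using lk by (simp add: abs_mult power2_eq_square)
      also have "\<dots> \<le> lam N * ((L * (2 * \<rho> * (real N * (lam N * \<delta>)))) * \<rho>)"
        using lk dm yk \<delta>0 L(1) \<rho> by (intro mult_mono) auto
      also have "\<dots> = 2 * L * \<rho>\<^sup>2 * real N * (lam N)\<^sup>2 * \<delta>" by (simp add: power2_eq_square)
      finally show ?thesis by (simp add: \<rho>)
    qed
    have "(lam k)\<^sup>2 * m (min (\<Sigma> x) R) * x k - (lam k)\<^sup>2 * m (min (\<Sigma> y) R) * y k =
      (lam k)\<^sup>2 * m (min (\<Sigma> x) R) * (x k - y k) + (lam k)\<^sup>2 * (m (min (\<Sigma> x) R) - m (min (\<Sigma> y) R)) * y k"
      by (simp add: algebra_simps)
    then show ?thesis using t1 t2 by (simp only: distrib_right) linarith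
  qed
  show ?thesis
  proof (cases "\<Sigma> y \<le> \<Sigma> x")
    case True
    then show ?thesis using main \<delta> by blast
  next
    case False
    then have "\<Sigma> x \<le> \<Sigma> y" by simp
    from main[OF this] \<delta> show ?thesis by (subst abs_minus_commute) (auto simp: abs_minus_commute)
  qed
qed

text \<open>The truncated system has global solutions, and it has a conserved energy of its own.
  This energy keeps \<open>sg\<close> below \<open>R\<close>, so the truncation never acts and the
  original system is solved.\<close>

lemma galerkin_exists: "\<exists>R\<ge>0. \<forall>N. \<exists>u v. galerkin R N u v"
proof -
  have sa: "summable (\<lambda>k. (lam k)\<^sup>2 * (a k)\<^sup>2)" and sb: "summable (\<lambda>k. (b k)\<^sup>2)"
    by (rule summable_comparison_test'[OF summable_en(2), of 0]; simp add: en_def)+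
  define sinf where "sinf = (\<Sum>k. (lam k)\<^sup>2 * (a k)\<^sup>2)"
  define B2 where "B2 = (\<Sum>k. (b k)\<^sup>2)"
  have sinf: "sinf \<ge> 0" and B2: "B2 \<ge> 0" using sa sb by (auto simp: sinf_def B2_def suminf_nonneg)
  obtain \<mu>0 where \<mu>0: "\<mu>0 \<ge> 1" "\<And>s. 0 \<le> s \<Longrightarrow> s \<le> sinf \<Longrightarrow> m s \<le> \<mu>0" using m_upper[OF sinf] by blast
  \<comment> \<open>The first term keeps the truncation inactive on the initial values of
    \<open>sg\<close>. The second is the bound on the initial energy divided by
    \<open>\<nu>\<close>, which bounds \<open>sg\<close> later on.\<close>
  define R where "R = max sinf ((B2 + \<mu>0 * sinf) / \<nu>)"
  have R: "R \<ge> 0" "sinf \<le> R" using sinf by (auto simp: R_def)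
  have "(B2 + \<mu>0 * sinf) / \<nu> \<le> R" by (simp add: R_def)
  then have RH: "B2 + \<mu>0 * sinf \<le> \<nu> * R" using nu by (simp add: field_simps)
  obtain L where L: "L \<ge> 0" "\<And>x y. x \<in> {0..R} \<Longrightarrow> y \<in> {0..R} \<Longrightarrow> \<bar>m x - m y\<bar> \<le> L * \<bar>x - y\<bar>"
    using m_lip[OF R(1)] by blast
  obtain \<mu> where \<mu>: "\<mu> \<ge> 1" "\<And>s. 0 \<le> s \<Longrightarrow> s \<le> R \<Longrightarrow> m s \<le> \<mu>" using m_upper[OF R(1)] by blast
  have "\<exists>u v. galerkin R N u v" for N
  proof -
    define m' where "m' s = m (min s R)" for s
    define f :: "(nat \<times> bool \<Rightarrow> real) \<Rightarrow> nat \<times> bool \<Rightarrow> real" where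
      "f = (\<lambda>x (k, c). if c then - ((lam k)\<^sup>2 * m' (\<Sum>j<N. (lam j)\<^sup>2 * (x (j, False))\<^sup>2) * x (k, False)) else x (k, True))"
    define K where "K = 1 + ((lam N)\<^sup>2 * \<mu> + 2 * L * R * real N * (lam N)\<^sup>2)"
    have K: "K \<ge> 1" using \<mu>(1) L(1) R(1) by (simp add: K_def)
    have "\<exists>X. \<forall>i\<in>{..<N} \<times> UNIV. X i 0 = (\<lambda>(k, c). if c then b k else a k) i \<and>
      (\<forall>t\<ge>0. (X i has_real_derivative f (\<lambda>j. X j t) i) (at t within {0..}))"
    proof (rule picard_finite[of _ K])
      fix x y :: "nat \<times> bool \<Rightarrow> real" and i :: "nat \<times> bool" and \<delta> :: real
      assume i: "i \<in> {..<N} \<times> UNIV" and \<delta>: "\<And>j. j \<in> {..<N} \<times> UNIV \<Longrightarrow> \<bar>x j - y j\<bar> \<le> \<delta>"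
      obtain k c where kc: "i = (k, c)" by (cases i)
      have k: "k < N" using i kc by simp
      have \<delta>0: "\<delta> \<ge> 0" using \<delta>[OF i] by linarith
      show "\<bar>f x i - f y i\<bar> \<le> K * \<delta>"
      proof (cases c)
        case True
        have "\<bar>f x i - f y i\<bar> \<le> ((lam N)\<^sup>2 * \<mu> + 2 * L * R * real N * (lam N)\<^sup>2) * \<delta>"
          using cutoff_lipschitz[OF R(1) L \<mu>(2), of N "\<lambda>j. x (j, False)" "\<lambda>j. y (j, False)" \<delta> k] \<delta> k True
          by (simp add: f_def kc m'_def abs_minus_commute)
        also have "\<dots> \<le> K * \<delta>" using \<delta>0 unfolding K_def by (intro mult_right_mono) auto
        finally show ?thesis .
      next
        case False
        have "\<bar>f x i - f y i\<bar> \<le> \<delta>" using \<delta>[of "(k, True)"] k False by (simp add: f_def kc)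
        also have "\<delta> \<le> K * \<delta>" using mult_right_mono[OF K \<delta>0] by simp
        finally show ?thesis .
      qed
    qed (use K in auto)
    then obtain X where X: "\<forall>i\<in>{..<N} \<times> UNIV. X i 0 = (\<lambda>(k, c). if c then b k else a k) i \<and>
      (\<forall>t\<ge>0. (X i has_real_derivative f (\<lambda>j. X j t) i) (at t within {0..}))" by blast
    have X0: "X (k, c) 0 = (if c then b k else a k)" if "k < N" for k c
      using bspec[OF X, of "(k, c)"] that by simp
    have X': "(X (k, c) has_real_derivative f (\<lambda>j. X j t) (k, c)) (at t within {0..})"
      if "k < N" "t \<ge> 0" for k c t
      using bspec[OF X, of "(k, c)"] that by simp
    define u where "u k t = (if k < N then X (k, False) t else 0)" for k t
    define v where "v k t = (if k < N then X (k, True) t else 0)" for k t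
    have sgX: "(\<Sum>j<N. (lam j)\<^sup>2 * (X (j, False) t)\<^sup>2) = sg N u t" for t
      by (simp add: sg_def u_def)
    have u': "(u k has_real_derivative v k t) (at t within {0..})" if "t \<ge> 0" for k t
    proof (cases "k < N")
      case True
      then have "u k = X (k, False)" "v k t = X (k, True) t" by (auto simp: u_def v_def)
      then show ?thesis using X'[OF True that, of False] by (simp add: f_def)
    qed (simp add: u_def[abs_def] v_def)
    have v': "(v k has_real_derivative - ((lam k)\<^sup>2 * m' (sg N u t) * u k t)) (at t within {0..})" if "t \<ge> 0" for k t
    proof (cases "k < N")
      case True
      then have "v k = X (k, True)" "u k t = X (k, False) t" by (auto simp: u_def v_def)
      then show ?thesis using X'[OF True that, of True] by (simp add: f_def sgX)
    qed (simp add: v_def[abs_def] u_def)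
    have m'c: "continuous_on {0..} m'"
      unfolding m'_def
      by (rule continuous_on_compose2[OF m_cont]) (use R in \<open>auto intro!: continuous_intros\<close>)
    define M where "M s = integral {0..s} m'" for s
    have M': "(M has_real_derivative m' s) (at s within {0..})" if "s \<ge> 0" for s
    proof -
      have "continuous_on {0..s + 1} m'" by (rule continuous_on_subset[OF m'c]) auto
      from integral_has_real_derivative[OF this, of s] that
      have "(M has_real_derivative m' s) (at s within {0..s + 1})" by (simp add: M_def[abs_def])
      moreover have "at s within {0..s + 1} = at s within {0..}"
        by (rule at_within_nhd[of s "{..<s + 1}"]) (use that in auto)
      ultimately show ?thesis by simp
    qed
    have m'int: "m' integrable_on {0..s}" for s
      by (intro integrable_continuous_real continuous_on_subset[OF m'c]) auto
    have M_ge: "\<nu> * s \<le> M s" if "s \<ge> 0" for s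
    proof -
      have "integral {0..s} (\<lambda>_. \<nu>) \<le> M s"
        unfolding M_def by (rule integral_le) (use m'int m_ge R in \<open>auto simp: m'_def\<close>)
      then show ?thesis using that by (simp add: mult.commute)
    qed
    define s0 where "s0 = sg N u 0"
    have s0: "0 \<le> s0" "s0 \<le> sinf"
    proof -
      have "s0 = (\<Sum>k<N. (lam k)\<^sup>2 * (a k)\<^sup>2)" by (simp add: s0_def sg_def u_def X0)
      also have "\<dots> \<le> sinf" unfolding sinf_def by (rule sum_le_suminf[OF sa]) auto
      finally show "s0 \<le> sinf" .
    qed (simp add: s0_def sg_nonneg)
    have "M s0 \<le> integral {0..s0} (\<lambda>_. \<mu>0)"
      unfolding M_def by (rule integral_le) (use m'int \<mu>0 R s0 in \<open>auto simp: m'_def\<close>)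
    also have "\<dots> = \<mu>0 * s0" using s0 by simp
    also have "\<dots> \<le> \<mu>0 * sinf" using s0 \<mu>0(1) by (intro mult_left_mono) auto
    finally have Ms0: "M s0 \<le> \<mu>0 * sinf" .
    have v0: "(\<Sum>k<N. (v k 0)\<^sup>2) \<le> B2"
      unfolding B2_def using sum_le_suminf[OF sb, of "{..<N}"] by (simp add: v_def X0)
    \<comment> \<open>Kinetic energy plus \<open>M\<close> of the potential sum, where
      \<open>M\<close> is an antiderivative of the truncated coefficient: the two derivatives
      cancel.\<close>
    define H where "H t = (\<Sum>k<N. (v k t)\<^sup>2) + M (sg N u t)" for t
    have sg': "(sg N u has_real_derivative sd N u v t) (at t within {0..})" if "t \<ge> 0" for t
      unfolding sg_def[abs_def] sd_def
      by (intro DERIV_sum) (auto intro!: derivative_eq_intros u' that)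
    have "(H has_real_derivative 0) (at t within {0..})" if t: "t \<ge> 0" for t
    proof -
      have "((\<lambda>t. M (sg N u t)) has_real_derivative m' (sg N u t) * sd N u v t) (at t within {0..})"
      proof -
        have "(M has_real_derivative m' (sg N u t)) (at (sg N u t) within sg N u ` {0..})"
          by (rule has_field_derivative_subset[OF M'[OF sg_nonneg]]) (auto simp: sg_nonneg)
        from DERIV_image_chain[OF this sg'[OF t]] show ?thesis by (simp add: o_def)
      qed
      moreover have "((\<lambda>t. \<Sum>k<N. (v k t)\<^sup>2) has_real_derivative
          (\<Sum>k<N. 2 * v k t * - ((lam k)\<^sup>2 * m' (sg N u t) * u k t))) (at t within {0..})"
        by (intro DERIV_sum) (auto intro!: derivative_eq_intros v' t)
      ultimately have "(H has_real_derivative (\<Sum>k<N. 2 * v k t * - ((lam k)\<^sup>2 * m' (sg N u t) * u k t)) +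
          m' (sg N u t) * sd N u v t) (at t within {0..})"
        unfolding H_def[abs_def] by (intro DERIV_add)
      moreover have "(\<Sum>k<N. 2 * v k t * - ((lam k)\<^sup>2 * m' (sg N u t) * u k t)) + m' (sg N u t) * sd N u v t = 0"
        by (simp add: sd_def sum_distrib_left sum.distrib[symmetric] sum_negf mult_ac)
      ultimately show ?thesis by simp
    qed
    then obtain c where c: "\<And>t. t \<ge> 0 \<Longrightarrow> H t = c"
      using has_field_derivative_zero_constant[of "{0..}" H] by auto
    have H: "H t \<le> \<nu> * R" if "t \<ge> 0" for t
    proof -
      have "H t = H 0" using c that by simp
      also have "\<dots> \<le> B2 + \<mu>0 * sinf" using v0 Ms0 by (simp add: H_def s0_def)
      finally show ?thesis using RH by linarith
    qed
    have bd: "sg N u t \<le> R \<and> (\<Sum>k<N. (v k t)\<^sup>2) \<le> R" if "t \<ge> 0" for t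
    proof -
      have 1: "(\<Sum>k<N. (v k t)\<^sup>2) \<ge> 0" by (simp add: sum_nonneg)
      have 2: "\<nu> * sg N u t \<le> M (sg N u t)" "0 \<le> \<nu> * sg N u t"
        using M_ge[OF sg_nonneg] sg_nonneg nu by auto
      have 3: "\<nu> * R \<le> R" using nu R(1) mult_right_mono[of \<nu> 1 R] by simp
      have "\<nu> * sg N u t \<le> \<nu> * R" using H[OF that] 1 2 unfolding H_def by linarith
      then have "sg N u t \<le> R" using nu by simp
      moreover have "(\<Sum>k<N. (v k t)\<^sup>2) \<le> R" using H[OF that] 2 3 unfolding H_def by linarith
      ultimately show ?thesis by simp
    qed
    have "galerkin R N u v"
      unfolding galerkin_def
      using u' v' bd by (auto simp: m'_def min_absorb1 u_def v_def X0)
    then show ?thesis by blast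
  qed
  then show ?thesis using R(1) by blast
qed

section \<open>A priori bounds\<close>

lemma galerkinD:
  assumes "galerkin R N u v"
  shows "t \<ge> 0 \<Longrightarrow> (u k has_real_derivative v k t) (at t within {0..})"
    and "t \<ge> 0 \<Longrightarrow> (v k has_real_derivative - ((lam k)\<^sup>2 * m (sg N u t) * u k t)) (at t within {0..})"
    and "k \<ge> N \<Longrightarrow> u k t = 0" and "k \<ge> N \<Longrightarrow> v k t = 0"
    and "k < N \<Longrightarrow> u k 0 = a k" and "k < N \<Longrightarrow> v k 0 = b k"
    and "t \<ge> 0 \<Longrightarrow> sg N u t \<le> R" and "t \<ge> 0 \<Longrightarrow> (\<Sum>k<N. (v k t)\<^sup>2) \<le> R"
  using assms unfolding galerkin_def by blast+

lemma sg_deriv: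
  assumes "galerkin R N u v" "t \<ge> 0"
  shows "(sg N u has_real_derivative sd N u v t) (at t within {0..})"
  unfolding sg_def[abs_def] sd_def
  by (intro DERIV_sum) (auto intro!: derivative_eq_intros galerkinD(1)[OF assms(1)] assms(2))

text \<open>From \<open>2 (lam u) v \<le> (lam u)^2 + v^2\<close> with one factor \<open>lam\<close>
  left over: the derivative of the potential sum needs the energy at the level of
  \<open>A^(1/4) u'\<close> and \<open>A^(3/4) u\<close>. This is the origin of the condition
  \<open>p > 1\<close>.\<close>

lemma abs_sd_le: "\<bar>sd N u v t\<bar> \<le> (\<Sum>k<N. lam k * en k (u k t) (v k t))"
proof -
  have "\<bar>2 * (lam k)\<^sup>2 * u k t * v k t\<bar> \<le> lam k * en k (u k t) (v k t)" for k
  proof -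
    have ab: "\<bar>2 * (x * y)\<bar> \<le> x\<^sup>2 + y\<^sup>2" for x y :: real
      using zero_le_power2[of "x - y"] zero_le_power2[of "x + y"]
      unfolding power2_diff power2_sum by (simp add: abs_le_iff)
    have "\<bar>2 * (lam k)\<^sup>2 * u k t * v k t\<bar> = lam k * \<bar>2 * ((lam k * u k t) * v k t)\<bar>"
      using lam_nonneg[of k] by (simp add: abs_mult power2_eq_square)
    also have "\<dots> \<le> lam k * ((lam k * u k t)\<^sup>2 + (v k t)\<^sup>2)"
      using ab lam_nonneg by (intro mult_left_mono) auto
    finally show ?thesis by (simp add: en_def power_mult_distrib add.commute)
  qed
  then have "(\<Sum>k<N. \<bar>2 * (lam k)\<^sup>2 * u k t * v k t\<bar>) \<le> (\<Sum>k<N. lam k * en k (u k t) (v k t))"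
    by (intro sum_mono)
  then show ?thesis unfolding sd_def by (rule order_trans[OF sum_abs])
qed

text \<open>The Lipschitz condition on \<open>m\<close> needs a two-sided bound on the increment of
  \<open>sg\<close>; it is obtained from one-sided estimates for \<open>sg\<close> and for its
  negative.\<close>

lemma dini_m_sg:
  assumes g: "galerkin R N u v" and t: "t \<ge> 0"
    and L: "L \<ge> 0" "\<And>x y. x \<in> {0..R} \<Longrightarrow> y \<in> {0..R} \<Longrightarrow> \<bar>m x - m y\<bar> \<le> L * \<bar>x - y\<bar>"
  shows "dini_le (\<lambda>s. m (sg N u s)) (L * \<bar>sd N u v t\<bar>) t"
  unfolding dini_le_def
proof (intro allI impI)
  fix \<epsilon> :: real assume \<epsilon>: "\<epsilon> > 0"
  define \<eta> where "\<eta> = \<epsilon> / (L + 1)"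
  have \<eta>: "\<eta> > 0" "L * \<eta> \<le> \<epsilon>"
  proof -
    have "L * \<eta> = \<epsilon> * (L / (L + 1))" by (simp add: \<eta>_def)
    also have "\<dots> \<le> \<epsilon> * 1" using L(1) \<epsilon> by (intro mult_left_mono) auto
    finally show "L * \<eta> \<le> \<epsilon>" by simp
  qed (use \<epsilon> L(1) in \<open>simp add: \<eta>_def\<close>)
  note d = at_within_atLeast_mono[OF sg_deriv[OF g t] t]
  have d': "((\<lambda>s. - sg N u s) has_real_derivative - sd N u v t) (at_right t)"
    by (rule DERIV_minus[OF d])
  from dini_leD[OF dini_le_deriv[OF d] \<eta>(1)] dini_leD[OF dini_le_deriv[OF d'] \<eta>(1)] eventually_at_right_less[of t]
  show "\<forall>\<^sub>F s in at_right t. m (sg N u s) \<le> m (sg N u t) + (L * \<bar>sd N u v t\<bar> + \<epsilon>) * (s - t)"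
  proof eventually_elim
    case (elim s)
    have "\<bar>sg N u s - sg N u t\<bar> \<le> (\<bar>sd N u v t\<bar> + \<eta>) * (s - t)"
    proof -
      have "(sd N u v t + \<eta>) * (s - t) \<le> (\<bar>sd N u v t\<bar> + \<eta>) * (s - t)"
        "(- sd N u v t + \<eta>) * (s - t) \<le> (\<bar>sd N u v t\<bar> + \<eta>) * (s - t)"
        using elim(3) by (auto intro!: mult_right_mono)
      then show ?thesis using elim(1,2) by linarith
    qed
    then have "L * \<bar>sg N u s - sg N u t\<bar> \<le> L * ((\<bar>sd N u v t\<bar> + \<eta>) * (s - t))"
      by (rule mult_left_mono[OF _ L(1)])
    moreover have "\<bar>m (sg N u s) - m (sg N u t)\<bar> \<le> L * \<bar>sg N u s - sg N u t\<bar>"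
      using galerkinD(7)[OF g] t elim(3) by (intro L) (auto simp: sg_nonneg)
    moreover have "L * ((\<bar>sd N u v t\<bar> + \<eta>) * (s - t)) \<le> (L * \<bar>sd N u v t\<bar> + \<epsilon>) * (s - t)"
      using mult_right_mono[OF \<eta>(2), of "s - t"] elim(3) by (simp add: algebra_simps)
    ultimately show ?case by linarith
  qed
qed

lemma wen_nonneg: "(\<And>k. w k \<ge> 0) \<Longrightarrow> wen w N u v t \<ge> 0"
  unfolding wen_def using m_pos[OF sg_nonneg]
  by (intro sum_nonneg mult_nonneg_nonneg add_nonneg_nonneg) (auto intro: less_imp_le)

lemma en_le_energy:
  assumes "\<nu> \<le> c"
  shows "\<nu> * en k x y \<le> y\<^sup>2 + c * (lam k)\<^sup>2 * x\<^sup>2"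
proof -
  have "\<nu> * y\<^sup>2 \<le> 1 * y\<^sup>2" using nu by (intro mult_right_mono) auto
  moreover have "\<nu> * ((lam k)\<^sup>2 * x\<^sup>2) \<le> c * ((lam k)\<^sup>2 * x\<^sup>2)" using assms by (intro mult_right_mono) auto
  ultimately show ?thesis by (simp add: en_def algebra_simps)
qed

lemma energy_le_en:
  assumes "c \<le> \<mu>" "\<mu> \<ge> 1"
  shows "y\<^sup>2 + c * (lam k)\<^sup>2 * x\<^sup>2 \<le> \<mu> * en k x y"
proof -
  have "1 * y\<^sup>2 \<le> \<mu> * y\<^sup>2" using assms by (intro mult_right_mono) auto
  moreover have "c * ((lam k)\<^sup>2 * x\<^sup>2) \<le> \<mu> * ((lam k)\<^sup>2 * x\<^sup>2)" using assms by (intro mult_right_mono) auto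
  ultimately show ?thesis by (simp add: en_def algebra_simps)
qed

text \<open>The modes interact only through the coefficient, so each energy grows at the rate
  \<open>L / \<nu> * \<bar>sd\<bar>\<close>, the same for all \<open>k\<close>. Hence any
  nonnegative weights may be put on the modes.\<close>

lemma galerkin_energy_dini:
  assumes g: "galerkin R N u v" and t: "t \<ge> 0"
    and L: "L \<ge> 0" "\<And>x y. x \<in> {0..R} \<Longrightarrow> y \<in> {0..R} \<Longrightarrow> \<bar>m x - m y\<bar> \<le> L * \<bar>x - y\<bar>"
  shows "dini_le (\<lambda>s. (v k s)\<^sup>2 + m (sg N u s) * (lam k)\<^sup>2 * (u k s)\<^sup>2)
    (L / \<nu> * \<bar>sd N u v t\<bar> * ((v k t)\<^sup>2 + m (sg N u t) * (lam k)\<^sup>2 * (u k t)\<^sup>2)) t"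
proof -
  have d: "dini_le (\<lambda>s. (v k s)\<^sup>2 + m (sg N u s) * (lam k)\<^sup>2 * (u k s)\<^sup>2)
     (2 * v k t * 0 + L * \<bar>sd N u v t\<bar> * ((lam k)\<^sup>2 * (u k t)\<^sup>2)) t"
    using at_within_atLeast_mono[OF galerkinD(1)[OF g t] t, of k] at_within_atLeast_mono[OF galerkinD(2)[OF g t] t, of k]
    by (intro energy_dini dini_m_sg[OF g t L]) (simp_all add: L(1) mult_ac)
  have "(lam k)\<^sup>2 * (u k t)\<^sup>2 \<le> en k (u k t) (v k t)" by (simp add: en_def)
  also have "en k (u k t) (v k t) \<le> ((v k t)\<^sup>2 + m (sg N u t) * (lam k)\<^sup>2 * (u k t)\<^sup>2) / \<nu>"
    using en_le_energy[OF m_ge[OF sg_nonneg], of k "u k t" "v k t" N u t] nu by (simp add: field_simps)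
  finally have "L * \<bar>sd N u v t\<bar> * ((lam k)\<^sup>2 * (u k t)\<^sup>2) \<le>
     L * \<bar>sd N u v t\<bar> * (((v k t)\<^sup>2 + m (sg N u t) * (lam k)\<^sup>2 * (u k t)\<^sup>2) / \<nu>)"
    using L(1) by (intro mult_left_mono) auto
  then show ?thesis by (intro dini_le_mono[OF d]) (simp add: mult_ac)
qed

lemma wen_dini:
  assumes g: "galerkin R N u v" and t: "t \<ge> 0"
    and L: "L \<ge> 0" "\<And>x y. x \<in> {0..R} \<Longrightarrow> y \<in> {0..R} \<Longrightarrow> \<bar>m x - m y\<bar> \<le> L * \<bar>x - y\<bar>"
    and w: "\<And>k. w k \<ge> 0"
  shows "dini_le (wen w N u v) (L / \<nu> * \<bar>sd N u v t\<bar> * wen w N u v t) t"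
  unfolding wen_def[abs_def] sum_distrib_left
proof (intro dini_le_sum)
  fix k
  show "dini_le (\<lambda>s. w k * ((v k s)\<^sup>2 + m (sg N u s) * (lam k)\<^sup>2 * (u k s)\<^sup>2))
    (L / \<nu> * \<bar>sd N u v t\<bar> * (w k * ((v k t)\<^sup>2 + m (sg N u t) * (lam k)\<^sup>2 * (u k t)\<^sup>2))) t"
    using dini_le_cmult[OF galerkin_energy_dini[OF g t L, of k] w[of k]] by (simp add: mult_ac)
qed simp

lemma galerkin_cont:
  assumes g: "galerkin R N u v"
  shows "continuous_on {0..} (u k)" "continuous_on {0..} (v k)" "continuous_on {0..} (\<lambda>s. m (sg N u s))"
proof -
  show u: "continuous_on {0..} (u k)" and v: "continuous_on {0..} (v k)"
    by (rule DERIV_continuous_on[OF galerkinD(1)[OF g]] DERIV_continuous_on[OF galerkinD(2)[OF g]]; simp)+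
  have "continuous_on {0..} (sg N u)"
    by (rule DERIV_continuous_on[OF sg_deriv[OF g]]) simp
  then show "continuous_on {0..} (\<lambda>s. m (sg N u s))"
    by (rule continuous_on_compose2[OF m_cont]) (auto simp: sg_nonneg)
qed

lemma wen_cont:
  assumes g: "galerkin R N u v"
  shows "continuous_on {0..} (wen w N u v)"
  unfolding wen_def[abs_def] by (intro continuous_intros galerkin_cont[OF g])

text \<open>The spectral gap enters here: the energy \<open>F\<close> of the modes above \<open>n\<close>, weighted by \<open>lam\<close>, starts
  below \<open>(B + 1) exp (- (p - 1) lam\<^sub>n)\<close> and satisfies \<open>F' \<le> C (lam\<^sub>n + F) F\<close>, so that it stays below \<open>1\<close>
  for a time which depends neither on \<open>B\<close> nor on \<open>n\<close>.\<close>

lemma energy_step: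
  assumes R: "R \<ge> 0"
  obtains \<tau> where "\<tau> > 0" "\<And>B. B \<ge> 0 \<Longrightarrow> \<exists>B'\<ge>0. \<exists>K\<ge>0. \<forall>N u v t0. galerkin R N u v \<and> t0 \<ge> 0 \<and>
     wen (\<lambda>k. lam k powr p) N u v t0 \<le> B \<longrightarrow>
     (\<forall>t\<in>{t0..t0 + \<tau>}. \<bar>sd N u v t\<bar> \<le> K \<and> wen (\<lambda>k. lam k powr p) N u v t \<le> B')"
proof -
  obtain L where L: "L \<ge> 0" "\<And>x y. x \<in> {0..R} \<Longrightarrow> y \<in> {0..R} \<Longrightarrow> \<bar>m x - m y\<bar> \<le> L * \<bar>x - y\<bar>"
    using m_lip[OF R] by blast
  define H1 where "H1 = 2 * R"
  have H1: "H1 \<ge> 0" using R by (simp add: H1_def)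
  \<comment> \<open>Since \<open>K = l H1 + 1 / \<nu>\<close> is at most
    \<open>(H1 + 1 / \<nu>) (l + 1)\<close>, the rate \<open>L / \<nu> * K\<close> is below
    \<open>C1 (l + 1)\<close>. The summand 1 makes this strict, as the barrier argument demands, and
    keeps \<open>C1\<close> positive.\<close>
  define C1 where "C1 = L / \<nu> * (H1 + 1 / \<nu>) + 1"
  have C1: "C1 \<ge> 1" using L nu H1 by (simp add: C1_def)
  define \<delta> where "\<delta> = p - 1"
  have \<delta>: "\<delta> > 0" using p by (simp add: \<delta>_def)
  \<comment> \<open>Growth at the rate \<open>C1 (l + 1)\<close> during this time costs
    \<open>\<delta> / 2 * (l + 1)\<close> in the exponent, about half of the initial gain
    \<open>\<delta> * l\<close>.\<close>
  define \<tau> where "\<tau> = \<delta> / (2 * C1)"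
  have \<tau>: "\<tau> > 0" using \<delta> C1 by (simp add: \<tau>_def)
  let ?pw = "\<lambda>k. lam k powr p"
  have pw: "?pw k \<ge> 0" for k by simp
  have "\<exists>B'\<ge>0. \<exists>K\<ge>0. \<forall>N u v t0. galerkin R N u v \<and> t0 \<ge> 0 \<and> wen ?pw N u v t0 \<le> B \<longrightarrow>
     (\<forall>t\<in>{t0..t0 + \<tau>}. \<bar>sd N u v t\<bar> \<le> K \<and> wen ?pw N u v t \<le> B')" if B: "B \<ge> 0" for B
  proof -
    \<comment> \<open>The split level: \<open>lam n \<ge> n\<close> is so large that the other half
      of the gain pays for \<open>ln (B + 1) + \<delta> / 2\<close>. Using \<open>B + 1\<close> in
      place of \<open>B\<close> keeps \<open>G\<close> positive and the logarithm
      nonnegative.\<close>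
    obtain n :: nat where n: "real n \<ge> 2 / \<delta> * (ln (B + 1) + \<delta> / 2)"
      using real_arch_simple by blast
    have "\<delta> / 2 * (2 / \<delta> * (ln (B + 1) + \<delta> / 2)) \<le> \<delta> / 2 * lam n"
      using n lam_ge[of n] \<delta> by (intro mult_left_mono) auto
    then have n': "ln (B + 1) + \<delta> / 2 \<le> \<delta> / 2 * lam n" using \<delta> by simp
    define l where "l = lam n"
    have l: "l \<ge> 0" by (simp add: l_def lam_nonneg)
    define w where "w k = (if k > n then lam k else 0)" for k
    have w: "w k \<ge> 0" for k by (simp add: w_def lam_nonneg)
    define G where "G = (B + 1) * exp (- (\<delta> * l))"
    have G: "G > 0" using B by (simp add: G_def)
    define C where "C = C1 * (l + 1)"
    define K where "K = l * H1 + 1 / \<nu>"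
    have K: "K \<ge> 0" using l H1 nu by (simp add: K_def)
    have KC: "L / \<nu> * K < C"
    proof -
      have "(H1 + 1 / \<nu>) * (l + 1) = l * H1 + H1 + 1 / \<nu> + l * (1 / \<nu>)"
        by (simp add: distrib_left distrib_right)
      moreover have "0 \<le> l * (1 / \<nu>)" using l nu by simp
      ultimately have "K \<le> (H1 + 1 / \<nu>) * (l + 1)" using H1 unfolding K_def by linarith
      then have "L / \<nu> * K \<le> L / \<nu> * ((H1 + 1 / \<nu>) * (l + 1))" using L nu by (intro mult_left_mono) auto
      also have "\<dots> < C"
      proof -
        have "C = L / \<nu> * ((H1 + 1 / \<nu>) * (l + 1)) + (l + 1)"
          unfolding C_def C1_def
          by (simp only: distrib_right[of "L / \<nu> * (H1 + 1 / \<nu>)" 1] mult.assoc mult_1_left)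
        then show ?thesis using l by linarith
      qed
      finally show ?thesis .
    qed
    have C\<tau>: "G * exp (C * s) \<le> 1" if "0 \<le> s" "s \<le> \<tau>" for s
    proof -
      have "C * s \<le> C * \<tau>" using that C1 l by (intro mult_left_mono) (auto simp: C_def)
      also have "C * \<tau> = \<delta> / 2 * (l + 1)" using C1 by (simp add: C_def \<tau>_def)
      finally have "ln (B + 1) - \<delta> * l + C * s \<le> 0" using n' by (simp add: l_def algebra_simps)
      moreover have "G * exp (C * s) = exp (ln (B + 1) - \<delta> * l + C * s)"
        using B by (simp add: G_def exp_add exp_diff exp_minus field_simps)
      ultimately show ?thesis by simp
    qed
    \<comment> \<open>Modes above \<open>n\<close> have \<open>lam k \<ge> exp l\<close>; replacing
      the weight \<open>lam^p\<close> by \<open>lam\<close> therefore gains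
      \<open>exp (- \<delta> l)\<close>.\<close>
    have wp: "w k \<le> exp (- (\<delta> * l)) * ?pw k" for k
    proof (cases "k > n")
      case True
      have lk: "exp l \<le> lam k" using lam_Suc[of n] lam_mono[of "Suc n" k] True by (simp add: l_def)
      then have lk0: "lam k > 0" using exp_gt_zero[of l] by linarith
      have "exp (\<delta> * l) = exp l powr \<delta>" by (simp add: powr_def mult.commute)
      also have "\<dots> \<le> lam k powr \<delta>" using lk \<delta> by (intro powr_mono2) auto
      finally have "exp (\<delta> * l) * lam k \<le> lam k powr \<delta> * lam k" using lk0 by simp
      also have "\<dots> = ?pw k" using lk0 by (simp add: \<delta>_def powr_diff)
      finally have "exp (\<delta> * l) * lam k \<le> ?pw k" .
      then show ?thesis using True by (simp add: w_def exp_minus field_simps)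
    qed (simp add: w_def)
    have concl: "\<bar>sd N u v t\<bar> \<le> K \<and> wen ?pw N u v t \<le> B * exp (L / \<nu> * K * \<tau>)"
      if g: "galerkin R N u v" and t0: "t0 \<ge> 0" and B0: "wen ?pw N u v t0 \<le> B"
        and t: "t \<in> {t0..t0 + \<tau>}" for N u v t0 t
    proof -
      \<comment> \<open>Modes up to \<open>n\<close> have frequency at most \<open>l\<close> and
        share the total energy bound \<open>H1\<close>; the remaining ones are measured by the
        weight \<open>w\<close>.\<close>
      have sdw: "\<bar>sd N u v s\<bar> \<le> l * H1 + wen w N u v s / \<nu>" if s: "s \<ge> 0" for s
      proof -
        have "\<bar>sd N u v s\<bar> \<le> (\<Sum>k<N. lam k * en k (u k s) (v k s))" by (rule abs_sd_le)
        also have "\<dots> \<le> (\<Sum>k<N. l * en k (u k s) (v k s) + w k * en k (u k s) (v k s))"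
        proof (rule sum_mono)
          fix k
          have "lam k \<le> l + w k" using l lam_mono[of k n] by (simp add: w_def l_def)
          then show "lam k * en k (u k s) (v k s) \<le> l * en k (u k s) (v k s) + w k * en k (u k s) (v k s)"
            using mult_right_mono[OF _ en_nonneg, of "lam k" "l + w k" k "u k s" "v k s"] by (simp add: distrib_right)
        qed
        also have "\<dots> = l * ((\<Sum>k<N. (v k s)\<^sup>2) + sg N u s) + (\<Sum>k<N. w k * en k (u k s) (v k s))"
          by (simp add: sum.distrib sum_distrib_left en_def sg_def distrib_left)
        also have "\<dots> \<le> l * H1 + wen w N u v s / \<nu>"
        proof (rule add_mono)
          show "l * ((\<Sum>k<N. (v k s)\<^sup>2) + sg N u s) \<le> l * H1"
            using galerkinD(7,8)[OF g s] l by (intro mult_left_mono) (auto simp: H1_def)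
          have "(\<Sum>k<N. w k * en k (u k s) (v k s)) \<le> (\<Sum>k<N. w k * ((v k s)\<^sup>2 + m (sg N u s) * (lam k)\<^sup>2 * (u k s)\<^sup>2) / \<nu>)"
          proof (rule sum_mono)
            fix k
            have "en k (u k s) (v k s) \<le> ((v k s)\<^sup>2 + m (sg N u s) * (lam k)\<^sup>2 * (u k s)\<^sup>2) / \<nu>"
              using en_le_energy[OF m_ge[OF sg_nonneg], of k "u k s" "v k s" N u s] nu by (simp add: field_simps)
            from mult_left_mono[OF this w[of k]]
            show "w k * en k (u k s) (v k s) \<le> w k * ((v k s)\<^sup>2 + m (sg N u s) * (lam k)\<^sup>2 * (u k s)\<^sup>2) / \<nu>" by simp
          qed
          then show "(\<Sum>k<N. w k * en k (u k s) (v k s)) \<le> wen w N u v s / \<nu>"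
            by (simp add: wen_def sum_divide_distrib)
        qed
        finally show ?thesis .
      qed
      have F0: "wen w N u v t0 \<le> G"
      proof -
        have "wen w N u v t0 \<le> (\<Sum>k<N. exp (- (\<delta> * l)) * (?pw k * ((v k t0)\<^sup>2 + m (sg N u t0) * (lam k)\<^sup>2 * (u k t0)\<^sup>2)))"
          unfolding wen_def
        proof (rule sum_mono)
          fix k
          have "0 \<le> (v k t0)\<^sup>2 + m (sg N u t0) * (lam k)\<^sup>2 * (u k t0)\<^sup>2"
            using m_pos[OF sg_nonneg[of N u t0]] by simp
          from mult_right_mono[OF wp[of k] this]
          show "w k * ((v k t0)\<^sup>2 + m (sg N u t0) * (lam k)\<^sup>2 * (u k t0)\<^sup>2) \<le>
             exp (- (\<delta> * l)) * (?pw k * ((v k t0)\<^sup>2 + m (sg N u t0) * (lam k)\<^sup>2 * (u k t0)\<^sup>2))"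
            by (simp only: mult.assoc)
        qed
        also have "\<dots> = exp (- (\<delta> * l)) * wen ?pw N u v t0" by (simp add: wen_def sum_distrib_left)
        also have "\<dots> \<le> exp (- (\<delta> * l)) * (B + 1)" using B0 by (intro mult_left_mono) auto
        finally show ?thesis by (simp add: G_def mult.commute)
      qed
      have Fle: "wen w N u v s \<le> G * exp (C * (s - t0))" if s: "s \<in> {t0..t0 + \<tau>}" for s
      proof (rule dini_barrier[where f="wen w N u v" and a=t0 and G=G, OF _ F0 _ s])
        show "continuous_on {t0..t0 + \<tau>} (wen w N u v)"
          by (rule continuous_on_subset[OF wen_cont[OF g]]) (use t0 in auto)
        \<comment> \<open>At a contact point the high energy equals the barrier, which is at most 1
          by \<open>C\<tau>\<close>. So \<open>\<bar>sd\<bar> \<le> K\<close> there, and the actual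
          growth rate is below \<open>C\<close>.\<close>
        fix s assume s: "t0 \<le> s" "s < t0 + \<tau>" and eq: "wen w N u v s = G * exp (C * (s - t0))"
        have F1: "0 < wen w N u v s" "wen w N u v s \<le> 1" using C\<tau>[of "s - t0"] s G unfolding eq by auto
        have s0: "s \<ge> 0" using s t0 by simp
        have "wen w N u v s / \<nu> \<le> 1 / \<nu>" using F1 nu by (intro divide_right_mono) auto
        then have "\<bar>sd N u v s\<bar> \<le> K" using sdw[OF s0] by (simp add: K_def)
        then have "L / \<nu> * \<bar>sd N u v s\<bar> \<le> L / \<nu> * K" using L nu by (intro mult_left_mono) auto
        then have "L / \<nu> * \<bar>sd N u v s\<bar> < C" using KC by linarith
        then have "L / \<nu> * \<bar>sd N u v s\<bar> * wen w N u v s < C * wen w N u v s"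
          using F1(1) by (rule mult_strict_right_mono)
        moreover have "dini_le (wen w N u v) (L / \<nu> * \<bar>sd N u v s\<bar> * wen w N u v s) s"
          using L w by (intro wen_dini[OF g s0])
        ultimately show "\<exists>d<C * wen w N u v s. dini_le (wen w N u v) d s" by blast
      qed
      have sdK: "\<bar>sd N u v s\<bar> \<le> K" if s: "s \<in> {t0..t0 + \<tau>}" for s
      proof -
        have "wen w N u v s \<le> 1" using Fle[OF s] C\<tau>[of "s - t0"] s by auto
        then have "wen w N u v s / \<nu> \<le> 1 / \<nu>" using nu by (intro divide_right_mono) auto
        then show ?thesis using sdw[of s] s t0 by (simp add: K_def)
      qed
      have "wen ?pw N u v t \<le> wen ?pw N u v t0 * exp (L / \<nu> * K * (t - t0))"
      proof (rule dini_gronwall[OF _ _ _ t])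
        show "continuous_on {t0..t0 + \<tau>} (wen ?pw N u v)"
          by (rule continuous_on_subset[OF wen_cont[OF g]]) (use t0 in auto)
        show "wen ?pw N u v s \<ge> 0" for s by (rule wen_nonneg[OF pw])
        fix s assume s: "t0 \<le> s" "s < t0 + \<tau>"
        have "L / \<nu> * \<bar>sd N u v s\<bar> * wen ?pw N u v s \<le> L / \<nu> * K * wen ?pw N u v s"
          using sdK[of s] s L nu wen_nonneg[OF pw] by (intro mult_right_mono mult_left_mono) auto
        then show "dini_le (wen ?pw N u v) (L / \<nu> * K * wen ?pw N u v s) s"
          using s t0 L pw by (intro dini_le_mono[OF wen_dini[OF g]]) auto
      qed
      also have "\<dots> \<le> B * exp (L / \<nu> * K * \<tau>)"
      proof (rule mult_mono)
        show "exp (L / \<nu> * K * (t - t0)) \<le> exp (L / \<nu> * K * \<tau>)"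
          unfolding exp_le_cancel_iff using t L(1) nu K by (intro mult_left_mono) auto
      qed (use B0 B in auto)
      finally show ?thesis using sdK[OF t] by simp
    qed
    show ?thesis
      by (rule exI[of _ "B * exp (L / \<nu> * K * \<tau>)"], rule conjI, use B in simp, rule exI[of _ K])
        (use K concl in blast)
  qed
  with \<tau> show thesis by (rule that)
qed

text \<open>The bound \<open>B\<close> may increase from step to step, but the step length
  \<open>\<tau>\<close> does not depend on it; finitely many steps reach any
  \<open>T\<close>.\<close>

lemma sd_bounded:
  assumes R: "R \<ge> 0"
  shows "\<exists>K\<ge>0. \<forall>N u v. galerkin R N u v \<longrightarrow> (\<forall>t\<in>{0..T}. \<bar>sd N u v t\<bar> \<le> K)"
proof -
  let ?pw = "\<lambda>k. lam k powr p"
  obtain \<mu> where \<mu>: "\<mu> \<ge> 1" "\<And>s. 0 \<le> s \<Longrightarrow> s \<le> R \<Longrightarrow> m s \<le> \<mu>" using m_upper[OF R] by blast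
  obtain \<tau> where \<tau>: "\<tau> > 0" and step: "\<And>B. B \<ge> 0 \<Longrightarrow> \<exists>B'\<ge>0. \<exists>K\<ge>0. \<forall>N u v t0. galerkin R N u v \<and> t0 \<ge> 0 \<and>
     wen ?pw N u v t0 \<le> B \<longrightarrow>
     (\<forall>t\<in>{t0..t0 + \<tau>}. \<bar>sd N u v t\<bar> \<le> K \<and> wen ?pw N u v t \<le> B')"
    using energy_step[OF R] by blast
  \<comment> \<open>The bound on \<open>sd\<close> is asked only before the end point, so that it is
    vacuous for \<open>j = 0\<close>.\<close>
  have iter: "\<exists>B\<ge>0. \<exists>K\<ge>0. \<forall>N u v. galerkin R N u v \<longrightarrow>
    wen ?pw N u v (real j * \<tau>) \<le> B \<and> (\<forall>t\<in>{0..real j * \<tau>}. t < real j * \<tau> \<longrightarrow> \<bar>sd N u v t\<bar> \<le> K)" for j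
  proof (induct j)
    case 0
    define B where "B = \<mu> * (\<Sum>k. lam k powr p * en k (a k) (b k))"
    have "B \<ge> 0" using \<mu>(1) data' by (auto simp: B_def en_nonneg intro!: mult_nonneg_nonneg suminf_nonneg)
    moreover have "wen ?pw N u v 0 \<le> B" if g: "galerkin R N u v" for N u v
    proof -
      have "wen ?pw N u v 0 \<le> (\<Sum>k<N. \<mu> * (lam k powr p * en k (a k) (b k)))"
        unfolding wen_def
      proof (rule sum_mono)
        fix k assume k: "k \<in> {..<N}"
        have "m (sg N u 0) \<le> \<mu>" using galerkinD(7)[OF g, of 0] by (intro \<mu>(2) sg_nonneg) auto
        from mult_left_mono[OF energy_le_en[OF this \<mu>(1), of "b k" k "a k"] powr_ge_zero, of "lam k" p]
        show "lam k powr p * ((v k 0)\<^sup>2 + m (sg N u 0) * (lam k)\<^sup>2 * (u k 0)\<^sup>2) \<le> \<mu> * (lam k powr p * en k (a k) (b k))"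
          using galerkinD(5,6)[OF g] k by (simp add: mult_ac)
      qed
      also have "\<dots> = \<mu> * (\<Sum>k<N. lam k powr p * en k (a k) (b k))" by (simp add: sum_distrib_left)
      also have "\<dots> \<le> B"
        unfolding B_def using \<mu>(1) data' by (intro mult_left_mono sum_le_suminf) (auto simp: en_nonneg)
      finally show ?thesis .
    qed
    ultimately show ?case by (intro exI[of _ B] conjI exI[of _ 0]) auto
  next
    case (Suc j)
    then obtain B K where BK: "B \<ge> 0" "K \<ge> 0" and H: "\<And>N u v. galerkin R N u v \<Longrightarrow>
      wen ?pw N u v (real j * \<tau>) \<le> B \<and> (\<forall>t\<in>{0..real j * \<tau>}. t < real j * \<tau> \<longrightarrow> \<bar>sd N u v t\<bar> \<le> K)" by blast
    from step[OF BK(1)] obtain B' K' where BK': "B' \<ge> 0" "K' \<ge> 0" and H': "\<And>N u v t0. galerkin R N u v \<Longrightarrow> t0 \<ge> 0 \<Longrightarrow>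
     wen ?pw N u v t0 \<le> B \<Longrightarrow> (\<forall>t\<in>{t0..t0 + \<tau>}. \<bar>sd N u v t\<bar> \<le> K' \<and> wen ?pw N u v t \<le> B')" by blast
    have SJ: "real (Suc j) * \<tau> = real j * \<tau> + \<tau>" by (simp add: algebra_simps)
    have "wen ?pw N u v (real (Suc j) * \<tau>) \<le> B' \<and>
      (\<forall>t\<in>{0..real (Suc j) * \<tau>}. t < real (Suc j) * \<tau> \<longrightarrow> \<bar>sd N u v t\<bar> \<le> max K K')" if g: "galerkin R N u v" for N u v
    proof -
      note h' = H'[OF g, of "real j * \<tau>"]
      have j0: "real j * \<tau> \<ge> 0" using \<tau> by simp
      show ?thesis unfolding SJ
      proof (intro conjI ballI impI)
        show "wen ?pw N u v (real j * \<tau> + \<tau>) \<le> B'" using h' H[OF g] j0 \<tau> by auto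
        fix t assume t: "t \<in> {0..real j * \<tau> + \<tau>}" "t < real j * \<tau> + \<tau>"
        show "\<bar>sd N u v t\<bar> \<le> max K K'"
        proof (cases "t < real j * \<tau>")
          case True
          then show ?thesis using H[OF g] t by (auto simp: le_max_iff_disj)
        next
          case False
          then show ?thesis using h' H[OF g] j0 t by (auto simp: le_max_iff_disj)
        qed
      qed
    qed
    then show ?case using BK BK' by (intro exI[of _ B'] conjI exI[of _ "max K K'"]) auto
  qed
  obtain j :: nat where "T / \<tau> < real j" using reals_Archimedean2 by blast
  then have j: "T < real j * \<tau>" using \<tau> by (simp add: field_simps)
  from iter[of j] obtain B K where K: "K \<ge> 0" "\<And>N u v. galerkin R N u v \<Longrightarrow>
    (\<forall>t\<in>{0..real j * \<tau>}. t < real j * \<tau> \<longrightarrow> \<bar>sd N u v t\<bar> \<le> K)" by blast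
  then show ?thesis using j by (intro exI[of _ K]) auto
qed

text \<open>A bound on \<open>sd\<close> turns the energy inequality of each mode into Gronwall's
  inequality with a rate independent of \<open>k\<close> and \<open>N\<close>. The resulting
  multiples of the initial energies are the majorants for all later passages to the limit.\<close>

lemma component_bound:
  assumes R: "R \<ge> 0"
  shows "\<exists>C\<ge>0. \<forall>N u v. galerkin R N u v \<longrightarrow>
    (\<forall>t\<in>{0..T}. \<forall>k. en k (u k t) (v k t) \<le> C * en k (a k) (b k))"
    and "\<exists>K\<ge>0. \<forall>N u v. galerkin R N u v \<longrightarrow>
    (\<forall>s\<in>{0..T}. \<forall>t\<in>{0..T}. \<bar>m (sg N u s) - m (sg N u t)\<bar> \<le> K * \<bar>s - t\<bar>)"
proof -
  obtain L where L: "L \<ge> 0" "\<And>x y. x \<in> {0..R} \<Longrightarrow> y \<in> {0..R} \<Longrightarrow> \<bar>m x - m y\<bar> \<le> L * \<bar>x - y\<bar>"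
    using m_lip[OF R] by blast
  obtain \<mu> where \<mu>: "\<mu> \<ge> 1" "\<And>s. 0 \<le> s \<Longrightarrow> s \<le> R \<Longrightarrow> m s \<le> \<mu>" using m_upper[OF R] by blast
  obtain K where K: "K \<ge> 0" "\<And>N u v t. galerkin R N u v \<Longrightarrow> t \<in> {0..T} \<Longrightarrow> \<bar>sd N u v t\<bar> \<le> K"
    using sd_bounded[OF R, of T] by blast
  have "\<bar>m (sg N u s) - m (sg N u t)\<bar> \<le> (L * K) * \<bar>s - t\<bar>"
    if g: "galerkin R N u v" and st: "s \<in> {0..T}" "t \<in> {0..T}" for N u v s t
  proof -
    have "norm (sg N u s - sg N u t) \<le> K * norm (s - t)"
    proof (rule field_differentiable_bound[of "{0..T}"])
      show "(sg N u has_field_derivative sd N u v x) (at x within {0..T})" if "x \<in> {0..T}" for x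
        by (rule has_field_derivative_subset[OF sg_deriv[OF g]]) (use that in auto)
      show "norm (sd N u v x) \<le> K" if "x \<in> {0..T}" for x using K(2)[OF g that] by simp
    qed (use st in auto)
    then have "L * \<bar>sg N u s - sg N u t\<bar> \<le> L * (K * \<bar>s - t\<bar>)" using L(1) by (intro mult_left_mono) auto
    moreover have "\<bar>m (sg N u s) - m (sg N u t)\<bar> \<le> L * \<bar>sg N u s - sg N u t\<bar>"
      using galerkinD(7)[OF g] st by (intro L(2)) (auto simp: sg_nonneg)
    ultimately show ?thesis by simp
  qed
  then show "\<exists>K\<ge>0. \<forall>N u v. galerkin R N u v \<longrightarrow>
    (\<forall>s\<in>{0..T}. \<forall>t\<in>{0..T}. \<bar>m (sg N u s) - m (sg N u t)\<bar> \<le> K * \<bar>s - t\<bar>)"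
    using L(1) K(1) by (intro exI[of _ "L * K"]) auto
  define C where "C = \<mu> / \<nu> * exp (L / \<nu> * K * \<bar>T\<bar>)"
  have C: "C \<ge> 0" using \<mu>(1) nu by (simp add: C_def)
  have "en k (u k t) (v k t) \<le> C * en k (a k) (b k)"
    if g: "galerkin R N u v" and t: "t \<in> {0..T}" for N u v t k
  proof (cases "k < N")
    case False
    then show ?thesis using galerkinD(3,4)[OF g] C by (simp add: en_def)
  next
    case True
    define Q where "Q s = (v k s)\<^sup>2 + m (sg N u s) * (lam k)\<^sup>2 * (u k s)\<^sup>2" for s
    have Q0: "Q s \<ge> 0" for s using m_pos[OF sg_nonneg[of N u s]] by (simp add: Q_def)
    have "Q t \<le> Q 0 * exp (L / \<nu> * K * (t - 0))"
    proof (rule dini_gronwall[OF _ Q0 _ t])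
      show "continuous_on {0..T} Q" unfolding Q_def
        by (intro continuous_intros continuous_on_subset[OF galerkin_cont(1)[OF g]]
          continuous_on_subset[OF galerkin_cont(2)[OF g]] continuous_on_subset[OF galerkin_cont(3)[OF g]]) auto
      fix s assume s: "0 \<le> s" "s < T"
      have "L / \<nu> * \<bar>sd N u v s\<bar> * Q s \<le> L / \<nu> * K * Q s"
        using K(2)[OF g, of s] s L nu Q0 by (intro mult_right_mono mult_left_mono) auto
      then show "dini_le Q (L / \<nu> * K * Q s) s"
        using galerkin_energy_dini[OF g s(1) L, of k] unfolding Q_def by (rule dini_le_mono[rotated])
    qed
    also have "\<dots> \<le> (\<mu> * en k (a k) (b k)) * exp (L / \<nu> * K * \<bar>T\<bar>)"
    proof (rule mult_mono)
      have "m (sg N u 0) \<le> \<mu>" using galerkinD(7)[OF g, of 0] by (intro \<mu>(2) sg_nonneg) auto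
      from energy_le_en[OF this \<mu>(1)] show "Q 0 \<le> \<mu> * en k (a k) (b k)"
        using galerkinD(5,6)[OF g True] by (simp add: Q_def)
      show "exp (L / \<nu> * K * (t - 0)) \<le> exp (L / \<nu> * K * \<bar>T\<bar>)"
        unfolding exp_le_cancel_iff using t L nu K(1) by (intro mult_left_mono) auto
    qed (use \<mu>(1) en_nonneg in auto)
    finally have "Q t \<le> \<mu> * en k (a k) (b k) * exp (L / \<nu> * K * \<bar>T\<bar>)" .
    moreover have "\<nu> * en k (u k t) (v k t) \<le> Q t"
      unfolding Q_def by (rule en_le_energy[OF m_ge[OF sg_nonneg]])
    ultimately have "\<nu> * en k (u k t) (v k t) \<le> \<mu> * en k (a k) (b k) * exp (L / \<nu> * K * \<bar>T\<bar>)" by linarith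
    then show ?thesis using nu by (simp add: C_def field_simps)
  qed
  then show "\<exists>C\<ge>0. \<forall>N u v. galerkin R N u v \<longrightarrow>
    (\<forall>t\<in>{0..T}. \<forall>k. en k (u k t) (v k t) \<le> C * en k (a k) (b k))"
    using C by blast
qed

section \<open>Stability and global coefficients\<close>

lemma weight_pos: "1 + lam k > 0" using lam_nonneg[of k] by linarith

text \<open>Write the difference as the sum of \<open>lam^2 (x - y) (x + y)\<close> and use the
  Cauchy-Schwarz inequality with factors \<open>1 / sqrt (1 + lam)\<close> and
  \<open>sqrt (1 + lam)\<close>. The factor 4 comes from
  \<open>(x + y)^2 \<le> 2 x^2 + 2 y^2\<close>.\<close>

lemma sigma_diff_bound:
  assumes Z: "\<And>n. (\<Sum>k<n. (lam k)\<^sup>2 * (x k - y k)\<^sup>2 / (1 + lam k)) \<le> Z"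
    and Bx: "\<And>n. (\<Sum>k<n. (1 + lam k) * ((lam k)\<^sup>2 * (x k)\<^sup>2)) \<le> B"
    and By: "\<And>n. (\<Sum>k<n. (1 + lam k) * ((lam k)\<^sup>2 * (y k)\<^sup>2)) \<le> B"
  shows "((\<Sum>k. (lam k)\<^sup>2 * (x k)\<^sup>2) - (\<Sum>k. (lam k)\<^sup>2 * (y k)\<^sup>2))\<^sup>2 \<le> 4 * B * Z"
proof -
  have B0: "B \<ge> 0" and Z0: "Z \<ge> 0" using Bx[of 0] Z[of 0] by auto
  have sm: "summable (\<lambda>k. (lam k)\<^sup>2 * (x k)\<^sup>2)"
    if B: "\<And>n. (\<Sum>k<n. (1 + lam k) * ((lam k)\<^sup>2 * (x k)\<^sup>2)) \<le> B" for x :: "nat \<Rightarrow> real"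
  proof (rule summableI_nonneg_bounded)
    fix n
    have "(\<Sum>k<n. (lam k)\<^sup>2 * (x k)\<^sup>2) \<le> (\<Sum>k<n. (1 + lam k) * ((lam k)\<^sup>2 * (x k)\<^sup>2))"
    proof (rule sum_mono)
      fix k show "(lam k)\<^sup>2 * (x k)\<^sup>2 \<le> (1 + lam k) * ((lam k)\<^sup>2 * (x k)\<^sup>2)"
        using mult_right_mono[of 1 "1 + lam k" "(lam k)\<^sup>2 * (x k)\<^sup>2"] lam_nonneg[of k] by simp
    qed
    then show "(\<Sum>k<n. (lam k)\<^sup>2 * (x k)\<^sup>2) \<le> B" using B[of n] by linarith
  qed simp
  have fin: "((\<Sum>k<n. (lam k)\<^sup>2 * (x k)\<^sup>2) - (\<Sum>k<n. (lam k)\<^sup>2 * (y k)\<^sup>2))\<^sup>2 \<le> 4 * B * Z" for n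
  proof -
    let ?r = "\<lambda>k. sqrt (1 + lam k)"
    have r: "?r k > 0" "(?r k)\<^sup>2 = 1 + lam k" for k using weight_pos[of k] by auto
    have "(\<Sum>k<n. (lam k)\<^sup>2 * (x k)\<^sup>2) - (\<Sum>k<n. (lam k)\<^sup>2 * (y k)\<^sup>2) =
      (\<Sum>k<n. (lam k * (x k - y k) / ?r k) * (?r k * (lam k * (x k + y k))))"
      unfolding sum_subtractf[symmetric]
    proof (rule sum.cong[OF refl])
      fix k
      have "?r k \<noteq> 0" using r(1)[of k] by linarith
      then have "(lam k * (x k - y k) / ?r k) * (?r k * (lam k * (x k + y k))) =
        (lam k * (x k - y k)) * (lam k * (x k + y k))" by simp
      then show "(lam k)\<^sup>2 * (x k)\<^sup>2 - (lam k)\<^sup>2 * (y k)\<^sup>2 =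
        (lam k * (x k - y k) / ?r k) * (?r k * (lam k * (x k + y k)))"
        by (simp add: power2_eq_square algebra_simps)
    qed
    then have "((\<Sum>k<n. (lam k)\<^sup>2 * (x k)\<^sup>2) - (\<Sum>k<n. (lam k)\<^sup>2 * (y k)\<^sup>2))\<^sup>2 \<le>
      (\<Sum>k<n. (lam k * (x k - y k) / ?r k)\<^sup>2) * (\<Sum>k<n. (?r k * (lam k * (x k + y k)))\<^sup>2)"
      by (simp only: Cauchy_Schwarz_ineq_sum)
    also have "\<dots> \<le> Z * (4 * B)"
    proof (rule mult_mono)
      show "(\<Sum>k<n. (lam k * (x k - y k) / ?r k)\<^sup>2) \<le> Z"
        using Z[of n] by (simp only: power_divide power_mult_distrib r)
      have "(\<Sum>k<n. (?r k * (lam k * (x k + y k)))\<^sup>2) \<le>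
        (\<Sum>k<n. 2 * ((1 + lam k) * ((lam k)\<^sup>2 * (x k)\<^sup>2)) + 2 * ((1 + lam k) * ((lam k)\<^sup>2 * (y k)\<^sup>2)))"
      proof (rule sum_mono)
        fix k
        have "(x k + y k)\<^sup>2 \<le> 2 * (x k)\<^sup>2 + 2 * (y k)\<^sup>2"
          using zero_le_power2[of "x k - y k"] by (simp add: power2_sum power2_diff)
        then have "((1 + lam k) * (lam k)\<^sup>2) * (x k + y k)\<^sup>2 \<le> ((1 + lam k) * (lam k)\<^sup>2) * (2 * (x k)\<^sup>2 + 2 * (y k)\<^sup>2)"
          using lam_nonneg[of k] by (intro mult_left_mono) auto
        then show "(?r k * (lam k * (x k + y k)))\<^sup>2 \<le>
          2 * ((1 + lam k) * ((lam k)\<^sup>2 * (x k)\<^sup>2)) + 2 * ((1 + lam k) * ((lam k)\<^sup>2 * (y k)\<^sup>2))"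
          unfolding power_mult_distrib r(2) by (simp add: distrib_left mult_ac)
      qed
      also have "\<dots> \<le> 4 * B" using Bx[of n] By[of n] by (simp add: sum.distrib sum_distrib_left[symmetric])
      finally show "(\<Sum>k<n. (?r k * (lam k * (x k + y k)))\<^sup>2) \<le> 4 * B" .
    qed (use Z0 in \<open>auto intro: sum_nonneg\<close>)
    finally show ?thesis by (simp add: mult_ac)
  qed
  have "(\<lambda>n. ((\<Sum>k<n. (lam k)\<^sup>2 * (x k)\<^sup>2) - (\<Sum>k<n. (lam k)\<^sup>2 * (y k)\<^sup>2))\<^sup>2) \<longlonglongrightarrow>
    ((\<Sum>k. (lam k)\<^sup>2 * (x k)\<^sup>2) - (\<Sum>k. (lam k)\<^sup>2 * (y k)\<^sup>2))\<^sup>2"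
    by (intro tendsto_intros summable_LIMSEQ sm[OF Bx] sm[OF By])
  then show ?thesis by (rule LIMSEQ_le_const2) (use fin in blast)
qed

text \<open>Stability in the energy at level \<open>- 1/2\<close>: there the difference of the coefficients is controlled
  by the energy of the difference. Bounding \<open>exp (- 4 C t)\<close> times the energy by its supremum \<open>Y\<close>, the
  differential inequality \<open>Q' \<le> C (Q + Y exp (4 C t))\<close> improves \<open>Y\<close> to \<open>Q 0 + Y / 3\<close>.\<close>

lemma stability:
  fixes u1 v1 u2 v2 :: "nat \<Rightarrow> real \<Rightarrow> real" and c1 c2 :: "real \<Rightarrow> real"
  assumes u1: "\<And>k t. t \<ge> 0 \<Longrightarrow> (u1 k has_real_derivative v1 k t) (at t within {0..})"
    and v1: "\<And>k t. t \<ge> 0 \<Longrightarrow> (v1 k has_real_derivative - ((lam k)\<^sup>2 * c1 t * u1 k t)) (at t within {0..})"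
    and u2: "\<And>k t. t \<ge> 0 \<Longrightarrow> (u2 k has_real_derivative v2 k t) (at t within {0..})"
    and v2: "\<And>k t. t \<ge> 0 \<Longrightarrow> (v2 k has_real_derivative - ((lam k)\<^sup>2 * c2 t * u2 k t)) (at t within {0..})"
    and K: "K \<ge> 0" "\<And>s t. s \<in> {0..T} \<Longrightarrow> t \<in> {0..T} \<Longrightarrow> \<bar>c1 s - c1 t\<bar> \<le> K * \<bar>s - t\<bar>"
    and c1: "\<mu> \<ge> 1" "\<And>t. t \<in> {0..T} \<Longrightarrow> \<nu> \<le> c1 t" "\<And>t. t \<in> {0..T} \<Longrightarrow> c1 t \<le> \<mu>"
    and L: "\<And>t. t \<in> {0..T} \<Longrightarrow>
      \<bar>c1 t - c2 t\<bar> \<le> L * \<bar>(\<Sum>k. (lam k)\<^sup>2 * (u1 k t)\<^sup>2) - (\<Sum>k. (lam k)\<^sup>2 * (u2 k t)\<^sup>2)\<bar>"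
    and B1: "\<And>n t. t \<in> {0..T} \<Longrightarrow> (\<Sum>k<n. (1 + lam k) * en k (u1 k t) (v1 k t)) \<le> B"
    and B2: "\<And>n t. t \<in> {0..T} \<Longrightarrow> (\<Sum>k<n. (1 + lam k) * en k (u2 k t) (v2 k t)) \<le> B"
    and D: "\<And>n. (\<Sum>k<n. en k (u1 k 0 - u2 k 0) (v1 k 0 - v2 k 0) / (1 + lam k)) \<le> D"
    and t: "t \<in> {0..T}"
  shows "(\<Sum>k<n. en k (u1 k t - u2 k t) (v1 k t - v2 k t) / (1 + lam k)) \<le>
    3 / 2 * \<mu> / \<nu> * exp (4 * (K / \<nu> + 1 + 4 * L\<^sup>2 * B\<^sup>2 / \<nu>) * T) * D"
proof -
  define w where "w k t = u1 k t - u2 k t" for k t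
  define z where "z k t = v1 k t - v2 k t" for k t
  define Q where "Q n t = (\<Sum>k<n. 1 / (1 + lam k) * ((z k t)\<^sup>2 + c1 t * (lam k)\<^sup>2 * (w k t)\<^sup>2))" for n t
  define C where "C = K / \<nu> + 1 + 4 * L\<^sup>2 * B\<^sup>2 / \<nu>"
  have "0 \<le> K / \<nu>" "0 \<le> 4 * L\<^sup>2 * B\<^sup>2 / \<nu>" using K(1) nu by simp_all
  then have C: "C > 0" unfolding C_def by linarith
  have T: "T \<ge> 0" using t by simp
  have D0: "D \<ge> 0" using D[of 0] by simp
  have B0: "B \<ge> 0" using B1[OF t, of 0] by simp
  have wp: "1 / (1 + lam k) \<ge> 0" for k using weight_pos[of k] by simp
  have w1: "1 / (1 + lam k) \<le> 1 + lam k" for k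
  proof -
    have "1 / (1 + lam k) \<le> 1" using lam_nonneg[of k] by simp
    then show ?thesis using lam_nonneg[of k] by linarith
  qed
  have en_diff: "en k (x - x') (y - y') \<le> 2 * en k x y + 2 * en k x' y'" for k x x' y y'
  proof -
    have sq: "(r - s)\<^sup>2 \<le> 2 * r\<^sup>2 + 2 * s\<^sup>2" for r s :: real
      using zero_le_power2[of "r + s"] by (simp add: power2_sum power2_diff)
    have "(lam k)\<^sup>2 * (x - x')\<^sup>2 \<le> (lam k)\<^sup>2 * (2 * x\<^sup>2 + 2 * x'\<^sup>2)"
      by (intro mult_left_mono sq) simp
    then show ?thesis using sq[of y y'] by (simp add: en_def algebra_simps)
  qed
  have Q_le: "Q n t \<le> \<mu> * (\<Sum>k<n. en k (w k t) (z k t) / (1 + lam k))" if t: "t \<in> {0..T}" for n t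
    unfolding Q_def sum_distrib_left
  proof (rule sum_mono)
    fix k
    show "1 / (1 + lam k) * ((z k t)\<^sup>2 + c1 t * (lam k)\<^sup>2 * (w k t)\<^sup>2) \<le> \<mu> * (en k (w k t) (z k t) / (1 + lam k))"
      using mult_left_mono[OF energy_le_en[OF c1(3)[OF t] c1(1), of "z k t" k "w k t"] wp[of k]] by simp
  qed
  have Q_ge: "\<nu> * (\<Sum>k<n. en k (w k t) (z k t) / (1 + lam k)) \<le> Q n t" if t: "t \<in> {0..T}" for n t
    unfolding Q_def sum_distrib_left
  proof (rule sum_mono)
    fix k
    show "\<nu> * (en k (w k t) (z k t) / (1 + lam k)) \<le> 1 / (1 + lam k) * ((z k t)\<^sup>2 + c1 t * (lam k)\<^sup>2 * (w k t)\<^sup>2)"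
      using mult_left_mono[OF en_le_energy[OF c1(2)[OF t], of k "w k t" "z k t"] wp[of k]] by simp
  qed
  \<comment> \<open>A crude bound whose sole purpose is the finiteness of the supremum
    \<open>Y\<close>.\<close>
  have Q_bd: "Q n t \<le> \<mu> * (4 * B)" if t: "t \<in> {0..T}" for n t
  proof -
    have "(\<Sum>k<n. en k (w k t) (z k t) / (1 + lam k)) \<le>
      (\<Sum>k<n. 2 * ((1 + lam k) * en k (u1 k t) (v1 k t)) + 2 * ((1 + lam k) * en k (u2 k t) (v2 k t)))"
    proof (rule sum_mono)
      fix k
      have "en k (w k t) (z k t) / (1 + lam k) \<le> (1 + lam k) * en k (w k t) (z k t)"
        using mult_right_mono[OF w1[of k] en_nonneg, of k "w k t" "z k t"] by simp
      also have "\<dots> \<le> (1 + lam k) * (2 * en k (u1 k t) (v1 k t) + 2 * en k (u2 k t) (v2 k t))"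
        unfolding w_def z_def using weight_pos[of k] by (intro mult_left_mono en_diff) auto
      finally show "en k (w k t) (z k t) / (1 + lam k) \<le>
        2 * ((1 + lam k) * en k (u1 k t) (v1 k t)) + 2 * ((1 + lam k) * en k (u2 k t) (v2 k t))"
        by (simp add: algebra_simps)
    qed
    also have "\<dots> \<le> 4 * B" using B1[OF t, of n] B2[OF t, of n] by (simp add: sum.distrib sum_distrib_left[symmetric])
    finally have "\<mu> * (\<Sum>k<n. en k (w k t) (z k t) / (1 + lam k)) \<le> \<mu> * (4 * B)"
      using c1(1) by (intro mult_left_mono) auto
    then show ?thesis using Q_le[OF t, of n] by linarith
  qed
  \<comment> \<open>The supremum is over all partial sums as well as over time: the difference of
    the coefficients depends on all modes at once, whereas each \<open>Q n\<close> contains only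
    finitely many.\<close>
  define YS where "YS = {exp (- (4 * C * t)) * Q n t | n t. t \<in> {0..T}}"
  define Y where "Y = Sup YS"
  have bdd: "bdd_above YS"
  proof (rule bdd_aboveI)
    fix y assume "y \<in> YS"
    then obtain n t where y: "y = exp (- (4 * C * t)) * Q n t" and t: "t \<in> {0..T}" by (auto simp: YS_def)
    have "exp (- (4 * C * t)) * Q n t \<le> 1 * (\<mu> * (4 * B))"
    proof -
      have e1: "exp (- (4 * C * t)) \<le> 1" using C t by simp
      have "exp (- (4 * C * t)) * Q n t \<le> exp (- (4 * C * t)) * (\<mu> * (4 * B))"
        by (intro mult_left_mono Q_bd t) simp
      also have "\<dots> \<le> 1 * (\<mu> * (4 * B))" using c1(1) B0 by (intro mult_right_mono e1) simp
      finally show ?thesis .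
    qed
    then show "y \<le> \<mu> * (4 * B)" by (simp add: y)
  qed
  have Q_Y: "Q n t \<le> Y * exp (4 * C * t)" if t: "t \<in> {0..T}" for n t
  proof -
    have "exp (- (4 * C * t)) * Q n t \<le> Y"
      unfolding Y_def by (rule cSup_upper[OF _ bdd]) (use t in \<open>auto simp: YS_def\<close>)
    then have "exp (4 * C * t) * (exp (- (4 * C * t)) * Q n t) \<le> exp (4 * C * t) * Y"
      by (intro mult_left_mono) auto
    moreover have "exp (4 * C * t) * (exp (- (4 * C * t)) * Q n t) = Q n t" by (simp add: exp_minus)
    ultimately show ?thesis by (simp only: mult.commute[of Y])
  qed
  have YS0: "0 \<in> YS"
    unfolding YS_def by (rule CollectI, rule exI[of _ 0], rule exI[of _ 0]) (use T in \<open>simp add: Q_def\<close>)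
  then have Y0: "Y \<ge> 0" unfolding Y_def by (rule cSup_upper[OF _ bdd])
  have q: "(c2 t - c1 t)\<^sup>2 \<le> 4 * L\<^sup>2 * B / \<nu> * (Y * exp (4 * C * t))" if t: "t \<in> {0..T}" for t
  proof -
    have "(\<Sum>k<n. (lam k)\<^sup>2 * (u1 k t - u2 k t)\<^sup>2 / (1 + lam k)) \<le> Y * exp (4 * C * t) / \<nu>" for n
    proof -
      have "(\<Sum>k<n. (lam k)\<^sup>2 * (u1 k t - u2 k t)\<^sup>2 / (1 + lam k)) \<le> (\<Sum>k<n. en k (w k t) (z k t) / (1 + lam k))"
        using weight_pos by (intro sum_mono divide_right_mono) (auto simp: en_def w_def less_imp_le)
      also have "\<dots> \<le> Q n t / \<nu>" using Q_ge[OF t, of n] nu by (simp add: field_simps)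
      also have "\<dots> \<le> Y * exp (4 * C * t) / \<nu>" using Q_Y[OF t, of n] nu by (intro divide_right_mono) auto
      finally show ?thesis .
    qed
    moreover have "(\<Sum>k<n. (1 + lam k) * ((lam k)\<^sup>2 * (u k t)\<^sup>2)) \<le> B"
      if B: "(\<Sum>k<n. (1 + lam k) * en k (u k t) (v k t)) \<le> B" for n and u v :: "nat \<Rightarrow> real \<Rightarrow> real"
    proof -
      have "(\<Sum>k<n. (1 + lam k) * ((lam k)\<^sup>2 * (u k t)\<^sup>2)) \<le> (\<Sum>k<n. (1 + lam k) * en k (u k t) (v k t))"
        using weight_pos by (intro sum_mono mult_left_mono) (auto simp: en_def less_imp_le)
      then show ?thesis using B by linarith
    qed
    ultimately have s: "((\<Sum>k. (lam k)\<^sup>2 * (u1 k t)\<^sup>2) - (\<Sum>k. (lam k)\<^sup>2 * (u2 k t)\<^sup>2))\<^sup>2 \<le> 4 * B * (Y * exp (4 * C * t) / \<nu>)"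
      using B1[OF t] B2[OF t] by (intro sigma_diff_bound) blast+
    have "(c2 t - c1 t)\<^sup>2 = \<bar>c1 t - c2 t\<bar>\<^sup>2" by (simp add: power2_commute)
    also have "\<dots> \<le> (L * \<bar>(\<Sum>k. (lam k)\<^sup>2 * (u1 k t)\<^sup>2) - (\<Sum>k. (lam k)\<^sup>2 * (u2 k t)\<^sup>2)\<bar>)\<^sup>2"
      by (intro power_mono L t) simp
    also have "\<dots> \<le> L\<^sup>2 * (4 * B * (Y * exp (4 * C * t) / \<nu>))"
      unfolding power_mult_distrib power2_abs by (intro mult_left_mono s) simp
    finally show ?thesis by (simp add: mult_ac)
  qed
  have wz: "(w k has_real_derivative z k t) (at t within {0..})"
    "(z k has_real_derivative (lam k)\<^sup>2 * (c2 t - c1 t) * u2 k t - (lam k)\<^sup>2 * c1 t * w k t) (at t within {0..})"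
    if "t \<ge> 0" for k t
  proof -
    show "(w k has_real_derivative z k t) (at t within {0..})"
      unfolding w_def[abs_def] z_def by (intro DERIV_diff u1 u2 that)
    have "(z k has_real_derivative - ((lam k)\<^sup>2 * c1 t * u1 k t) - - ((lam k)\<^sup>2 * c2 t * u2 k t)) (at t within {0..})"
      unfolding z_def[abs_def] by (intro DERIV_diff v1 v2 that)
    then show "(z k has_real_derivative (lam k)\<^sup>2 * (c2 t - c1 t) * u2 k t - (lam k)\<^sup>2 * c1 t * w k t) (at t within {0..})"
      by (simp add: w_def algebra_simps)
  qed
  have cont: "continuous_on {0..} (w k)" "continuous_on {0..} (z k)" for k
    by (rule DERIV_continuous_on[OF wz(1)] DERIV_continuous_on[OF wz(2)]; simp)+
  have c1cont: "continuous_on {0..T} c1"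
  proof -
    have "K-lipschitz_on {0..T} c1" by (rule lipschitz_onI) (use K in \<open>auto simp: dist_real_def\<close>)
    then show ?thesis by (rule lipschitz_on_continuous_on)
  qed
  have Qcont: "continuous_on {0..T} (Q n)" for n
    unfolding Q_def[abs_def]
    by (intro continuous_intros c1cont continuous_on_subset[OF cont(1)] continuous_on_subset[OF cont(2)]) auto
  have dc1: "dini_le c1 K t" if t: "0 \<le> t" "t < T" for t
    unfolding dini_le_def
  proof (intro allI impI)
    fix \<epsilon> :: real assume \<epsilon>: "\<epsilon> > 0"
    have "\<forall>\<^sub>F s in at_right t. s < T" using t(2) by (rule eventually_at_rightI[rotated]) auto
    with eventually_at_right_less[of t] show "\<forall>\<^sub>F s in at_right t. c1 s \<le> c1 t + (K + \<epsilon>) * (s - t)"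
    proof eventually_elim
      case (elim s)
      have "\<bar>c1 s - c1 t\<bar> \<le> K * \<bar>s - t\<bar>" using elim t by (intro K) auto
      also have "\<dots> \<le> (K + \<epsilon>) * (s - t)" using elim \<epsilon> by simp
      finally show ?case by linarith
    qed
  qed
  have dQ: "dini_le (Q n) (C * (Q n t + Y * exp (4 * C * t))) t" if t: "0 \<le> t" "t < T" for n t
  proof -
    have tT: "t \<in> {0..T}" using t by simp
    define r where "r k = (lam k)\<^sup>2 * (c2 t - c1 t) * u2 k t" for k
    have "dini_le (Q n) (\<Sum>k<n. 1 / (1 + lam k) * (2 * z k t * r k + K * ((lam k)\<^sup>2 * (w k t)\<^sup>2))) t"
      unfolding Q_def[abs_def]
    proof (intro dini_le_sum dini_le_cmult wp)
      fix k
      show "dini_le (\<lambda>s. (z k s)\<^sup>2 + c1 s * (lam k)\<^sup>2 * (w k s)\<^sup>2) (2 * z k t * r k + K * ((lam k)\<^sup>2 * (w k t)\<^sup>2)) t"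
        using at_within_atLeast_mono[OF wz(1) t(1), of k] at_within_atLeast_mono[OF wz(2) t(1), of k] t
        by (intro energy_dini dc1 K(1)) (auto simp: r_def)
    qed simp
    moreover have "(\<Sum>k<n. 1 / (1 + lam k) * (2 * z k t * r k + K * ((lam k)\<^sup>2 * (w k t)\<^sup>2))) \<le>
      C * (Q n t + Y * exp (4 * C * t))"
    proof -
      have "(\<Sum>k<n. 1 / (1 + lam k) * (2 * z k t * r k + K * ((lam k)\<^sup>2 * (w k t)\<^sup>2))) \<le>
        (\<Sum>k<n. (K / \<nu> + 1) * (1 / (1 + lam k) * ((z k t)\<^sup>2 + c1 t * (lam k)\<^sup>2 * (w k t)\<^sup>2)) +
          (c2 t - c1 t)\<^sup>2 * ((1 + lam k) * en k (u2 k t) (v2 k t)))"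
      proof (rule sum_mono)
        fix k
        let ?E = "(z k t)\<^sup>2 + c1 t * (lam k)\<^sup>2 * (w k t)\<^sup>2"
        have c1t: "\<nu> \<le> c1 t" by (rule c1(2)[OF tT])
        have zE: "(z k t)\<^sup>2 \<le> ?E" using c1t nu by simp
        have "\<nu> * ((lam k)\<^sup>2 * (w k t)\<^sup>2) \<le> c1 t * ((lam k)\<^sup>2 * (w k t)\<^sup>2)" using c1t by (intro mult_right_mono) auto
        also have "\<dots> \<le> ?E" by simp
        finally have "(lam k)\<^sup>2 * (w k t)\<^sup>2 \<le> ?E / \<nu>" using nu by (simp add: field_simps)
        from mult_left_mono[OF this K(1)] have kE: "K * ((lam k)\<^sup>2 * (w k t)\<^sup>2) \<le> K / \<nu> * ?E" by simp
        have zr: "2 * z k t * r k \<le> (z k t)\<^sup>2 + (r k)\<^sup>2"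
          using zero_le_power2[of "z k t - r k"] by (simp add: power2_diff)
        have "2 * z k t * r k + K * ((lam k)\<^sup>2 * (w k t)\<^sup>2) \<le> (K / \<nu> + 1) * ?E + (r k)\<^sup>2"
        proof -
          have "(K / \<nu> + 1) * ?E = K / \<nu> * ?E + ?E" by (simp only: distrib_right mult_1_left)
          then show ?thesis using zE kE zr by linarith
        qed
        then have "1 / (1 + lam k) * (2 * z k t * r k + K * ((lam k)\<^sup>2 * (w k t)\<^sup>2)) \<le>
          1 / (1 + lam k) * ((K / \<nu> + 1) * ?E + (r k)\<^sup>2)"
          using wp[of k] by (rule mult_left_mono)
        also have "\<dots> = (K / \<nu> + 1) * (1 / (1 + lam k) * ?E) + (r k)\<^sup>2 / (1 + lam k)"
          by (simp add: distrib_left mult.left_commute[of "1 / (1 + lam k)"])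
        \<comment> \<open>Two factors \<open>lam\<close> in the squared forcing are bounded by
          \<open>(1 + lam)^2\<close>, of which the weight cancels one. What remains is the energy of
          \<open>u2\<close> with weight \<open>1 + lam\<close>, whose sum is at most
          \<open>B\<close>.\<close>
        also have "(r k)\<^sup>2 / (1 + lam k) \<le> (c2 t - c1 t)\<^sup>2 * ((1 + lam k) * en k (u2 k t) (v2 k t))"
        proof -
          have "(lam k)\<^sup>2 \<le> (1 + lam k)\<^sup>2" using lam_nonneg[of k] by (intro power_mono) auto
          then have "(lam k)\<^sup>2 * ((c2 t - c1 t)\<^sup>2 * ((lam k)\<^sup>2 * (u2 k t)\<^sup>2)) \<le>
             (1 + lam k)\<^sup>2 * ((c2 t - c1 t)\<^sup>2 * ((lam k)\<^sup>2 * (u2 k t)\<^sup>2))" by (intro mult_right_mono) auto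
          also have "\<dots> \<le> (1 + lam k)\<^sup>2 * ((c2 t - c1 t)\<^sup>2 * en k (u2 k t) (v2 k t))"
            by (intro mult_left_mono) (auto simp: en_def)
          finally have "(r k)\<^sup>2 \<le> (1 + lam k)\<^sup>2 * ((c2 t - c1 t)\<^sup>2 * en k (u2 k t) (v2 k t))"
            by (simp add: r_def power_mult_distrib mult_ac)
          then have "(r k)\<^sup>2 / (1 + lam k) \<le> (1 + lam k)\<^sup>2 * ((c2 t - c1 t)\<^sup>2 * en k (u2 k t) (v2 k t)) / (1 + lam k)"
            using weight_pos[of k] by (intro divide_right_mono) auto
          also have "\<dots> = (c2 t - c1 t)\<^sup>2 * ((1 + lam k) * en k (u2 k t) (v2 k t))"
            using weight_pos[of k] by (simp add: power2_eq_square[of "1 + lam k"])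
          finally show ?thesis .
        qed
        finally show "1 / (1 + lam k) * (2 * z k t * r k + K * ((lam k)\<^sup>2 * (w k t)\<^sup>2)) \<le>
          (K / \<nu> + 1) * (1 / (1 + lam k) * ?E) + (c2 t - c1 t)\<^sup>2 * ((1 + lam k) * en k (u2 k t) (v2 k t))" by simp
      qed
      also have "\<dots> = (K / \<nu> + 1) * Q n t + (c2 t - c1 t)\<^sup>2 * (\<Sum>k<n. (1 + lam k) * en k (u2 k t) (v2 k t))"
        by (simp only: sum.distrib sum_distrib_left Q_def)
      also have "\<dots> \<le> (K / \<nu> + 1) * Q n t + (4 * L\<^sup>2 * B / \<nu> * (Y * exp (4 * C * t))) * B"
        using Y0 B0 nu weight_pos
        by (intro add_left_mono mult_mono q tT B2 sum_nonneg mult_nonneg_nonneg en_nonneg) (auto simp: less_imp_le)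
      also have "\<dots> = (K / \<nu> + 1) * Q n t + (4 * L\<^sup>2 * B\<^sup>2 / \<nu>) * (Y * exp (4 * C * t))"
        by (simp add: power2_eq_square)
      also have "\<dots> \<le> C * Q n t + C * (Y * exp (4 * C * t))"
      proof (intro add_mono mult_right_mono)
        show "K / \<nu> + 1 \<le> C" using nu by (simp add: C_def)
        show "4 * L\<^sup>2 * B\<^sup>2 / \<nu> \<le> C" using K(1) nu by (simp add: C_def)
        show "0 \<le> Y * exp (4 * C * t)" using Y0 by simp
        have "0 \<le> \<nu> * (\<Sum>k<n. en k (w k t) (z k t) / (1 + lam k))"
          using nu weight_pos by (intro mult_nonneg_nonneg sum_nonneg divide_nonneg_nonneg en_nonneg) (auto simp: less_imp_le)
        then show "0 \<le> Q n t" using Q_ge[OF tT, of n] by linarith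
      qed
      finally show ?thesis by (simp only: distrib_left)
    qed
    ultimately show ?thesis by (rule dini_le_mono)
  qed
  have Y_le: "Y \<le> 3 / 2 * (\<mu> * D)"
  proof -
    have "Y \<le> \<mu> * D + Y / 3 + \<epsilon>" if \<epsilon>: "\<epsilon> > 0" for \<epsilon>
    proof -
      \<comment> \<open>This makes \<open>Y < 3 G\<close>. At a contact point
        \<open>Q = G exp (4 C t)\<close>, so the forcing \<open>Y exp (4 C t)\<close> is below
        \<open>3 Q\<close> and the derivative below \<open>4 C Q\<close>: the rate
        \<open>4 C\<close> reproduces itself.\<close>
      define G where "G = \<mu> * D + Y / 3 + \<epsilon>"
      have "\<mu> * D \<ge> 0" using D0 c1(1) by simp
      then have "3 * (\<mu> * D) + 3 * \<epsilon> > 0" "\<mu> * D + Y / 3 + \<epsilon> > 0" using Y0 \<epsilon> by linarith+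
      then have G: "Y < 3 * G" "G > 0" by (simp_all add: G_def)
      have "y \<le> G" if yYS: "y \<in> YS" for y
      proof -
        obtain n t where y: "y = exp (- (4 * C * t)) * Q n t" and t: "t \<in> {0..T}"
          using yYS by (auto simp: YS_def)
        have Q0: "Q n 0 \<le> G"
        proof -
          have "Q n 0 \<le> \<mu> * (\<Sum>k<n. en k (w k 0) (z k 0) / (1 + lam k))" by (rule Q_le) (use T in simp)
          also have "\<dots> \<le> \<mu> * D" using D[of n] c1(1) by (intro mult_left_mono) (auto simp: w_def z_def)
          finally show ?thesis using Y0 \<epsilon> by (simp add: G_def)
        qed
        have "Q n t \<le> G * exp (4 * C * (t - 0))"
        proof (rule dini_barrier[where f="Q n" and a=0 and G=G, OF Qcont Q0 _ t])
          fix t assume t: "0 \<le> t" "t < T" "Q n t = G * exp (4 * C * (t - 0))"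
          have "Y * exp (4 * C * t) < 3 * G * exp (4 * C * t)" using G(1) by (intro mult_strict_right_mono) auto
          then have "Q n t + Y * exp (4 * C * t) < 4 * Q n t" using t(3) by simp
          then have "C * (Q n t + Y * exp (4 * C * t)) < C * (4 * Q n t)" using C by (rule mult_strict_left_mono)
          then show "\<exists>d<4 * C * Q n t. dini_le (Q n) d t" using dQ[OF t(1,2), of n] by (auto simp: mult_ac)
        qed
        then have "exp (- (4 * C * t)) * Q n t \<le> exp (- (4 * C * t)) * (G * exp (4 * C * t))"
          by (intro mult_left_mono) auto
        also have "exp (- (4 * C * t)) * (G * exp (4 * C * t)) = G" by (simp add: exp_minus)
        finally show ?thesis by (simp add: y)
      qed
      then show ?thesis unfolding Y_def[symmetric] G_def[symmetric]
        using YS0 unfolding Y_def by (intro cSup_least) auto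
    qed
    then have "Y \<le> \<mu> * D + Y / 3" by (rule field_le_epsilon)
    then show ?thesis by linarith
  qed
  have "\<nu> * (\<Sum>k<n. en k (w k t) (z k t) / (1 + lam k)) \<le> Y * exp (4 * C * t)"
    using Q_ge[OF t, of n] Q_Y[OF t, of n] by linarith
  also have "\<dots> \<le> (3 / 2 * (\<mu> * D)) * exp (4 * C * T)"
    using Y_le t C D0 c1(1) by (intro mult_mono) auto
  finally have "(\<Sum>k<n. en k (w k t) (z k t) / (1 + lam k)) \<le> (3 / 2 * (\<mu> * D)) * exp (4 * C * T) / \<nu>"
    using nu by (simp add: field_simps)
  then show ?thesis by (simp add: w_def z_def C_def mult_ac)
qed

lemma weighted_en_sum_le:
  assumes "C \<ge> 0" "\<And>k. en k (x k) (y k) \<le> C * en k (a k) (b k)"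
  shows "(\<Sum>k<n. (1 + lam k) * en k (x k) (y k)) \<le> C * (\<Sum>k. (1 + lam k) * en k (a k) (b k))"
proof -
  have "(\<Sum>k<n. (1 + lam k) * en k (x k) (y k)) \<le> (\<Sum>k<n. C * ((1 + lam k) * en k (a k) (b k)))"
  proof (rule sum_mono)
    fix k
    have "(1 + lam k) * en k (x k) (y k) \<le> (1 + lam k) * (C * en k (a k) (b k))"
      using weight_pos[of k] by (intro mult_left_mono assms(2)) auto
    then show "(1 + lam k) * en k (x k) (y k) \<le> C * ((1 + lam k) * en k (a k) (b k))"
      by (simp only: mult.left_commute)
  qed
  also have "\<dots> = C * (\<Sum>k<n. (1 + lam k) * en k (a k) (b k))" by (simp only: sum_distrib_left)
  also have "\<dots> \<le> C * (\<Sum>k. (1 + lam k) * en k (a k) (b k))"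
    using assms(1) summable_en(1) weight_pos
    by (intro mult_left_mono sum_le_suminf) (auto simp: en_nonneg less_imp_le)
  finally show ?thesis .
qed

text \<open>Two Galerkin solutions differ initially by a tail of the data, so by
  \<open>stability\<close> they form a Cauchy sequence, uniformly on bounded time intervals, mode by
  mode and for the coefficient. Sums over the modes pass to the limit by domination.\<close>

lemma global_solution:
  "\<exists>U V c.
    (\<forall>k. \<forall>t\<ge>0. (U k has_real_derivative V k t) (at t within {0..})) \<and>
    (\<forall>k. \<forall>t\<ge>0. (V k has_real_derivative - ((lam k)\<^sup>2 * c t * U k t)) (at t within {0..})) \<and>
    (\<forall>k. U k 0 = a k \<and> V k 0 = b k) \<and>
    (\<forall>t\<ge>0. c t = m (\<Sum>k. (lam k)\<^sup>2 * (U k t)\<^sup>2)) \<and>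
    (\<forall>T. \<exists>C\<ge>0. \<forall>t\<in>{0..T}. \<forall>k. en k (U k t) (V k t) \<le> C * en k (a k) (b k)) \<and>
    (\<forall>T. \<exists>K\<ge>0. \<forall>s\<in>{0..T}. \<forall>t\<in>{0..T}. \<bar>c s - c t\<bar> \<le> K * \<bar>s - t\<bar>) \<and>
    (\<exists>\<mu>\<ge>1. \<forall>t\<ge>0. \<nu> \<le> c t \<and> c t \<le> \<mu>)"
proof -
  obtain R where R: "R \<ge> 0" "\<And>N. \<exists>u v. galerkin R N u v" using galerkin_exists by blast
  obtain us vs where g: "\<And>N. galerkin R N (us N) (vs N)" using R(2) by metis
  define cc where "cc N t = m (sg N (us N) t)" for N t
  note us' = galerkinD(1)[OF g] and vs' = galerkinD(2)[OF g, folded cc_def]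
  have init: "us N k 0 = (if k < N then a k else 0)" "vs N k 0 = (if k < N then b k else 0)" for N k
    using galerkinD(3-6)[OF g] by auto
  have sg_suminf: "(\<Sum>k. (lam k)\<^sup>2 * (us N k t)\<^sup>2) = sg N (us N) t" for N t
    unfolding sg_def by (rule suminf_finite) (auto simp: galerkinD(3)[OF g])
  obtain L where L: "L \<ge> 0" "\<And>x y. x \<in> {0..R} \<Longrightarrow> y \<in> {0..R} \<Longrightarrow> \<bar>m x - m y\<bar> \<le> L * \<bar>x - y\<bar>"
    using m_lip[OF R(1)] by blast
  obtain \<mu> where \<mu>: "\<mu> \<ge> 1" "\<And>s. 0 \<le> s \<Longrightarrow> s \<le> R \<Longrightarrow> m s \<le> \<mu>" using m_upper[OF R(1)] by blast
  have sgR: "sg N (us N) t \<in> {0..R}" if "t \<ge> 0" for N t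
    using galerkinD(7)[OF g that] by (simp add: sg_nonneg)
  have cc_b: "\<nu> \<le> cc N t" "cc N t \<le> \<mu>" if "t \<ge> 0" for N t
    using sgR[OF that, of N] m_ge \<mu>(2) by (auto simp: cc_def)
  have cdiff: "\<bar>cc i t - cc j t\<bar> \<le> L * \<bar>(\<Sum>k. (lam k)\<^sup>2 * (us i k t)\<^sup>2) - (\<Sum>k. (lam k)\<^sup>2 * (us j k t)\<^sup>2)\<bar>"
    if "t \<ge> 0" for i j t
    unfolding sg_suminf cc_def by (intro L sgR that)
  define E0 where "E0 = (\<Sum>k. (1 + lam k) * en k (a k) (b k))"
  have E0: "E0 \<ge> 0" unfolding E0_def using summable_en(1) weight_pos
    by (intro suminf_nonneg mult_nonneg_nonneg en_nonneg) (auto simp: less_imp_le)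
  have key: "\<exists>M. \<forall>i\<ge>M. \<forall>j\<ge>M. \<forall>t\<in>{0..T}.
      (\<forall>k. en k (us i k t - us j k t) (vs i k t - vs j k t) \<le> (1 + lam k) * \<epsilon>) \<and> (cc i t - cc j t)\<^sup>2 \<le> \<epsilon>"
    if T: "T \<ge> 0" and \<epsilon>: "\<epsilon> > 0" for T \<epsilon>
  proof -
    obtain C where C: "C \<ge> 0" "\<And>N t k. t \<in> {0..T} \<Longrightarrow> en k (us N k t) (vs N k t) \<le> C * en k (a k) (b k)"
      using component_bound(1)[OF R(1), of T] g by blast
    obtain K where K: "K \<ge> 0" "\<And>N s t. s \<in> {0..T} \<Longrightarrow> t \<in> {0..T} \<Longrightarrow> \<bar>cc N s - cc N t\<bar> \<le> K * \<bar>s - t\<bar>"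
      using component_bound(2)[OF R(1), of T] g unfolding cc_def by blast
    define B where "B = C * E0"
    have B: "(\<Sum>k<n. (1 + lam k) * en k (us N k t) (vs N k t)) \<le> B" if "t \<in> {0..T}" for n N t
      unfolding B_def E0_def by (intro weighted_en_sum_le C that)
    have B0: "B \<ge> 0" using C(1) E0 by (simp add: B_def)
    define F where "F = 3 / 2 * \<mu> / \<nu> * exp (4 * (K / \<nu> + 1 + 4 * L\<^sup>2 * B\<^sup>2 / \<nu>) * T)"
    have F: "F > 0" using \<mu>(1) nu by (simp add: F_def)
    \<comment> \<open>Solves \<open>(1 + 4 L^2 B) F \<eta> = \<epsilon>\<close>, so that the modes
      and the squared difference of the coefficients are covered by the same
      \<open>\<epsilon>\<close>.\<close>
    define \<eta> where "\<eta> = \<epsilon> / (F * (1 + 4 * L\<^sup>2 * B))"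
    have W: "1 + 4 * L\<^sup>2 * B \<ge> 1" using B0 by simp
    have FW: "F * (1 + 4 * L\<^sup>2 * B) > 0" using F W by (intro mult_pos_pos) linarith+
    have \<eta>: "\<eta> > 0" unfolding \<eta>_def using \<epsilon> FW by (rule divide_pos_pos)
    have F\<eta>: "F * \<eta> = \<epsilon> / (1 + 4 * L\<^sup>2 * B)" using F W by (simp add: \<eta>_def)
    have F\<eta>1: "F * \<eta> \<le> \<epsilon>"
      unfolding F\<eta> using divide_left_mono[OF W, of \<epsilon>] W \<epsilon> by simp
    obtain M where M: "\<And>p q. p \<ge> M \<Longrightarrow> norm (\<Sum>k=p..<q. en k (a k) (b k)) < \<eta>"
      using summable_en(2) \<eta> unfolding summable_Cauchy by blast
    show ?thesis
    proof (intro exI[of _ M] allI impI ballI)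
      fix i j t assume ij: "i \<ge> M" "j \<ge> M" and t: "t \<in> {0..T}"
      have D: "(\<Sum>k<n. en k (us i k 0 - us j k 0) (vs i k 0 - vs j k 0) / (1 + lam k)) \<le> \<eta>" for n
      proof -
        have "(\<Sum>k<n. en k (us i k 0 - us j k 0) (vs i k 0 - vs j k 0) / (1 + lam k)) \<le>
          (\<Sum>k<n. if k < M then 0 else en k (a k) (b k))"
        proof (rule sum_mono)
          fix k
          have le: "en k (us i k 0 - us j k 0) (vs i k 0 - vs j k 0) \<le> (if k < M then 0 else en k (a k) (b k))"
            using ij by (auto simp: init en_def)
          have "en k (us i k 0 - us j k 0) (vs i k 0 - vs j k 0) / (1 + lam k) \<le> en k (us i k 0 - us j k 0) (vs i k 0 - vs j k 0) / 1"
            using lam_nonneg[of k] by (intro divide_left_mono en_nonneg) auto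
          then show "en k (us i k 0 - us j k 0) (vs i k 0 - vs j k 0) / (1 + lam k) \<le> (if k < M then 0 else en k (a k) (b k))"
            using le by linarith
        qed
        also have "\<dots> = (\<Sum>k=M..<n. en k (a k) (b k))"
          by (rule sum.mono_neutral_cong_right) auto
        also have "\<dots> \<le> \<eta>" using M[of M n] by (simp add: abs_less_iff)
        finally show ?thesis .
      qed
      have st: "(\<Sum>k<n. en k (us i k t - us j k t) (vs i k t - vs j k t) / (1 + lam k)) \<le> F * \<eta>" for n
        unfolding F_def
        by (rule stability[OF us' vs' us' vs' K \<mu>(1) _ _ _ B B D t]) (auto simp: cc_b intro: cdiff)
      have 1: "en k (us i k t - us j k t) (vs i k t - vs j k t) \<le> (1 + lam k) * \<epsilon>" for k
      proof -
        have "en k (us i k t - us j k t) (vs i k t - vs j k t) / (1 + lam k) \<le>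
          (\<Sum>k<Suc k. en k (us i k t - us j k t) (vs i k t - vs j k t) / (1 + lam k))"
          using weight_pos by (intro member_le_sum) (auto simp: en_nonneg less_imp_le)
        also have "\<dots> \<le> \<epsilon>" using st[of "Suc k"] F\<eta>1 by linarith
        finally show ?thesis using weight_pos[of k] by (simp add: field_simps)
      qed
      have "(cc i t - cc j t)\<^sup>2 \<le> \<epsilon>"
      proof -
        have Z: "(\<Sum>k<n. (lam k)\<^sup>2 * (us i k t - us j k t)\<^sup>2 / (1 + lam k)) \<le> F * \<eta>" for n
        proof -
          have "(\<Sum>k<n. (lam k)\<^sup>2 * (us i k t - us j k t)\<^sup>2 / (1 + lam k)) \<le>
            (\<Sum>k<n. en k (us i k t - us j k t) (vs i k t - vs j k t) / (1 + lam k))"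
            using weight_pos by (intro sum_mono divide_right_mono) (auto simp: en_def less_imp_le)
          then show ?thesis using st[of n] by linarith
        qed
        have Bu: "(\<Sum>k<n. (1 + lam k) * ((lam k)\<^sup>2 * (us N k t)\<^sup>2)) \<le> B" for n N
        proof -
          have "(\<Sum>k<n. (1 + lam k) * ((lam k)\<^sup>2 * (us N k t)\<^sup>2)) \<le> (\<Sum>k<n. (1 + lam k) * en k (us N k t) (vs N k t))"
            using weight_pos by (intro sum_mono mult_left_mono) (auto simp: en_def less_imp_le)
          then show ?thesis using B[OF t, of N n] by linarith
        qed
        have "(cc i t - cc j t)\<^sup>2 = \<bar>cc i t - cc j t\<bar>\<^sup>2" by simp
        also have "\<dots> \<le> (L * \<bar>(\<Sum>k. (lam k)\<^sup>2 * (us i k t)\<^sup>2) - (\<Sum>k. (lam k)\<^sup>2 * (us j k t)\<^sup>2)\<bar>)\<^sup>2"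
          using t by (intro power_mono cdiff) auto
        also have "\<dots> \<le> L\<^sup>2 * (4 * B * (F * \<eta>))"
          unfolding power_mult_distrib power2_abs by (intro mult_left_mono sigma_diff_bound Z Bu) simp
        also have "\<dots> = 4 * L\<^sup>2 * B * (F * \<eta>)" by simp
        also have "\<dots> \<le> (1 + 4 * L\<^sup>2 * B) * (F * \<eta>)" using F \<eta> by (intro mult_right_mono) auto
        also have "\<dots> = \<epsilon>"
        proof -
          have "1 + 4 * L\<^sup>2 * B \<noteq> 0" using W by linarith
          then show ?thesis unfolding F\<eta> by simp
        qed
        finally show ?thesis .
      qed
      with 1 show "(\<forall>k. en k (us i k t - us j k t) (vs i k t - vs j k t) \<le> (1 + lam k) * \<epsilon>) \<and> (cc i t - cc j t)\<^sup>2 \<le> \<epsilon>"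
        by blast
    qed
  qed
  have vdiff: "\<exists>M. \<forall>i\<ge>M. \<forall>j\<ge>M. \<forall>t\<in>{0..T}. \<bar>vs i k t - vs j k t\<bar> < \<epsilon>"
    if T: "T \<ge> 0" and \<epsilon>: "\<epsilon> > 0" for T k \<epsilon>
  proof -
    define \<epsilon>' where "\<epsilon>' = (\<epsilon> / 2)\<^sup>2 / (1 + lam k)"
    have "\<epsilon>' > 0" using \<epsilon> weight_pos[of k] by (simp add: \<epsilon>'_def)
    from key[OF T this] obtain M where M: "\<And>i j t. i \<ge> M \<Longrightarrow> j \<ge> M \<Longrightarrow> t \<in> {0..T} \<Longrightarrow>
      en k (us i k t - us j k t) (vs i k t - vs j k t) \<le> (1 + lam k) * \<epsilon>'" by blast
    show ?thesis
    proof (intro exI[of _ M] allI impI ballI)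
      fix i j t assume "i \<ge> M" "j \<ge> M" "t \<in> {0..T}"
      then have "en k (us i k t - us j k t) (vs i k t - vs j k t) \<le> (\<epsilon> / 2)\<^sup>2"
        using M[of i j t] weight_pos[of k] by (simp add: \<epsilon>'_def)
      moreover have "(vs i k t - vs j k t)\<^sup>2 \<le> en k (us i k t - us j k t) (vs i k t - vs j k t)" by (simp add: en_def)
      ultimately have "\<bar>vs i k t - vs j k t\<bar>\<^sup>2 \<le> (\<epsilon> / 2)\<^sup>2" by simp
      then have "\<bar>vs i k t - vs j k t\<bar> \<le> \<epsilon> / 2" by (rule power2_le_imp_le) (use \<epsilon> in simp)
      then show "\<bar>vs i k t - vs j k t\<bar> < \<epsilon>" using \<epsilon> by simp
    qed
  qed
  have cdiff': "\<exists>M. \<forall>i\<ge>M. \<forall>j\<ge>M. \<forall>t\<in>{0..T}. \<bar>cc i t - cc j t\<bar> < \<epsilon>"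
    if T: "T \<ge> 0" and \<epsilon>: "\<epsilon> > 0" for T \<epsilon>
  proof -
    have "(\<epsilon> / 2)\<^sup>2 > 0" using \<epsilon> by simp
    from key[OF T this] obtain M where M: "\<And>i j t. i \<ge> M \<Longrightarrow> j \<ge> M \<Longrightarrow> t \<in> {0..T} \<Longrightarrow>
      (cc i t - cc j t)\<^sup>2 \<le> (\<epsilon> / 2)\<^sup>2" by blast
    show ?thesis
    proof (intro exI[of _ M] allI impI ballI)
      fix i j t assume "i \<ge> M" "j \<ge> M" "t \<in> {0..T}"
      then have "\<bar>cc i t - cc j t\<bar>\<^sup>2 \<le> (\<epsilon> / 2)\<^sup>2" using M[of i j t] by simp
      then have "\<bar>cc i t - cc j t\<bar> \<le> \<epsilon> / 2" by (rule power2_le_imp_le) (use \<epsilon> in simp)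
      then show "\<bar>cc i t - cc j t\<bar> < \<epsilon>" using \<epsilon> by simp
    qed
  qed
  \<comment> \<open>For \<open>lam k = 0\<close> the energy does not see the position, so the bound
    on the velocities is integrated. Indices above \<open>k\<close> have the same initial value in
    mode \<open>k\<close>.\<close>
  have udiff: "\<exists>M. \<forall>i\<ge>M. \<forall>j\<ge>M. \<forall>t\<in>{0..T}. \<bar>us i k t - us j k t\<bar> < \<epsilon>"
    if T: "T \<ge> 0" and \<epsilon>: "\<epsilon> > 0" for T k \<epsilon>
  proof -
    define \<epsilon>' where "\<epsilon>' = \<epsilon> / (T + 1)"
    have \<epsilon>': "\<epsilon>' > 0" using \<epsilon> T by (simp add: \<epsilon>'_def)
    from vdiff[OF T \<epsilon>'] obtain M where M: "\<And>i j t. i \<ge> M \<Longrightarrow> j \<ge> M \<Longrightarrow> t \<in> {0..T} \<Longrightarrow>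
      \<bar>vs i k t - vs j k t\<bar> < \<epsilon>'" by blast
    show ?thesis
    proof (intro exI[of _ "max M (Suc k)"] allI impI ballI)
      fix i j t assume ij: "i \<ge> max M (Suc k)" "j \<ge> max M (Suc k)" and t: "t \<in> {0..T}"
      have "norm ((us i k t - us j k t) - (us i k 0 - us j k 0)) \<le> \<epsilon>' * norm (t - 0)"
      proof (rule field_differentiable_bound[of "{0..T}"])
        show "((\<lambda>t. us i k t - us j k t) has_field_derivative (vs i k x - vs j k x)) (at x within {0..T})"
          if "x \<in> {0..T}" for x
          by (intro DERIV_diff has_field_derivative_subset[OF us'[of x]]) (use that in auto)
        show "norm (vs i k x - vs j k x) \<le> \<epsilon>'" if "x \<in> {0..T}" for x
          using M[of i j x] ij that by simp
      qed (use t in auto)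
      moreover have "us i k 0 - us j k 0 = 0" using ij by (simp add: init)
      moreover have "\<epsilon>' * norm (t - 0) < \<epsilon>"
      proof -
        have "\<epsilon>' * norm (t - 0) \<le> \<epsilon>' * T" using t \<epsilon>' by (intro mult_left_mono) auto
        also have "\<dots> < \<epsilon>' * (T + 1)" using \<epsilon>' by simp
        also have "\<dots> = \<epsilon>" using T by (simp add: \<epsilon>'_def)
        finally show ?thesis .
      qed
      ultimately show "\<bar>us i k t - us j k t\<bar> < \<epsilon>" by simp
    qed
  qed
  define U where "U k t = lim (\<lambda>N. us N k t)" for k t
  define V where "V k t = lim (\<lambda>N. vs N k t)" for k t
  define c where "c t = lim (\<lambda>N. cc N t)" for t
  have Uu: "uniform_limit {0..T} (\<lambda>N. us N k) (U k) sequentially"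
    and Vu: "uniform_limit {0..T} (\<lambda>N. vs N k) (V k) sequentially"
    and cu: "uniform_limit {0..T} cc c sequentially" if T: "T \<ge> 0" for T k
    unfolding U_def V_def c_def by (rule uniform_limit_lim; rule udiff[OF T] vdiff[OF T] cdiff'[OF T]; assumption)+
  have Ul: "(\<lambda>N. us N k t) \<longlonglongrightarrow> U k t" and Vl: "(\<lambda>N. vs N k t) \<longlonglongrightarrow> V k t" and cl: "(\<lambda>N. cc N t) \<longlonglongrightarrow> c t"
    if "t \<ge> 0" for k t
    by (rule tendsto_uniform_limitI[OF Uu[OF that]] tendsto_uniform_limitI[OF Vu[OF that]]
        tendsto_uniform_limitI[OF cu[OF that]]; use that in simp)+
  have cb: "\<nu> \<le> c t" "c t \<le> \<mu>" if t: "t \<ge> 0" for t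
    by (rule LIMSEQ_le_const[OF cl[OF t]], use cc_b[OF t] in blast)
      (rule LIMSEQ_le_const2[OF cl[OF t]], use cc_b[OF t] in blast)
  have U': "(U k has_real_derivative V k t) (at t within {0..})" if "t \<ge> 0" for k t
    by (rule derivative_uniform_limit[where F="\<lambda>N. us N k" and G="\<lambda>N. vs N k", OF us' Vu Ul that])
  have Ucont: "continuous_on {0..} (U k)" for k
    by (rule DERIV_continuous_on[OF U']) simp
  have V': "(V k has_real_derivative - ((lam k)\<^sup>2 * c t * U k t)) (at t within {0..})" if "t \<ge> 0" for k t
  proof (rule derivative_uniform_limit[where F="\<lambda>N. vs N k" and G="\<lambda>N t. - ((lam k)\<^sup>2 * cc N t * us N k t)", OF vs' _ Vl that])
    fix T :: real assume T: "T \<ge> 0"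
    have "bounded (c ` {0..T})"
      unfolding bounded_iff using cb nu by (intro exI[of _ \<mu>]) (force simp: abs_le_iff)
    moreover have "bounded (U k ` {0..T})"
      by (intro compact_imp_bounded compact_continuous_image continuous_on_subset[OF Ucont]) auto
    ultimately have "uniform_limit {0..T} (\<lambda>N t. cc N t * us N k t) (\<lambda>t. c t * U k t) sequentially"
      by (intro uniform_lim_mult cu Uu T)
    then have "uniform_limit {0..T} (\<lambda>N t. - ((lam k)\<^sup>2) * (cc N t * us N k t)) (\<lambda>t. - ((lam k)\<^sup>2) * (c t * U k t)) sequentially"
      by (rule bounded_linear.uniform_limit[OF bounded_linear_mult_right])
    then show "uniform_limit {0..T} (\<lambda>N t. - ((lam k)\<^sup>2 * cc N t * us N k t)) (\<lambda>t. - ((lam k)\<^sup>2 * c t * U k t)) sequentially"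
      by (simp add: mult.assoc)
  qed
  have U0: "U k 0 = a k" and V0: "V k 0 = b k" for k
  proof -
    have "(\<lambda>N. us N k 0) \<longlonglongrightarrow> a k" "(\<lambda>N. vs N k 0) \<longlonglongrightarrow> b k"
      by (rule tendsto_eventually, auto simp: init eventually_sequentially intro!: exI[of _ "Suc k"])+
    then show "U k 0 = a k" "V k 0 = b k" using LIMSEQ_unique Ul[of 0 k] Vl[of 0 k] by auto
  qed
  have en_b: "\<exists>C\<ge>0. \<forall>t\<in>{0..T}. (\<forall>k. en k (U k t) (V k t) \<le> C * en k (a k) (b k)) \<and>
    (\<forall>N k. en k (us N k t) (vs N k t) \<le> C * en k (a k) (b k))" for T
  proof -
    obtain C where C: "C \<ge> 0" "\<And>N t k. t \<in> {0..T} \<Longrightarrow> en k (us N k t) (vs N k t) \<le> C * en k (a k) (b k)"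
      using component_bound(1)[OF R(1), of T] g by blast
    have "en k (U k t) (V k t) \<le> C * en k (a k) (b k)" if t: "t \<in> {0..T}" for t k
    proof (rule LIMSEQ_le_const2)
      show "(\<lambda>N. en k (us N k t) (vs N k t)) \<longlonglongrightarrow> en k (U k t) (V k t)"
        unfolding en_def by (intro tendsto_intros Ul Vl) (use t in auto)
    qed (use C(2)[OF t] in blast)
    then show ?thesis using C by blast
  qed
  have ceq: "c t = m (\<Sum>k. (lam k)\<^sup>2 * (U k t)\<^sup>2)" if t: "t \<ge> 0" for t
  proof -
    obtain C where C: "\<And>N k. en k (us N k t) (vs N k t) \<le> C * en k (a k) (b k)"
      using en_b[of t] t by force
    \<comment> \<open>Convergence of each mode does not suffice for the sum; the majorant
      \<open>C * en k (a k) (b k)\<close> is the same for all \<open>N\<close>.\<close>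
    have "(\<lambda>N. \<Sum>k. (lam k)\<^sup>2 * (us N k t)\<^sup>2) \<longlonglongrightarrow> (\<Sum>k. (lam k)\<^sup>2 * (U k t)\<^sup>2)"
    proof (rule tannerys_theorem[THEN conjunct2, THEN conjunct2])
      show "(\<lambda>N. (lam k)\<^sup>2 * (us N k t)\<^sup>2) \<longlonglongrightarrow> (lam k)\<^sup>2 * (U k t)\<^sup>2" for k
        by (intro tendsto_intros Ul t)
      show "summable (\<lambda>k. C * en k (a k) (b k))" by (intro summable_mult summable_en)
      have "norm ((lam k)\<^sup>2 * (us N k t)\<^sup>2) \<le> C * en k (a k) (b k)" for k N
        using C[of k N] by (simp add: en_def[of k "us N k t"]) (smt (verit) zero_le_power2)
      then show "\<forall>\<^sub>F (k, N) in at_top \<times>\<^sub>F sequentially. norm ((lam k)\<^sup>2 * (us N k t)\<^sup>2) \<le> C * en k (a k) (b k)"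
        by (auto intro!: always_eventually)
    qed simp
    then have s: "(\<lambda>N. sg N (us N) t) \<longlonglongrightarrow> (\<Sum>k. (lam k)\<^sup>2 * (U k t)\<^sup>2)" by (simp add: sg_suminf)
    moreover have "(\<Sum>k. (lam k)\<^sup>2 * (U k t)\<^sup>2) \<in> {0..}"
      using LIMSEQ_le_const[OF s, of 0] by (auto simp: sg_nonneg)
    ultimately have "(\<lambda>N. m (sg N (us N) t)) \<longlonglongrightarrow> m (\<Sum>k. (lam k)\<^sup>2 * (U k t)\<^sup>2)"
      by (intro continuous_on_tendsto_compose[OF m_cont]) (auto simp: sg_nonneg)
    then show ?thesis using LIMSEQ_unique[OF cl[OF t]] by (simp add: cc_def)
  qed
  have clip: "\<exists>K\<ge>0. \<forall>s\<in>{0..T}. \<forall>t\<in>{0..T}. \<bar>c s - c t\<bar> \<le> K * \<bar>s - t\<bar>" for T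
  proof -
    obtain K where K: "K \<ge> 0" "\<And>N s t. s \<in> {0..T} \<Longrightarrow> t \<in> {0..T} \<Longrightarrow> \<bar>cc N s - cc N t\<bar> \<le> K * \<bar>s - t\<bar>"
      using component_bound(2)[OF R(1), of T] g unfolding cc_def by blast
    have "\<bar>c s - c t\<bar> \<le> K * \<bar>s - t\<bar>" if st: "s \<in> {0..T}" "t \<in> {0..T}" for s t
    proof (rule LIMSEQ_le_const2)
      show "(\<lambda>N. \<bar>cc N s - cc N t\<bar>) \<longlonglongrightarrow> \<bar>c s - c t\<bar>"
        by (intro tendsto_intros cl) (use st in auto)
    qed (use K(2)[OF st] in blast)
    then show ?thesis using K(1) by blast
  qed
  have en_b': "\<exists>C\<ge>0. \<forall>t\<in>{0..T}. \<forall>k. en k (U k t) (V k t) \<le> C * en k (a k) (b k)" for T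
    using en_b[of T] by blast
  show ?thesis
  proof (rule exI[of _ U], rule exI[of _ V], rule exI[of _ c], intro conjI)
    show "\<exists>\<mu>\<ge>1. \<forall>t\<ge>0. \<nu> \<le> c t \<and> c t \<le> \<mu>" using cb \<mu>(1) by blast
    show "\<forall>t\<ge>0. c t = m (\<Sum>k. (lam k)\<^sup>2 * (U k t)\<^sup>2)" using ceq by blast
  qed (simp_all add: U' V' U0 V0 en_b' clip)
qed

end

section \<open>Series limits and one-sided derivatives\<close>

lemma eventually_prod_snd:
  assumes "eventually Q F"
  shows "eventually (\<lambda>(k, s). Q s) (G \<times>\<^sub>F F)"
proof -
  have "eventually (\<lambda>p. True \<and> Q (snd p)) (G \<times>\<^sub>F F)"
    using eventually_prodI[OF eventually_True assms, of G] by simp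
  then show ?thesis by (rule eventually_mono) auto
qed

lemma suminf_tendsto_zero:
  fixes f :: "nat \<Rightarrow> 'b \<Rightarrow> real"
  assumes "\<And>k. (f k \<longlongrightarrow> 0) F" "\<forall>\<^sub>F s in F. \<forall>k. \<bar>f k s\<bar> \<le> M k" "summable M" "F \<noteq> bot"
  shows "((\<lambda>s. \<Sum>k. f k s) \<longlongrightarrow> 0) F"
proof -
  have "((\<lambda>s. \<Sum>k. f k s) \<longlongrightarrow> (\<Sum>k. 0)) F"
  proof (rule tannerys_theorem[THEN conjunct2, THEN conjunct2])
    show "\<forall>\<^sub>F (k, s) in at_top \<times>\<^sub>F F. norm (f k s) \<le> M k"
      using eventually_prod_snd[OF assms(2), of at_top] by (rule eventually_mono) auto
  qed (use assms in auto)
  then show ?thesis by simp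
qed

text \<open>Brings the derivative into the shape of the quotient in \<open>C1_dom\<close>, where it
  is dominated by the graph norm.\<close>

lemma has_vector_derivative_iff_quotient:
  fixes f :: "real \<Rightarrow> 'b::real_normed_vector"
  shows "(f has_vector_derivative d) (at t within X) \<longleftrightarrow>
    ((\<lambda>s. norm ((1 / (s - t)) *\<^sub>R (f s - f t) - d)) \<longlongrightarrow> 0) (at t within X)"
proof -
  have eq: "norm ((f s - f t) - (s - t) *\<^sub>R d) / norm (s - t) = norm ((1 / (s - t)) *\<^sub>R (f s - f t) - d)"
    if "s \<noteq> t" for s
  proof -
    have "(1 / (s - t)) *\<^sub>R ((f s - f t) - (s - t) *\<^sub>R d) = (1 / (s - t)) *\<^sub>R (f s - f t) - d"
      using that by (simp add: scaleR_diff_right)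
    then have "norm ((1 / (s - t)) *\<^sub>R (f s - f t) - d) = \<bar>1 / (s - t)\<bar> * norm ((f s - f t) - (s - t) *\<^sub>R d)"
      by (metis norm_scaleR)
    then show ?thesis by (simp add: abs_divide)
  qed
  have "(f has_vector_derivative d) (at t within X) \<longleftrightarrow>
    ((\<lambda>s. norm ((f s - f t) - (s - t) *\<^sub>R d) / norm (s - t)) \<longlongrightarrow> 0) (at t within X)"
    unfolding has_vector_derivative_def has_derivative_iff_norm
    by (simp add: bounded_linear_scaleR_left)
  also have "\<dots> \<longleftrightarrow> ((\<lambda>s. norm ((1 / (s - t)) *\<^sub>R (f s - f t) - d)) \<longlongrightarrow> 0) (at t within X)"
    by (rule filterlim_cong) (auto simp: eventually_at_filter eq[unfolded real_norm_def] intro!: always_eventually)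
  finally show ?thesis .
qed

lemma at_within_atLeast_nontrivial: "t \<ge> 0 \<Longrightarrow> at t within {0..} \<noteq> (bot :: real filter)"
proof -
  assume "t \<ge> 0"
  then have "at_right t \<le> at t within {0..}" by (intro at_le) auto
  then show ?thesis using trivial_limit_at_right_real[of t] by (metis bot.extremum_uniqueI)
qed

lemma has_real_derivative_unique_atLeast:
  assumes "t \<ge> 0" "(f has_real_derivative c) (at t within {0..})" "(f has_real_derivative d) (at t within {0..})"
  shows "c = d"
  using assms(2,3) at_within_atLeast_nontrivial[OF assms(1)] tendsto_unique
  unfolding has_field_derivative_iff by blast

lemma graph_norm_ge: "norm x \<le> graph_norm T x" "norm (op_apply T x) \<le> graph_norm T x"
  unfolding graph_norm_def by (rule real_le_rsqrt; simp)+

context spectral_setting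
begin

section \<open>Powers of the operator and the graph norm in coordinates\<close>

definition pow :: "real \<Rightarrow> 'a operator" where
  "pow \<beta> = spectral_integral E (\<lambda>s. if \<beta> = 0 then 1 else s powr \<beta>)"

text \<open>The eigenvalue \<open>(lam k)\<^sup>2\<close> of \<open>A\<close> raised to the power
  \<open>\<beta>\<close>.\<close>

definition wt :: "real \<Rightarrow> nat \<Rightarrow> real" where "wt \<beta> k = lam k powr (2 * \<beta>)"

lemma pow_measurable [measurable]: "(\<lambda>s. if \<beta> = 0 then 1 else s powr \<beta>) \<in> borel_measurable (borel :: real measure)"
  by measurable

lemma sq_powr: "((lam k)\<^sup>2) powr \<beta> = wt \<beta> k"
proof (cases "lam k = 0")
  case False
  then have "lam k > 0" using lam_nonneg[of k] by simp
  then show ?thesis by (simp add: wt_def powr_powr[symmetric])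
qed (simp add: wt_def)

lemma pow_coeff: "\<beta> > 0 \<Longrightarrow> (x, y) \<in> pow \<beta> \<Longrightarrow> inner y (e k) = wt \<beta> k * inner x (e k)"
  unfolding pow_def using coeff_spectral_integral[OF pow_measurable, of x y \<beta> k] by (simp add: sq_powr)

lemma pow_synth:
  assumes "\<beta> > 0" "summable (\<lambda>k. (a k)\<^sup>2)" "summable (\<lambda>k. (wt \<beta> k * a k)\<^sup>2)"
  shows "(synth a, synth (\<lambda>k. wt \<beta> k * a k)) \<in> pow \<beta>"
  unfolding pow_def
  using S_spectral_integral[OF pow_measurable synth_in_S[OF assms(2)], of \<beta>] assms
  by (simp add: sq_powr inner_synth)

lemma pow_unique: "(x, y) \<in> pow \<beta> \<Longrightarrow> (x, y') \<in> pow \<beta> \<Longrightarrow> y = y'"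
  unfolding pow_def using spectral_integral_unique[OF pow_measurable] by blast

lemma op_apply_pow: "(x, y) \<in> pow \<beta> \<Longrightarrow> op_apply (pow \<beta>) x = y"
  unfolding op_apply_def using pow_unique by blast

lemma pow_op_apply: "x \<in> Domain (pow \<beta>) \<Longrightarrow> (x, op_apply (pow \<beta>) x) \<in> pow \<beta>"
  using op_apply_pow by auto

lemma pow_diff: "(x, y) \<in> pow \<beta> \<Longrightarrow> (x', y') \<in> pow \<beta> \<Longrightarrow> (x - x', y - y') \<in> pow \<beta>"
  unfolding pow_def by (rule spectral_integral_diff[OF pow_measurable])

lemma wt_sq: "(wt \<beta> k)\<^sup>2 = lam k powr (4 * \<beta>)"
  unfolding wt_def power2_eq_square powr_add[symmetric] by simp

lemma wt_half: "\<beta> > 0 \<Longrightarrow> (wt (\<beta> + 1/2) k)\<^sup>2 = lam k powr (4 * \<beta>) * (lam k)\<^sup>2"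
proof (cases "lam k = 0")
  case False
  then have "lam k > 0" using lam_nonneg[of k] by simp
  then have "lam k powr (4 * \<beta> + 2) = lam k powr (4 * \<beta>) * (lam k)\<^sup>2" by (simp add: powr_add)
  then show ?thesis by (simp add: wt_sq algebra_simps)
qed (simp add: wt_sq)

lemma graph_norm_synth:
  assumes "\<beta> > 0" "summable (\<lambda>k. (1 + (wt \<beta> k)\<^sup>2) * (a k)\<^sup>2)"
  shows "synth a \<in> Domain (pow \<beta>)" "graph_norm (pow \<beta>) (synth a) = sqrt (\<Sum>k. (1 + (wt \<beta> k)\<^sup>2) * (a k)\<^sup>2)"
    "summable (\<lambda>k. (a k)\<^sup>2)"
proof -
  have "norm ((a k)\<^sup>2) \<le> (1 + (wt \<beta> k)\<^sup>2) * (a k)\<^sup>2" "norm ((wt \<beta> k * a k)\<^sup>2) \<le> (1 + (wt \<beta> k)\<^sup>2) * (a k)\<^sup>2" for k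
    by (simp_all add: distrib_right power_mult_distrib)
  then have s: "summable (\<lambda>k. (a k)\<^sup>2)" "summable (\<lambda>k. (wt \<beta> k * a k)\<^sup>2)"
    by (intro summable_comparison_test'[OF assms(2), of 0]; simp)+
  then show "summable (\<lambda>k. (a k)\<^sup>2)" by simp
  note p = pow_synth[OF assms(1) s]
  then show "synth a \<in> Domain (pow \<beta>)" by blast
  have "(\<lambda>k. (a k)\<^sup>2 + (wt \<beta> k * a k)\<^sup>2) sums ((norm (synth a))\<^sup>2 + (norm (op_apply (pow \<beta>) (synth a)))\<^sup>2)"
    unfolding op_apply_pow[OF p] by (intro sums_add norm_synth_sums s)
  moreover have "(a k)\<^sup>2 + (wt \<beta> k * a k)\<^sup>2 = (1 + (wt \<beta> k)\<^sup>2) * (a k)\<^sup>2" for k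
    by (simp add: distrib_right power_mult_distrib)
  ultimately show "graph_norm (pow \<beta>) (synth a) = sqrt (\<Sum>k. (1 + (wt \<beta> k)\<^sup>2) * (a k)\<^sup>2)"
    by (simp add: graph_norm_def sums_iff)
qed

text \<open>Dominated convergence over the modes: convergence in each mode and one summable majorant
  near the limit point give convergence in the graph norm. Both continuity and differentiability of
  the solution are instances.\<close>

lemma graph_norm_synth_tendsto:
  assumes \<beta>: "\<beta> > 0" and F: "F \<noteq> bot" and M: "summable M"
    and le: "\<forall>\<^sub>F s in F. \<forall>k. (1 + (wt \<beta> k)\<^sup>2) * (\<xi> k s)\<^sup>2 \<le> M k"
    and x: "\<forall>\<^sub>F s in F. x s = synth (\<lambda>k. \<xi> k s)"
    and lim: "\<And>k. (\<xi> k \<longlongrightarrow> 0) F"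
  shows "((\<lambda>s. graph_norm (pow \<beta>) (x s)) \<longlongrightarrow> 0) F"
proof -
  have nn: "(1 + (wt \<beta> k)\<^sup>2) * (r::real)\<^sup>2 \<ge> 0" for k r by simp
  have "((\<lambda>s. \<Sum>k. (1 + (wt \<beta> k)\<^sup>2) * (\<xi> k s)\<^sup>2) \<longlongrightarrow> 0) F"
  proof (rule suminf_tendsto_zero[OF _ _ M F])
    show "((\<lambda>s. (1 + (wt \<beta> k)\<^sup>2) * (\<xi> k s)\<^sup>2) \<longlongrightarrow> 0) F" for k
      by (rule tendsto_eq_intros lim refl)+ simp
    show "\<forall>\<^sub>F s in F. \<forall>k. \<bar>(1 + (wt \<beta> k)\<^sup>2) * (\<xi> k s)\<^sup>2\<bar> \<le> M k"
      using le by eventually_elim (simp add: abs_mult)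
  qed
  from tendsto_real_sqrt[OF this]
  have "((\<lambda>s. sqrt (\<Sum>k. (1 + (wt \<beta> k)\<^sup>2) * (\<xi> k s)\<^sup>2)) \<longlongrightarrow> 0) F" by simp
  moreover have "\<forall>\<^sub>F s in F. sqrt (\<Sum>k. (1 + (wt \<beta> k)\<^sup>2) * (\<xi> k s)\<^sup>2) = graph_norm (pow \<beta>) (x s)"
    using le x
  proof eventually_elim
    case (elim s)
    have "summable (\<lambda>k. (1 + (wt \<beta> k)\<^sup>2) * (\<xi> k s)\<^sup>2)"
      by (rule summable_comparison_test'[OF M, of 0]) (use elim(1) nn in \<open>simp add: abs_of_nonneg\<close>)
    from graph_norm_synth(2)[OF \<beta> this] show ?case using elim(2) by simp
  qed
  ultimately show ?thesis by (rule Lim_transform_eventually)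
qed

lemma C0_dom_continuous:
  assumes "C0_dom (pow \<beta>) w"
  shows "continuous_on {0..} w" "continuous_on {0..} (\<lambda>t. op_apply (pow \<beta>) (w t))"
    "t \<ge> 0 \<Longrightarrow> (w t, op_apply (pow \<beta>) (w t)) \<in> pow \<beta>"
proof -
  have d: "(w t, op_apply (pow \<beta>) (w t)) \<in> pow \<beta>" if "t \<ge> 0" for t
    using assms that by (auto simp: C0_dom_def intro!: pow_op_apply)
  then show "t \<ge> 0 \<Longrightarrow> (w t, op_apply (pow \<beta>) (w t)) \<in> pow \<beta>" .
  have lim: "((\<lambda>s. graph_norm (pow \<beta>) (w s - w t)) \<longlongrightarrow> 0) (at t within {0..})" if "t \<ge> 0" for t
    using assms that by (auto simp: C0_dom_def)
  show "continuous_on {0..} w"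
    unfolding continuous_on_def
  proof
    fix t :: real assume t: "t \<in> {0..}"
    have "((\<lambda>s. w s - w t) \<longlongrightarrow> 0) (at t within {0..})"
      by (rule tendsto_norm_zero_cancel, rule tendsto_sandwich[OF _ _ tendsto_const lim])
        (use t in \<open>auto simp: graph_norm_ge(1)\<close>)
    then show "(w \<longlongrightarrow> w t) (at t within {0..})" by (simp add: LIM_zero_iff)
  qed
  show "continuous_on {0..} (\<lambda>t. op_apply (pow \<beta>) (w t))"
    unfolding continuous_on_def
  proof
    fix t :: real assume t: "t \<in> {0..}"
    have ev: "\<forall>\<^sub>F s in at t within {0..}. norm (op_apply (pow \<beta>) (w s) - op_apply (pow \<beta>) (w t)) \<le> graph_norm (pow \<beta>) (w s - w t)"
    proof -
      have "norm (op_apply (pow \<beta>) (w s) - op_apply (pow \<beta>) (w t)) \<le> graph_norm (pow \<beta>) (w s - w t)" if "s \<ge> 0" for s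
        using graph_norm_ge(2)[of "pow \<beta>" "w s - w t"] op_apply_pow[OF pow_diff[OF d[OF that] d[of t]]] t by simp
      then show ?thesis by (auto simp: eventually_at_filter)
    qed
    have "((\<lambda>s. op_apply (pow \<beta>) (w s) - op_apply (pow \<beta>) (w t)) \<longlongrightarrow> 0) (at t within {0..})"
      by (rule tendsto_norm_zero_cancel, rule tendsto_sandwich[OF _ ev tendsto_const lim]) (use t in auto)
    then show "((\<lambda>t. op_apply (pow \<beta>) (w t)) \<longlongrightarrow> op_apply (pow \<beta>) (w t)) (at t within {0..})"
      by (simp add: LIM_zero_iff)
  qed
qed

lemma C0_dom_bounded:
  assumes "C0_dom (pow \<beta>) w"
  shows "\<exists>B. \<forall>t\<in>{0..T}. norm (w t) \<le> B \<and> norm (op_apply (pow \<beta>) (w t)) \<le> B"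
proof -
  have "bounded (w ` {0..T})" "bounded ((\<lambda>t. op_apply (pow \<beta>) (w t)) ` {0..T})"
    by (intro compact_imp_bounded compact_continuous_image continuous_on_subset[OF C0_dom_continuous(1)[OF assms]]
        continuous_on_subset[OF C0_dom_continuous(2)[OF assms]]; force)+
  then obtain B1 B2 where "\<forall>t\<in>{0..T}. norm (w t) \<le> B1" "\<forall>t\<in>{0..T}. norm (op_apply (pow \<beta>) (w t)) \<le> B2"
    unfolding bounded_iff by force
  then have "\<forall>t\<in>{0..T}. norm (w t) \<le> max B1 B2 \<and> norm (op_apply (pow \<beta>) (w t)) \<le> max B1 B2" by force
  then show ?thesis by blast
qed

text \<open>It is applied to a competing solution before its values are known to lie in
  \<open>S\<close>, so the comparison uses the spectral measure and not the coefficients.\<close>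

lemma norm_pow_half_le:
  assumes "\<beta> \<ge> 1/2" "(x, y) \<in> pow (1/2)" "(x, y') \<in> pow \<beta>"
  shows "(norm y)\<^sup>2 \<le> 8 * (norm x)\<^sup>2 + 2 * (norm y')\<^sup>2"
proof (rule norm_spectral_integral_le[OF pow_measurable pow_measurable assms(2,3)[unfolded pow_def]])
  fix s :: real
  show "0 \<le> (if (1/2::real) = 0 then 1 else s powr (1/2))" by simp
  have "s powr (1/2) \<le> 1 + s powr \<beta>"
  proof (cases "s = 0")
    case False
    show ?thesis
    \<comment> \<open>The cases are on the sign of \<open>ln s\<close> because negative
      \<open>s\<close> must be covered too; whatever \<open>ln s\<close> is there,
      \<open>powr\<close> is still the exponential of its multiple.\<close>
    proof (cases "ln s \<ge> 0")
      case True
      then have "1/2 * ln s \<le> \<beta> * ln s" using assms(1) by (intro mult_right_mono) auto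
      then show ?thesis using False by (simp add: powr_def add_increasing)
    next
      case neg: False
      then have "exp (1/2 * ln s) \<le> 1" by simp
      moreover have "s powr \<beta> \<ge> 0" by simp
      moreover have "s powr (1/2) = exp (1/2 * ln s)" using False by (simp add: powr_def)
      ultimately show ?thesis by linarith
    qed
  qed simp
  then show "(if (1/2::real) = 0 then 1 else s powr (1/2)) \<le> 1 + (if \<beta> = 0 then 1 else s powr \<beta>)"
    using assms(1) by simp
qed

section \<open>Existence\<close>

lemma eventually_atLeast_less: "t \<ge> 0 \<Longrightarrow> \<forall>\<^sub>F s in at t within {0..}. s \<in> {0..t + 1} \<and> s \<noteq> (t::real)"
  unfolding eventually_at by (rule exI[of _ 1]) (auto simp: dist_real_def)

lemma summable_weighted:
  assumes "summable M" "\<And>k. (1 + (wt \<beta> k)\<^sup>2) * (x k)\<^sup>2 \<le> M k"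
  shows "summable (\<lambda>k. (1 + (wt \<beta> k)\<^sup>2) * (x k)\<^sup>2)"
  by (rule summable_comparison_test'[OF assms(1), of 0]) (use assms(2) in \<open>simp add: abs_mult\<close>)

lemma weighted_diff_le:
  assumes "(1 + (wt \<beta> k)\<^sup>2) * x\<^sup>2 \<le> M" "(1 + (wt \<beta> k)\<^sup>2) * y\<^sup>2 \<le> M"
  shows "(1 + (wt \<beta> k)\<^sup>2) * (x - y)\<^sup>2 \<le> 4 * M"
proof -
  have "(x - y)\<^sup>2 \<le> 2 * x\<^sup>2 + 2 * y\<^sup>2"
    using zero_le_power2[of "x + y"] by (simp add: power2_sum power2_diff)
  then have "(1 + (wt \<beta> k)\<^sup>2) * (x - y)\<^sup>2 \<le> (1 + (wt \<beta> k)\<^sup>2) * (2 * x\<^sup>2 + 2 * y\<^sup>2)"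
    by (intro mult_left_mono) auto
  also have "\<dots> = 2 * ((1 + (wt \<beta> k)\<^sup>2) * x\<^sup>2) + 2 * ((1 + (wt \<beta> k)\<^sup>2) * y\<^sup>2)"
    by (simp add: distrib_left distrib_right)
  finally show ?thesis using assms by linarith
qed

lemma C0_dom_synth:
  assumes \<beta>: "\<beta> > 0" and cont: "\<And>k. continuous_on {0..} (W k)"
    and bd: "\<And>T. T \<ge> 0 \<Longrightarrow> \<exists>M. summable M \<and> (\<forall>t\<in>{0..T}. \<forall>k. (1 + (wt \<beta> k)\<^sup>2) * (W k t)\<^sup>2 \<le> M k)"
  shows "C0_dom (pow \<beta>) (\<lambda>t. synth (\<lambda>k. W k t))"
  unfolding C0_dom_def
proof (intro conjI allI impI)
  fix t :: real assume t: "t \<ge> 0"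
  obtain M where M: "summable M" "\<And>s k. s \<in> {0..t + 1} \<Longrightarrow> (1 + (wt \<beta> k)\<^sup>2) * (W k s)\<^sup>2 \<le> M k"
    using bd[of "t + 1"] t by auto
  have s: "summable (\<lambda>k. (1 + (wt \<beta> k)\<^sup>2) * (W k s)\<^sup>2)" if "s \<in> {0..t + 1}" for s
    by (rule summable_weighted[OF M(1) M(2)[OF that]])
  have t': "t \<in> {0..t + 1}" using t by simp
  show "synth (\<lambda>k. W k t) \<in> Domain (pow \<beta>)" by (rule graph_norm_synth(1)[OF \<beta> s[OF t']])
  show "((\<lambda>s. graph_norm (pow \<beta>) (synth (\<lambda>k. W k s) - synth (\<lambda>k. W k t))) \<longlongrightarrow> 0) (at t within {0..})"
  proof (rule graph_norm_synth_tendsto[OF \<beta> at_within_atLeast_nontrivial[OF t] summable_mult[OF M(1), of 4]])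
    show "\<forall>\<^sub>F s in at t within {0..}. \<forall>k. (1 + (wt \<beta> k)\<^sup>2) * (W k s - W k t)\<^sup>2 \<le> 4 * M k"
      using eventually_atLeast_less[OF t] by eventually_elim (use M(2) t' weighted_diff_le in blast)
    show "\<forall>\<^sub>F s in at t within {0..}. synth (\<lambda>k. W k s) - synth (\<lambda>k. W k t) = synth (\<lambda>k. W k s - W k t)"
      using eventually_atLeast_less[OF t]
      by eventually_elim (intro synth_diff graph_norm_synth(3)[OF \<beta>] s t', auto)
    show "((\<lambda>s. W k s - W k t) \<longlongrightarrow> 0) (at t within {0..})" for k
      using cont[of k] t by (auto simp: continuous_on_def LIM_zero_iff)
  qed
qed

text \<open>In each mode the mean value inequality bounds the difference quotient by the majorant of
  the derivative, so dominated convergence applies; the factor 4 pays for subtracting the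
  derivative.\<close>

lemma synth_graph_derivative:
  assumes \<beta>: "\<beta> > 0" and der: "\<And>k t. t \<ge> 0 \<Longrightarrow> (W k has_real_derivative X k t) (at t within {0..})"
    and bd: "\<And>T. T \<ge> 0 \<Longrightarrow> \<exists>M. summable M \<and> (\<forall>t\<in>{0..T}. \<forall>k. (1 + (wt \<beta> k)\<^sup>2) * (W k t)\<^sup>2 \<le> M k)"
    and bd': "\<And>T. T \<ge> 0 \<Longrightarrow> \<exists>M. summable M \<and> (\<forall>t\<in>{0..T}. \<forall>k. (1 + (wt \<beta> k)\<^sup>2) * (X k t)\<^sup>2 \<le> M k)"
    and t: "t \<ge> 0"
  shows "((\<lambda>s. graph_norm (pow \<beta>) ((1 / (s - t)) *\<^sub>R (synth (\<lambda>k. W k s) - synth (\<lambda>k. W k t)) -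
    synth (\<lambda>k. X k t))) \<longlongrightarrow> 0) (at t within {0..})"
proof -
  obtain M where M: "summable M" "\<And>s k. s \<in> {0..t + 1} \<Longrightarrow> (1 + (wt \<beta> k)\<^sup>2) * (W k s)\<^sup>2 \<le> M k"
    using bd[of "t + 1"] t by auto
  obtain M' where M': "summable M'" "\<And>s k. s \<in> {0..t + 1} \<Longrightarrow> (1 + (wt \<beta> k)\<^sup>2) * (X k s)\<^sup>2 \<le> M' k"
    using bd'[of "t + 1"] t by auto
  have t': "t \<in> {0..t + 1}" using t by simp
  have sW: "summable (\<lambda>k. (W k s)\<^sup>2)" if "s \<in> {0..t + 1}" for s
    by (rule graph_norm_synth(3)[OF \<beta> summable_weighted[OF M(1) M(2)[OF that]]])
  have sX: "summable (\<lambda>k. (X k t)\<^sup>2)"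
    by (rule graph_norm_synth(3)[OF \<beta> summable_weighted[OF M'(1) M'(2)[OF t']]])
  have q: "(1 + (wt \<beta> k)\<^sup>2) * (1 / (s - t) * (W k s - W k t))\<^sup>2 \<le> M' k" if s: "s \<in> {0..t + 1}" "s \<noteq> t" for s k
  proof -
    let ?w = "1 + (wt \<beta> k)\<^sup>2"
    have w: "?w > 0" by (simp add: add_pos_nonneg)
    have "norm (W k s - W k t) \<le> sqrt (M' k / ?w) * norm (s - t)"
    proof (rule field_differentiable_bound[of "{0..t + 1}"])
      show "(W k has_field_derivative X k x) (at x within {0..t + 1})" if "x \<in> {0..t + 1}" for x
        by (rule has_field_derivative_subset[OF der]) (use that in auto)
      fix x assume "x \<in> {0..t + 1}"
      from M'(2)[OF this, of k] have "(X k x)\<^sup>2 \<le> M' k / ?w" using w by (simp add: pos_le_divide_eq mult.commute)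
      then show "norm (X k x) \<le> sqrt (M' k / ?w)" by (simp add: real_le_rsqrt)
    qed (use s t in auto)
    then have "\<bar>1 / (s - t) * (W k s - W k t)\<bar> \<le> sqrt (M' k / ?w)"
      using s by (simp add: abs_mult divide_le_eq)
    then have "\<bar>1 / (s - t) * (W k s - W k t)\<bar>\<^sup>2 \<le> (sqrt (M' k / ?w))\<^sup>2" by (rule power_mono) simp
    moreover have "0 \<le> M' k"
    proof -
      have "0 \<le> (1 + (wt \<beta> k)\<^sup>2) * (X k t)\<^sup>2" by simp
      then show ?thesis using M'(2)[OF t', of k] by linarith
    qed
    ultimately have "(1 / (s - t) * (W k s - W k t))\<^sup>2 \<le> M' k / ?w" using w by (simp only: power2_abs) simp
    then show ?thesis using w by (simp only: pos_le_divide_eq mult.commute)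
  qed
  show ?thesis
  proof (rule graph_norm_synth_tendsto[OF \<beta> at_within_atLeast_nontrivial[OF t] summable_mult[OF M'(1), of 4]])
    show "\<forall>\<^sub>F s in at t within {0..}. \<forall>k. (1 + (wt \<beta> k)\<^sup>2) * (1 / (s - t) * (W k s - W k t) - X k t)\<^sup>2 \<le> 4 * M' k"
      using eventually_atLeast_less[OF t] by eventually_elim (use M'(2) t' q weighted_diff_le in blast)
    show "\<forall>\<^sub>F s in at t within {0..}. (1 / (s - t)) *\<^sub>R (synth (\<lambda>k. W k s) - synth (\<lambda>k. W k t)) - synth (\<lambda>k. X k t) =
      synth (\<lambda>k. 1 / (s - t) * (W k s - W k t) - X k t)"
      using eventually_atLeast_less[OF t]
    proof eventually_elim
      case (elim s)
      have d: "summable (\<lambda>k. (W k s - W k t)\<^sup>2)"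
      proof (rule summable_comparison_test'[of "\<lambda>k. 2 * (W k s)\<^sup>2 + 2 * (W k t)\<^sup>2" 0])
        show "summable (\<lambda>k. 2 * (W k s)\<^sup>2 + 2 * (W k t)\<^sup>2)"
          using elim t' by (intro summable_add summable_mult sW) auto
        fix k show "norm ((W k s - W k t)\<^sup>2) \<le> 2 * (W k s)\<^sup>2 + 2 * (W k t)\<^sup>2"
        proof -
          have "(W k s - W k t)\<^sup>2 \<le> 2 * (W k s)\<^sup>2 + 2 * (W k t)\<^sup>2"
            using zero_le_power2[of "W k s + W k t"] unfolding power2_sum power2_diff by linarith
          then show ?thesis by simp
        qed
      qed
      have d': "summable (\<lambda>k. (1 / (s - t) * (W k s - W k t))\<^sup>2)"
        unfolding power_mult_distrib by (rule summable_mult[OF d])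
      show ?case
        using elim t' by (simp only: synth_diff[OF sW sW] synth_scale[OF d] synth_diff[OF d' sX])
    qed
    show "((\<lambda>s. 1 / (s - t) * (W k s - W k t) - X k t) \<longlongrightarrow> 0) (at t within {0..})" for k
      using der[OF t, of k] by (simp add: has_field_derivative_iff LIM_zero_iff)
  qed
qed

end

locale kirchhoff_setting = spectral_setting E e lam A
  for E :: "real set \<Rightarrow> 'a::{real_inner, complete_space} \<Rightarrow> 'a" and e :: "nat \<Rightarrow> 'a" and lam :: "nat \<Rightarrow> real"
    and A :: "'a operator" +
  fixes m :: "real \<Rightarrow> real" and \<nu> \<alpha> :: real and u0 u1 :: 'a
  assumes A_subspace: "subspace A" and A_dense: "closure (Domain A) = UNIV"
    and op_power_eq: "op_power A \<beta> = pow \<beta>"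
    and nu: "0 < \<nu>" "\<nu> \<le> 1" and m_ge: "s \<ge> 0 \<Longrightarrow> \<nu> \<le> m s"
    and m_lip: "R \<ge> 0 \<Longrightarrow> \<exists>L\<ge>0. \<forall>x\<in>{0..R}. \<forall>y\<in>{0..R}. \<bar>m x - m y\<bar> \<le> L * \<bar>x - y\<bar>"
    and alpha: "\<alpha> > 1/4"
    and u0: "u0 \<in> Domain (pow (\<alpha> + 1/2))" "u0 \<in> S"
    and u1: "u1 \<in> Domain (pow \<alpha>)" "u1 \<in> S"
begin

lemma coeff_Domain_summable:
  assumes "\<beta> > 0" "x \<in> Domain (pow \<beta>)"
  shows "summable (\<lambda>k. (wt \<beta> k)\<^sup>2 * (inner x (e k))\<^sup>2)"
  using summable_coeff[of "op_apply (pow \<beta>) x"] pow_coeff[OF assms(1) pow_op_apply[OF assms(2)]]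
  by (simp add: power_mult_distrib)

text \<open>The weights match because \<open>A\<close> has the eigenvalues
  \<open>(lam k)\<^sup>2\<close>: squared coefficients of \<open>A^\<alpha> u1\<close> carry
  \<open>lam^(4 \<alpha>)\<close>, those of \<open>A^(\<alpha> + 1/2) u0\<close> one more factor
  \<open>lam^2\<close>.\<close>

sublocale kirchhoff lam m \<nu> "4 * \<alpha>" "\<lambda>k. inner u0 (e k)" "\<lambda>k. inner u1 (e k)"
proof (unfold_locales)
  show "summable (\<lambda>k. lam k powr (4 * \<alpha>) * ((inner u1 (e k))\<^sup>2 + (lam k)\<^sup>2 * (inner u0 (e k))\<^sup>2))"
  proof -
    have \<alpha>0: "\<alpha> > 0" "\<alpha> + 1/2 > 0" using alpha by simp_all
    show ?thesis
      using summable_add[OF coeff_Domain_summable[OF \<alpha>0(1) u1(1)] coeff_Domain_summable[OF \<alpha>0(2) u0(1)]]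
      by (simp only: wt_half[OF \<alpha>0(1)] wt_sq[of \<alpha>] distrib_left mult.assoc)
  qed
qed (use nu m_ge m_lip alpha in auto)

lemma A_unique: "(z, y) \<in> A \<Longrightarrow> (z, y') \<in> A \<Longrightarrow> y = y'"
  unfolding A_eq by (rule spectral_integral_unique) auto

lemma op_apply_A: "(z, y) \<in> A \<Longrightarrow> op_apply A z = y"
  unfolding op_apply_def using A_unique by blast

lemma A_coeff: "(z, y) \<in> A \<Longrightarrow> inner y (e k) = (lam k)\<^sup>2 * inner z (e k)"
  unfolding A_eq using coeff_spectral_integral[of "\<lambda>s. s" z y k] by simp

text \<open>Besides the solution, its coordinate functions and their bounds are returned: they are
  the hypotheses on one side when \<open>stability\<close> compares this solution with another
  one.\<close>

lemma existence:
  obtains U V c where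
    "kirchhoff_solution A m \<alpha> u0 u1 (\<lambda>t. synth (\<lambda>k. U k t))"
    "\<And>k t. t \<ge> 0 \<Longrightarrow> (U k has_real_derivative V k t) (at t within {0..})"
    "\<And>k t. t \<ge> 0 \<Longrightarrow> (V k has_real_derivative - ((lam k)\<^sup>2 * c t * U k t)) (at t within {0..})"
    "\<And>k. U k 0 = inner u0 (e k)" "\<And>k. V k 0 = inner u1 (e k)"
    "\<And>t. t \<ge> 0 \<Longrightarrow> c t = m (\<Sum>k. (lam k)\<^sup>2 * (U k t)\<^sup>2)"
    "\<And>T. \<exists>C\<ge>0. \<forall>t\<in>{0..T}. \<forall>k. en k (U k t) (V k t) \<le> C * en k (inner u0 (e k)) (inner u1 (e k))"
    "\<And>T. \<exists>K\<ge>0. \<forall>s\<in>{0..T}. \<forall>t\<in>{0..T}. \<bar>c s - c t\<bar> \<le> K * \<bar>s - t\<bar>"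
    "\<exists>\<mu>\<ge>1. \<forall>t\<ge>0. \<nu> \<le> c t \<and> c t \<le> \<mu>"
proof -
  let ?a = "\<lambda>k. inner u0 (e k)" and ?b = "\<lambda>k. inner u1 (e k)"
  let ?p = "\<lambda>k. lam k powr (4 * \<alpha>)"
  have \<alpha>0: "\<alpha> > 0" using alpha by simp
  from global_solution obtain U V c \<mu> where
    U'0: "\<forall>k. \<forall>t\<ge>0. (U k has_real_derivative V k t) (at t within {0..})"
    and V'0: "\<forall>k. \<forall>t\<ge>0. (V k has_real_derivative - ((lam k)\<^sup>2 * c t * U k t)) (at t within {0..})"
    and UV0: "\<forall>k. U k 0 = ?a k \<and> V k 0 = ?b k"
    and ceq0: "\<forall>t\<ge>0. c t = m (\<Sum>k. (lam k)\<^sup>2 * (U k t)\<^sup>2)"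
    and enb0: "\<forall>T. \<exists>C\<ge>0. \<forall>t\<in>{0..T}. \<forall>k. en k (U k t) (V k t) \<le> C * en k (?a k) (?b k)"
    and clip0: "\<forall>T. \<exists>K\<ge>0. \<forall>s\<in>{0..T}. \<forall>t\<in>{0..T}. \<bar>c s - c t\<bar> \<le> K * \<bar>s - t\<bar>"
    and \<mu>1: "1 \<le> \<mu>" and c\<mu>: "\<forall>t\<ge>0. \<nu> \<le> c t \<and> c t \<le> \<mu>"
    by (elim exE conjE) (rule that; assumption)
  have U': "(U k has_real_derivative V k t) (at t within {0..})"
    and V': "(V k has_real_derivative - ((lam k)\<^sup>2 * c t * U k t)) (at t within {0..})"
    and ceq: "c t = m (\<Sum>k. (lam k)\<^sup>2 * (U k t)\<^sup>2)" if "t \<ge> 0" for k t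
    using U'0 V'0 ceq0 that by simp_all
  have U0: "U k 0 = ?a k" and V0: "V k 0 = ?b k" for k using UV0 by simp_all
  note enb = spec[OF enb0] and clip = spec[OF clip0]
  have \<mu>: "\<mu> \<ge> 1" "\<And>t. t \<ge> 0 \<Longrightarrow> \<nu> \<le> c t \<and> c t \<le> \<mu>" using \<mu>1 c\<mu> by simp_all
  have cb: "\<exists>\<mu>\<ge>1. \<forall>t\<ge>0. \<nu> \<le> c t \<and> c t \<le> \<mu>" using \<mu> by blast
  have Uc: "continuous_on {0..} (U k)" and Vc: "continuous_on {0..} (V k)" for k
    by (rule DERIV_continuous_on[OF U'] DERIV_continuous_on[OF V']; simp)+
  have bd: "\<exists>M. summable M \<and> (\<forall>t\<in>{0..T}. \<forall>k.
      (1 + (wt (\<alpha> + 1/2) k)\<^sup>2) * (U k t)\<^sup>2 \<le> M k \<and> (1 + (wt \<alpha> k)\<^sup>2) * (V k t)\<^sup>2 \<le> M k)" if T: "T \<ge> 0" for T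
  proof -
    obtain C where C: "C \<ge> 0" "\<And>t k. t \<in> {0..T} \<Longrightarrow> en k (U k t) (V k t) \<le> C * en k (?a k) (?b k)"
      using enb[of T] by blast
    \<comment> \<open>One majorant for both spaces. The energy bounds \<open>lam U\<close> but not
      \<open>U\<close>, so the unweighted part of \<open>U\<close> is estimated by its initial value
      and \<open>T\<close> times the bound on the velocity.\<close>
    define M where "M k = 2 * (?a k)\<^sup>2 + (2 * T\<^sup>2 + 1) * C * en k (?a k) (?b k) + C * (?p k * en k (?a k) (?b k))" for k
    have "summable M" unfolding M_def
      by (intro summable_add summable_mult summable_coeff summable_en data')
    moreover have "(1 + (wt (\<alpha> + 1/2) k)\<^sup>2) * (U k t)\<^sup>2 \<le> M k \<and> (1 + (wt \<alpha> k)\<^sup>2) * (V k t)\<^sup>2 \<le> M k"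
      if t: "t \<in> {0..T}" for t k
    proof -
      define X where "X = C * en k (?a k) (?b k)"
      have X: "X \<ge> 0" using C(1) by (simp add: X_def en_nonneg)
      have V2: "(V k s)\<^sup>2 \<le> X" and U2: "(lam k)\<^sup>2 * (U k s)\<^sup>2 \<le> X" if "s \<in> {0..T}" for s
      proof -
        have "(V k s)\<^sup>2 + (lam k)\<^sup>2 * (U k s)\<^sup>2 \<le> X" using C(2)[OF that, of k] by (simp add: X_def en_def)
        moreover have "0 \<le> (V k s)\<^sup>2" "0 \<le> (lam k)\<^sup>2 * (U k s)\<^sup>2" by simp_all
        ultimately show "(V k s)\<^sup>2 \<le> X" "(lam k)\<^sup>2 * (U k s)\<^sup>2 \<le> X" by linarith+
      qed
      have "norm (U k t - U k 0) \<le> sqrt X * norm (t - 0)"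
      proof (rule field_differentiable_bound[of "{0..T}"])
        show "(U k has_field_derivative V k x) (at x within {0..T})" if "x \<in> {0..T}" for x
          by (rule has_field_derivative_subset[OF U']) (use that in auto)
        show "norm (V k x) \<le> sqrt X" if "x \<in> {0..T}" for x
          using V2[OF that] by (simp add: real_le_rsqrt)
      qed (use t in auto)
      also have "\<dots> \<le> sqrt X * T" using t X by (intro mult_left_mono) auto
      finally have "\<bar>U k t - ?a k\<bar>\<^sup>2 \<le> (sqrt X * T)\<^sup>2" by (intro power_mono) (auto simp: U0)
      then have "(U k t - ?a k)\<^sup>2 \<le> X * T\<^sup>2" using X by (simp add: power_mult_distrib)
      moreover have "(U k t)\<^sup>2 \<le> 2 * (?a k)\<^sup>2 + 2 * (U k t - ?a k)\<^sup>2"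
        using zero_le_power2[of "U k t - 2 * ?a k"] by (simp add: power2_diff power_mult_distrib algebra_simps)
      ultimately have Usq: "(U k t)\<^sup>2 \<le> 2 * (?a k)\<^sup>2 + 2 * (X * T\<^sup>2)" by linarith
      have Meq: "M k = 2 * (?a k)\<^sup>2 + 2 * (X * T\<^sup>2) + X + ?p k * X"
        by (simp add: M_def X_def algebra_simps)
      have "(1 + (wt (\<alpha> + 1/2) k)\<^sup>2) * (U k t)\<^sup>2 = (U k t)\<^sup>2 + ?p k * ((lam k)\<^sup>2 * (U k t)\<^sup>2)"
        using \<alpha>0 by (simp add: wt_half distrib_right)
      moreover have "?p k * ((lam k)\<^sup>2 * (U k t)\<^sup>2) \<le> ?p k * X" using U2[OF t] by (intro mult_left_mono) auto
      ultimately have 1: "(1 + (wt (\<alpha> + 1/2) k)\<^sup>2) * (U k t)\<^sup>2 \<le> M k" using Usq X unfolding Meq by linarith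
      have "(1 + (wt \<alpha> k)\<^sup>2) * (V k t)\<^sup>2 = (V k t)\<^sup>2 + ?p k * (V k t)\<^sup>2" by (simp add: wt_sq distrib_right)
      moreover have "?p k * (V k t)\<^sup>2 \<le> ?p k * X" using V2[OF t] by (intro mult_left_mono) auto
      moreover have "0 \<le> 2 * (?a k)\<^sup>2" "0 \<le> X * T\<^sup>2" using X by simp_all
      ultimately have 2: "(1 + (wt \<alpha> k)\<^sup>2) * (V k t)\<^sup>2 \<le> M k" using V2[OF t] unfolding Meq by linarith
      show ?thesis using 1 2 by blast
    qed
    ultimately show ?thesis by blast
  qed
  have bdU: "\<exists>M. summable M \<and> (\<forall>t\<in>{0..T}. \<forall>k. (1 + (wt (\<alpha> + 1/2) k)\<^sup>2) * (U k t)\<^sup>2 \<le> M k)"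
    and bdV: "\<exists>M. summable M \<and> (\<forall>t\<in>{0..T}. \<forall>k. (1 + (wt \<alpha> k)\<^sup>2) * (V k t)\<^sup>2 \<le> M k)" if "T \<ge> 0" for T
    using bd[OF that] by blast+
  \<comment> \<open>The domain of \<open>A^(\<alpha> + 1/2)\<close> is contained in that of
    \<open>A^\<alpha>\<close>, on coefficients; needed since the difference quotients of
    \<open>u\<close> are measured in the weaker norm.\<close>
  have wle: "(wt \<alpha> k)\<^sup>2 \<le> 1 + (wt (\<alpha> + 1/2) k)\<^sup>2" for k
  proof (cases "lam k \<le> 1")
    case True
    then have "?p k \<le> 1" using lam_nonneg[of k] \<alpha>0 by (intro powr_le1) auto
    then show ?thesis by (simp add: wt_sq add_increasing2)
  next
    case False
    then have "1 \<le> (lam k)\<^sup>2" by simp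
    then have "?p k * 1 \<le> ?p k * (lam k)\<^sup>2" by (intro mult_left_mono) auto
    then show ?thesis unfolding wt_half[OF \<alpha>0] wt_sq[of \<alpha>] by linarith
  qed
  have bdU': "\<exists>M. summable M \<and> (\<forall>t\<in>{0..T}. \<forall>k. (1 + (wt \<alpha> k)\<^sup>2) * (U k t)\<^sup>2 \<le> M k)" if T: "T \<ge> 0" for T
  proof -
    obtain M where M: "summable M" "\<forall>t\<in>{0..T}. \<forall>k. (1 + (wt (\<alpha> + 1/2) k)\<^sup>2) * (U k t)\<^sup>2 \<le> M k"
      using bdU[OF T] by blast
    have "(1 + (wt \<alpha> k)\<^sup>2) * (U k t)\<^sup>2 \<le> 2 * M k" if "t \<in> {0..T}" for t k
    proof -
      have "1 + (wt \<alpha> k)\<^sup>2 \<le> 2 * (1 + (wt (\<alpha> + 1/2) k)\<^sup>2)" 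
      proof -
        have "1 + (wt \<alpha> k)\<^sup>2 \<le> 1 + (1 + (wt (\<alpha> + 1/2) k)\<^sup>2)" by (intro add_left_mono wle)
        also have "\<dots> \<le> 2 * (1 + (wt (\<alpha> + 1/2) k)\<^sup>2)" by simp
        finally show ?thesis .
      qed
      then have "(1 + (wt \<alpha> k)\<^sup>2) * (U k t)\<^sup>2 \<le> (2 * (1 + (wt (\<alpha> + 1/2) k)\<^sup>2)) * (U k t)\<^sup>2"
        by (intro mult_right_mono) auto
      also have "\<dots> = 2 * ((1 + (wt (\<alpha> + 1/2) k)\<^sup>2) * (U k t)\<^sup>2)" by (simp only: mult.assoc)
      also have "\<dots> \<le> 2 * M k" using M(2) that by simp
      finally show ?thesis .
    qed
    then show ?thesis using summable_mult[OF M(1), of 2] by blast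
  qed
  define u where "u t = synth (\<lambda>k. U k t)" for t
  define u' where "u' t = synth (\<lambda>k. V k t)" for t
  have sU: "summable (\<lambda>k. (1 + (wt (\<alpha> + 1/2) k)\<^sup>2) * (U k t)\<^sup>2)"
    and sV: "summable (\<lambda>k. (1 + (wt \<alpha> k)\<^sup>2) * (V k t)\<^sup>2)"
    and sU2: "summable (\<lambda>k. (1 + (wt \<alpha> k)\<^sup>2) * (U k t)\<^sup>2)" if t0: "t \<ge> 0" for t
  proof -
    have t: "t \<in> {0..t}" using t0 by simp
    obtain M where "summable M" "\<forall>t\<in>{0..t}. \<forall>k. (1 + (wt (\<alpha> + 1/2) k)\<^sup>2) * (U k t)\<^sup>2 \<le> M k"
      using bdU[OF t0] by (elim exE conjE)
    then show "summable (\<lambda>k. (1 + (wt (\<alpha> + 1/2) k)\<^sup>2) * (U k t)\<^sup>2)"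
      using t by (intro summable_weighted[of M]) blast+
    obtain M where "summable M" "\<forall>t\<in>{0..t}. \<forall>k. (1 + (wt \<alpha> k)\<^sup>2) * (V k t)\<^sup>2 \<le> M k"
      using bdV[OF t0] by (elim exE conjE)
    then show "summable (\<lambda>k. (1 + (wt \<alpha> k)\<^sup>2) * (V k t)\<^sup>2)"
      using t by (intro summable_weighted[of M]) blast+
    obtain M where "summable M" "\<forall>t\<in>{0..t}. \<forall>k. (1 + (wt \<alpha> k)\<^sup>2) * (U k t)\<^sup>2 \<le> M k"
      using bdU'[OF t0] by (elim exE conjE)
    then show "summable (\<lambda>k. (1 + (wt \<alpha> k)\<^sup>2) * (U k t)\<^sup>2)"
      using t by (intro summable_weighted[of M]) blast+
  qed
  have sU0: "summable (\<lambda>k. (U k t)\<^sup>2)" and sV0: "summable (\<lambda>k. (V k t)\<^sup>2)" if "t \<ge> 0" for t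
    using graph_norm_synth(3)[OF \<alpha>0 sU2[OF that]] graph_norm_synth(3)[OF \<alpha>0 sV[OF that]] by blast+
  have C0: "C0_dom (pow (\<alpha> + 1/2)) u"
    unfolding u_def[abs_def] by (rule C0_dom_synth) (use \<alpha>0 Uc bdU in auto)
  have C0': "C0_dom (pow \<alpha>) u'"
    unfolding u'_def[abs_def] by (rule C0_dom_synth) (use \<alpha>0 Vc bdV in auto)
  have q: "((\<lambda>s. graph_norm (pow \<alpha>) ((1 / (s - t)) *\<^sub>R (u s - u t) - u' t)) \<longlongrightarrow> 0) (at t within {0..})" if "t \<ge> 0" for t
    unfolding u_def u'_def by (rule synth_graph_derivative[OF \<alpha>0 U' bdU' bdV that])
  have C1: "C1_dom (pow \<alpha>) u"
    unfolding C1_dom_def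
    using C0' q graph_norm_synth(1)[OF \<alpha>0 sU2] by (auto simp: u_def)
  have vd: "(u has_vector_derivative u' t) (at t within {0..})" if t: "t \<ge> 0" for t
    unfolding has_vector_derivative_iff_quotient
    by (rule tendsto_sandwich[OF _ _ tendsto_const q[OF t]]) (auto simp: graph_norm_ge(1))
  have uinit: "u 0 = u0" "u' 0 = u1"
    using synth_coeff[OF u0(2)] synth_coeff[OF u1(2)] by (simp_all add: u_def u'_def U0 V0)
  have half: "(u t, synth (\<lambda>k. wt (1/2) k * U k t)) \<in> pow (1/2)"
    and half_norm: "(norm (op_apply (pow (1/2)) (u t)))\<^sup>2 = (\<Sum>k. (lam k)\<^sup>2 * (U k t)\<^sup>2)" if t: "t \<ge> 0" for t
  proof -
    have w2: "(wt (1/2) k)\<^sup>2 = (lam k)\<^sup>2" for k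
      unfolding wt_sq using lam_nonneg[of k] by simp
    obtain C where C: "\<And>k. en k (U k t) (V k t) \<le> C * en k (?a k) (?b k)"
      using enb[of t] t by force
    have le: "norm ((wt (1/2) k * U k t)\<^sup>2) \<le> C * en k (?a k) (?b k)" for k
    proof -
      have "(lam k)\<^sup>2 * (U k t)\<^sup>2 \<le> en k (U k t) (V k t)" by (simp add: en_def)
      then show ?thesis using C[of k] by (simp add: power_mult_distrib w2)
    qed
    have s: "summable (\<lambda>k. (wt (1/2) k * U k t)\<^sup>2)"
      by (rule summable_comparison_test'[OF summable_mult[OF summable_en(2), of C], of 0]) (rule le)
    show h: "(u t, synth (\<lambda>k. wt (1/2) k * U k t)) \<in> pow (1/2)"
      unfolding u_def by (rule pow_synth[OF _ sU0[OF t] s]) simp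
    show "(norm (op_apply (pow (1/2)) (u t)))\<^sup>2 = (\<Sum>k. (lam k)\<^sup>2 * (U k t)\<^sup>2)"
      unfolding op_apply_pow[OF h] using norm_synth_sums[OF s]
      by (simp add: power_mult_distrib w2 sums_iff)
  qed
  have ccont: "continuous_on {0..} c"
    unfolding continuous_on_def
  proof
    fix t :: real assume t: "t \<in> {0..}"
    obtain K where K: "K \<ge> 0" "\<And>s r. s \<in> {0..t + 1} \<Longrightarrow> r \<in> {0..t + 1} \<Longrightarrow> \<bar>c s - c r\<bar> \<le> K * \<bar>s - r\<bar>"
      using clip[of "t + 1"] by blast
    have "((\<lambda>s. c s - c t) \<longlongrightarrow> 0) (at t within {0..})"
    proof (rule Lim_null_comparison)
      show "\<forall>\<^sub>F s in at t within {0..}. norm (c s - c t) \<le> K * \<bar>s - t\<bar>"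
        using eventually_atLeast_less[of t] t by (auto elim!: eventually_mono intro!: K(2))
      show "((\<lambda>s. K * \<bar>s - t\<bar>) \<longlongrightarrow> 0) (at t within {0..})"
        by (rule tendsto_eq_intros refl)+ auto
    qed
    then show "(c \<longlongrightarrow> c t) (at t within {0..})" by (simp add: LIM_zero_iff)
  qed
  have weak: "weak_kirchhoff_solution A m u"
    unfolding weak_kirchhoff_solution_def op_power_eq
  proof (intro conjI allI impI ballI)
    show "u t \<in> Domain (pow (1/2))" if "t \<ge> 0" for t using half[OF that] by blast
    fix v assume "v \<in> Domain A"
    then obtain y where y: "(v, y) \<in> A" by blast
    define \<phi>'' where "\<phi>'' t = - (c t * inner (u t) y)" for t
    have 1: "((\<lambda>s. inner (u s) v) has_real_derivative inner (u' t) v) (at t within {0..})" if "t \<ge> 0" for t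
      unfolding has_real_derivative_iff_has_vector_derivative
      by (rule bounded_linear.has_vector_derivative[OF bounded_linear_inner_left vd[OF that]])
    have inner_sums: "(\<lambda>k. V k t * inner v (e k)) sums inner (u' t) v" "(\<lambda>k. U k t * inner y (e k)) sums inner (u t) y" if "t \<ge> 0" for t
      using sums_inner[OF sums_synth[OF sV0[OF that]], of v] sums_inner[OF sums_synth[OF sU0[OF that]], of y]
      by (simp_all add: u_def u'_def inner_commute)
    \<comment> \<open>The values of \<open>u\<close> need not lie in the domain of \<open>A\<close>.
      The factor \<open>lam^2\<close> is moved to the test vector, where it gives the square
      summable coefficients of \<open>y\<close>, so the series may be differentiated
      termwise.\<close>
    have 2: "((\<lambda>t. inner (u' t) v) has_real_derivative \<phi>'' t) (at t within {0..})" if t: "t \<ge> 0" for t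
    proof (rule derivative_uniform_limit[where F="\<lambda>n t. \<Sum>k<n. V k t * inner v (e k)"
          and G="\<lambda>n t. \<Sum>k<n. - ((lam k)\<^sup>2 * c t * U k t) * inner v (e k)", OF _ _ _ t])
      show "((\<lambda>t. \<Sum>k<n. V k t * inner v (e k)) has_real_derivative (\<Sum>k<n. - ((lam k)\<^sup>2 * c t * U k t) * inner v (e k))) (at t within {0..})"
        if "t \<ge> 0" for n t
        by (intro DERIV_sum DERIV_cmult_right V' that)
      show "(\<lambda>n. \<Sum>k<n. V k t * inner v (e k)) \<longlonglongrightarrow> inner (u' t) v" if "t \<ge> 0" for t
        using inner_sums(1)[OF that] by (simp add: sums_def)
      fix T :: real assume T: "T \<ge> 0"
      obtain M where M: "summable M" "\<forall>t\<in>{0..T}. \<forall>k. (1 + (wt \<alpha> k)\<^sup>2) * (U k t)\<^sup>2 \<le> M k"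
        using bdU'[OF T] by blast
      have eq: "- ((lam k)\<^sup>2 * c t * U k t) * inner v (e k) = - c t * (U k t * inner y (e k))" for k t
        by (simp add: A_coeff[OF y])
      have ul: "uniform_limit {0..T} (\<lambda>n t. \<Sum>k<n. - ((lam k)\<^sup>2 * c t * U k t) * inner v (e k))
         (\<lambda>t. \<Sum>k. - ((lam k)\<^sup>2 * c t * U k t) * inner v (e k)) sequentially"
      proof (rule Weierstrass_m_test)
        show "summable (\<lambda>k. \<mu> * (M k + (inner y (e k))\<^sup>2))"
          by (intro summable_mult summable_add M(1) summable_coeff)
        fix k t assume t: "t \<in> {0..T}"
        have c0: "0 \<le> c t" "c t \<le> \<mu>" using \<mu>(2)[of t] t nu by auto
        have "(U k t)\<^sup>2 \<le> (1 + (wt \<alpha> k)\<^sup>2) * (U k t)\<^sup>2" by (simp add: distrib_right)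
        also have "\<dots> \<le> M k" using M(2) t by blast
        finally have "(U k t)\<^sup>2 \<le> M k" .
        moreover have "\<bar>U k t * inner y (e k)\<bar> \<le> (U k t)\<^sup>2 + (inner y (e k))\<^sup>2"
        proof -
          have "2 * (\<bar>U k t\<bar> * \<bar>inner y (e k)\<bar>) \<le> (U k t)\<^sup>2 + (inner y (e k))\<^sup>2"
            using zero_le_power2[of "\<bar>U k t\<bar> - \<bar>inner y (e k)\<bar>"] by (simp add: power2_diff)
          moreover have "0 \<le> \<bar>U k t\<bar> * \<bar>inner y (e k)\<bar>" by simp
          ultimately show ?thesis unfolding abs_mult by linarith
        qed
        ultimately have "\<bar>U k t * inner y (e k)\<bar> \<le> M k + (inner y (e k))\<^sup>2" by linarith
        then have "c t * \<bar>U k t * inner y (e k)\<bar> \<le> \<mu> * (M k + (inner y (e k))\<^sup>2)"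
          using c0 by (intro mult_mono) auto
        then show "norm (- ((lam k)\<^sup>2 * c t * U k t) * inner v (e k)) \<le> \<mu> * (M k + (inner y (e k))\<^sup>2)"
          unfolding eq using c0 by (simp add: abs_mult)
      qed
      have eq\<phi>: "(\<Sum>k. - ((lam k)\<^sup>2 * c t * U k t) * inner v (e k)) = \<phi>'' t" if "t \<in> {0..T}" for t
        unfolding eq \<phi>''_def using sums_mult[OF inner_sums(2), of t "- c t"] that by (simp add: sums_iff)
      show "uniform_limit {0..T} (\<lambda>n t. \<Sum>k<n. - ((lam k)\<^sup>2 * c t * U k t) * inner v (e k)) \<phi>'' sequentially"
        by (rule iffD1[OF uniform_limit_cong' ul]) (rule refl, rule eq\<phi>)
    qed
    have 3: "continuous_on {0..} \<phi>''"
      unfolding \<phi>''_def by (intro continuous_intros ccont C0_dom_continuous(1)[OF C0])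
    have 4: "\<phi>'' t + m ((norm (op_apply (pow (1/2)) (u t)))\<^sup>2) * inner (u t) (op_apply A v) = 0" if "t \<ge> 0" for t
      unfolding half_norm[OF that] ceq[OF that, symmetric] op_apply_A[OF y] \<phi>''_def by simp
    show "\<exists>\<phi>' \<phi>''. (\<forall>t\<ge>0. ((\<lambda>s. inner (u s) v) has_real_derivative \<phi>' t) (at t within {0..})) \<and>
      (\<forall>t\<ge>0. (\<phi>' has_real_derivative \<phi>'' t) (at t within {0..})) \<and> continuous_on {0..} \<phi>'' \<and>
      (\<forall>t\<ge>0. \<phi>'' t + m ((norm (op_apply (pow (1/2)) (u t)))\<^sup>2) * inner (u t) (op_apply A v) = 0)"
      by (rule exI[of _ "\<lambda>t. inner (u' t) v"], rule exI[of _ \<phi>'']) (use 1 2 3 4 in blast)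
  qed
  have "kirchhoff_solution A m \<alpha> u0 u1 u"
    unfolding kirchhoff_solution_def op_power_eq
    using C1 C0 weak vd[of 0] uinit by simp
  then show thesis
    unfolding u_def[abs_def] by (rule that[OF _ U' V' U0 V0 ceq enb clip cb])
qed

end

section \<open>Uniqueness\<close>

text \<open>The effect of integrating the bound on \<open>f'\<close>, with the barrier lemma in
  place of an integral, since \<open>f'\<close> is not assumed continuous.\<close>

lemma exp_bound_upper:
  fixes f :: "real \<Rightarrow> real"
  assumes der: "\<And>s. s \<ge> 0 \<Longrightarrow> (f has_real_derivative f' s) (at s within {0..})" and f0: "f 0 = 0"
    and le: "\<And>s. s \<in> {0..T} \<Longrightarrow> f' s \<le> K * exp (r * s)" and r: "r > 0" and t: "t \<in> {0..T}" and K: "K \<ge> 0"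
  shows "f t \<le> K / r * exp (r * t)"
proof (rule field_le_epsilon)
  fix \<epsilon> :: real assume "\<epsilon> > 0"
  define \<eta> where "\<eta> = \<epsilon> / exp (r * t)"
  have \<eta>: "\<eta> > 0" using \<open>\<epsilon> > 0\<close> by (simp add: \<eta>_def)
  have G: "f 0 \<le> K / r + \<eta>" using f0 K r \<eta> by simp
  have cont: "continuous_on {0..T} f"
    by (rule continuous_on_subset[OF DERIV_continuous_on[OF der]]) auto
  have "f t \<le> (K / r + \<eta>) * exp (r * (t - 0))"
  proof (rule dini_barrier[where f=f and a=0 and G="K / r + \<eta>", OF cont G _ t])
    fix s assume s: "0 \<le> s" "s < T" "f s = (K / r + \<eta>) * exp (r * (s - 0))"
    have "f' s \<le> K * exp (r * s)" using s by (intro le) auto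
    also have "\<dots> < (K + r * \<eta>) * exp (r * s)" using r \<eta> by (intro mult_strict_right_mono) auto
    also have "\<dots> = r * f s" using r by (simp add: s(3) algebra_simps)
    finally show "\<exists>d<r * f s. dini_le f d s"
      using dini_le_deriv[OF at_within_atLeast_mono[OF der[OF s(1)] s(1)]] by blast
  qed
  also have "\<dots> = K / r * exp (r * t) + \<epsilon>" by (simp add: \<eta>_def distrib_right)
  finally show "f t \<le> K / r * exp (r * t) + \<epsilon>" .
qed

lemma exp_bound:
  fixes f :: "real \<Rightarrow> real"
  assumes der: "\<And>s. s \<ge> 0 \<Longrightarrow> (f has_real_derivative f' s) (at s within {0..})" and f0: "f 0 = 0"
    and le: "\<And>s. s \<in> {0..T} \<Longrightarrow> \<bar>f' s\<bar> \<le> K * exp (r * s)" and r: "r > 0" and t: "t \<in> {0..T}" and K: "K \<ge> 0"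
  shows "\<bar>f t\<bar> \<le> K / r * exp (r * t)"
proof -
  have "f t \<le> K / r * exp (r * t)"
    by (rule exp_bound_upper[OF der f0 _ r t K]) (use le in \<open>auto simp: abs_le_iff\<close>)
  moreover have "- f t \<le> K / r * exp (r * t)"
    by (rule exp_bound_upper[of "\<lambda>s. - f s" "\<lambda>s. - f' s", OF DERIV_minus[OF der] _ _ r t K])
      (use le f0 in \<open>auto simp: abs_le_iff\<close>)
  ultimately show ?thesis by linarith
qed

context kirchhoff_setting
begin

section \<open>The part of a solution orthogonal to \<open>S\<close>\<close>

definition cut :: "nat \<Rightarrow> real set" where "cut N = {s. \<bar>s\<bar> \<le> real N}"

definition cut_perp :: "nat \<Rightarrow> 'a set" where
  "cut_perp N = {z. E (cut N) z = z \<and> (\<forall>k. inner z (e k) = 0)}"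

text \<open>The orthogonal projection onto \<open>cut_perp N\<close>. A finite sum suffices because
  \<open>(lam k)\<^sup>2 > N\<close> for \<open>k > N\<close>, and being finite it does not lead out
  of the domain of \<open>A\<close>.\<close>

definition perp_proj :: "nat \<Rightarrow> 'a \<Rightarrow> 'a" where
  "perp_proj N x = E (cut N) x - (\<Sum>k<Suc N. inner (E (cut N) x) (e k) *\<^sub>R e k)"

lemma cut_borel [simp]: "cut N \<in> sets borel"
  unfolding cut_def by measurable

lemma inner_cut: "inner (E (cut N) x) (e k) = (if (lam k)\<^sup>2 \<le> real N then inner x (e k) else 0)"
  by (simp add: inner_E E_e cut_def)

lemma lam_sq_gt: "k \<ge> Suc N \<Longrightarrow> (lam k)\<^sup>2 > real N"
proof -
  assume "k \<ge> Suc N"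
  then have 1: "1 \<le> lam k" "real N < lam k" using lam_ge[of k] by linarith+
  have "lam k * 1 \<le> lam k * lam k" using 1 by (intro mult_left_mono) auto
  then show ?thesis using 1 unfolding power2_eq_square by linarith
qed

lemma perp_proj_cut_perp: "perp_proj N x \<in> cut_perp N"
proof -
  let ?c = "\<lambda>k. inner (E (cut N) x) (e k)"
  have "E (cut N) (?c k *\<^sub>R e k) = ?c k *\<^sub>R e k" for k
  proof (cases "(lam k)\<^sup>2 \<le> real N")
    case True
    then have "(lam k)\<^sup>2 \<in> cut N" by (simp add: cut_def)
    then have "E (cut N) (e k) = e k" by (simp add: E_e)
    then show ?thesis by (simp add: E_scale)
  next
    case False
    then show ?thesis by (simp add: inner_cut)
  qed
  then have "E (cut N) (\<Sum>k<Suc N. ?c k *\<^sub>R e k) = (\<Sum>k<Suc N. ?c k *\<^sub>R e k)"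
    by (simp only: linear_sum[OF bounded_linear.linear[OF bounded_linear_E[OF cut_borel]]])
  then have "E (cut N) (perp_proj N x) = perp_proj N x"
    by (simp add: perp_proj_def E_diff)
  moreover have "inner (perp_proj N x) (e k) = 0" for k
  proof (cases "k < Suc N")
    case True
    then show ?thesis by (simp add: perp_proj_def inner_diff_left inner_sum_e del: sum.lessThan_Suc)
  next
    case False
    then have "(lam k)\<^sup>2 > real N" using lam_sq_gt[of N k] by simp
    then show ?thesis using False
      by (simp add: perp_proj_def inner_diff_left inner_sum_e inner_cut[of N x k] del: sum.lessThan_Suc)
  qed
  ultimately show ?thesis by (simp add: cut_perp_def)
qed

lemma perp_proj_Domain:
  assumes "x \<in> Domain A"
  shows "perp_proj N x \<in> Domain A"
proof -
  obtain y where "(x, y) \<in> A" using assms by blast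
  then have "(E (cut N) x, E (cut N) y) \<in> A"
    unfolding A_eq by (intro spectral_integral_E) auto
  moreover have "(\<Sum>k<Suc N. inner (E (cut N) x) (e k) *\<^sub>R (e k, (lam k)\<^sup>2 *\<^sub>R e k)) \<in> A"
    using A_subspace eig by (intro subspace_sum subspace_scale) auto
  ultimately have q: "(E (cut N) x, E (cut N) y) - (\<Sum>k<Suc N. inner (E (cut N) x) (e k) *\<^sub>R (e k, (lam k)\<^sup>2 *\<^sub>R e k)) \<in> A"
    (is "?q \<in> A") using A_subspace by (intro subspace_diff)
  have "fst ?q = perp_proj N x"
    by (simp only: fst_diff fst_sum fst_scaleR fst_conv perp_proj_def)
  moreover have "fst ?q \<in> Domain A" using q by (simp only: Domain_fst imageI)
  ultimately show ?thesis by (simp only:)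
qed

text \<open>Approximants of \<open>z\<close> from the dense domain of \<open>A\<close> are
  projected; the projection is continuous, preserves the domain and fixes \<open>z\<close>. So no
  image of \<open>z\<close> itself under \<open>A\<close> has to be constructed.\<close>

lemma cut_perp_dense:
  assumes z: "z \<in> cut_perp N"
  obtains f where "\<And>j. f j \<in> cut_perp N" "\<And>j. f j \<in> Domain A" "f \<longlonglongrightarrow> z"
proof -
  have "z \<in> closure (Domain A)" by (simp add: A_dense)
  then obtain d where d: "\<And>j. d j \<in> Domain A" "d \<longlonglongrightarrow> z"
    unfolding closure_sequential by blast
  have Ed: "(\<lambda>j. E (cut N) (d j)) \<longlonglongrightarrow> E (cut N) z"
    by (rule bounded_linear.tendsto[OF bounded_linear_E[OF cut_borel] d(2)])
  have "(\<lambda>j. perp_proj N (d j)) \<longlonglongrightarrow> perp_proj N z"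
    unfolding perp_proj_def by (intro tendsto_intros Ed)
  moreover have "perp_proj N z = z"
    using z by (simp add: perp_proj_def cut_perp_def)
  ultimately show thesis
    using that[of "\<lambda>j. perp_proj N (d j)"] perp_proj_cut_perp perp_proj_Domain[OF d(1)] by simp
qed

lemma cut_perp_A:
  assumes z: "z \<in> cut_perp N" and y: "(z, y) \<in> A"
  shows "y \<in> cut_perp N" "norm y \<le> (real N + 1) * norm z"
proof -
  have Ez: "E (cut N) z = z" using z by (simp add: cut_perp_def)
  have "(E (cut N) z, E (cut N) y) \<in> A"
    using y unfolding A_eq by (intro spectral_integral_E) auto
  then have "(z, E (cut N) y) \<in> A" by (simp only: Ez)
  then have Ey: "E (cut N) y = y" by (rule A_unique[OF _ y])
  then show "y \<in> cut_perp N" using z A_coeff[OF y] by (simp add: cut_perp_def)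
  \<comment> \<open>The bound is \<open>N + 1\<close> rather than \<open>N\<close> because it has to
    be positive for \<open>N = 0\<close> as well.\<close>
  have "norm (E (cut N) y) \<le> (real N + 1) * norm (E (cut N) z)"
    by (rule norm_E_spectral_integral_le[OF _ y[unfolded A_eq]]) (auto simp: cut_def[of N])
  then show "norm y \<le> (real N + 1) * norm z" by (simp only: Ey Ez)
qed

text \<open>Let \<open>s\<close> be the projection of \<open>x\<close> to \<open>S\<close>. The
  hypothesis, tested with \<open>perp_proj N x\<close>, shows that no cutoff of \<open>x\<close> is
  longer than \<open>s\<close>. In the limit \<open>|x| \<le> |s|\<close>, and Pythagoras gives
  \<open>x = s\<close>.\<close>

lemma in_S_if_perp:
  assumes "\<And>N z. z \<in> cut_perp N \<Longrightarrow> inner x z = 0"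
  shows "x \<in> S"
proof -
  define s where "s = synth (\<lambda>k. inner x (e k))"
  note sc = summable_coeff[of x]
  have sS: "s \<in> S" unfolding s_def by (rule synth_in_S[OF sc])
  have sn: "(\<lambda>k. (inner x (e k))\<^sup>2) sums (norm s)\<^sup>2" unfolding s_def by (rule norm_synth_sums[OF sc])
  have "(norm (E (cut N) x))\<^sup>2 \<le> (norm s)\<^sup>2" for N
  proof -
    have "inner x (perp_proj N x) = 0" by (rule assms[OF perp_proj_cut_perp])
    then have "inner x (E (cut N) x) = (\<Sum>k<Suc N. inner (E (cut N) x) (e k) * inner x (e k))"
      by (simp add: perp_proj_def inner_diff_right inner_sum_right del: sum.lessThan_Suc)
    also have "\<dots> \<le> (\<Sum>k<Suc N. (inner x (e k))\<^sup>2)"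
      by (intro sum_mono) (simp add: inner_cut power2_eq_square)
    also have "\<dots> \<le> (norm s)\<^sup>2"
      using sum_le_suminf[OF sc, of "{..<Suc N}"] sn by (simp add: sums_iff del: sum.lessThan_Suc)
    finally show ?thesis using inner_E_self[OF cut_borel, of N x] by (simp add: inner_commute)
  qed
  moreover have "(\<lambda>N. (norm (E (cut N) x))\<^sup>2) \<longlonglongrightarrow> (norm x)\<^sup>2"
    unfolding cut_def by (intro tendsto_intros E_cutoff_tendsto[where f="\<lambda>s. s"]) simp
  ultimately have "(norm x)\<^sup>2 \<le> (norm s)\<^sup>2" by (intro LIMSEQ_le_const2) auto
  moreover have "(norm (x - s))\<^sup>2 = (norm x)\<^sup>2 - (norm s)\<^sup>2"
  proof -
    have "(\<lambda>k. inner s (e k) * inner x (e k)) sums inner s x" by (rule inner_S_sums[OF sS])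
    then have "inner s x = (norm s)\<^sup>2"
      using sn sums_unique2 by (fastforce simp: s_def inner_synth[OF sc] power2_eq_square)
    then show ?thesis by (simp add: power2_norm_eq_inner inner_diff_left inner_diff_right inner_commute[of x s])
  qed
  ultimately have "(norm (x - s))\<^sup>2 \<le> 0" by linarith
  then have "x = s" by simp
  then show ?thesis using sS by simp
qed

lemma inner_S_perp: "x \<in> S \<Longrightarrow> (\<And>k. inner z (e k) = 0) \<Longrightarrow> inner x z = 0"
  using inner_S_sums[of x z] by (simp add: sums_iff)

text \<open>On the spectral subspaces where \<open>A\<close> is bounded, the part of a solution orthogonal to \<open>S\<close> solves
  a linear problem with zero data; each use of the equation halves the weighted bound.\<close>

lemma solution_in_S:
  assumes d1: "\<And>z y t. (z, y) \<in> A \<Longrightarrow> t \<ge> 0 \<Longrightarrow> ((\<lambda>s. inner (v s) z) has_real_derivative inner (w t) z) (at t within {0..})"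
    and d2: "\<And>z y t. (z, y) \<in> A \<Longrightarrow> t \<ge> 0 \<Longrightarrow>
      ((\<lambda>s. inner (w s) z) has_real_derivative - (c t * inner (v t) y)) (at t within {0..})"
    and init: "v 0 \<in> S" "w 0 \<in> S"
    and c: "\<kappa> \<ge> 1" "\<And>t. t \<in> {0..T} \<Longrightarrow> \<bar>c t\<bar> \<le> \<kappa>"
    and M: "\<And>t. t \<in> {0..T} \<Longrightarrow> norm (v t) \<le> M" and t: "t \<in> {0..T}"
  shows "v t \<in> S"
proof (rule in_S_if_perp)
  fix N z assume z: "z \<in> cut_perp N"
  have M0: "M \<ge> 0" using M[OF t] norm_ge_zero[of "v t"] by linarith
  \<comment> \<open>The equation and the norm of \<open>A\<close> on the subspace contribute
    \<open>\<kappa> (N + 1)\<close>, and two integrations against \<open>exp (r t)\<close> divide by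
    \<open>r^2\<close>. With this \<open>r\<close> the net factor is 1/2.\<close>
  define r where "r = sqrt (2 * \<kappa> * (real N + 1))"
  have r: "r > 0" "r * r = 2 * \<kappa> * (real N + 1)" using c(1) by (simp_all add: r_def)
  \<comment> \<open>Stated for all \<open>z\<close>, since each induction step passes from
    \<open>z\<close> to its image \<open>y\<close> under \<open>A\<close>, which is again in
    \<open>cut_perp N\<close>.\<close>
  have claim: "\<bar>inner (v t) z\<bar> \<le> M * norm z * (1 / 2) ^ j * exp (r * t)"
    if "z \<in> cut_perp N" "t \<in> {0..T}" for j z t
    using that
  proof (induct j arbitrary: z t)
    case 0
    have "\<bar>inner (v t) z\<bar> \<le> norm (v t) * norm z" by (rule Cauchy_Schwarz_ineq2)
    also have "\<dots> \<le> M * norm z" by (intro mult_right_mono M 0) simp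
    also have "\<dots> = M * norm z * 1" by simp
    also have "\<dots> \<le> M * norm z * exp (r * t)" using 0 r M0 by (intro mult_left_mono) auto
    finally show ?case by simp
  next
    case (Suc j)
    have dom: "\<bar>inner (v t) z\<bar> \<le> M * norm z * (1 / 2) ^ Suc j * exp (r * t)"
      if z: "z \<in> cut_perp N" "z \<in> Domain A" for z
    proof -
      obtain y where y: "(z, y) \<in> A" using z(2) by blast
      note yN = cut_perp_A[OF z(1) y]
      have z0: "\<And>k. inner z (e k) = 0" using z(1) by (simp add: cut_perp_def)
      define K where "K = \<kappa> * (M * ((real N + 1) * norm z) * (1 / 2) ^ j)"
      have K: "K \<ge> 0" using c(1) M0 by (simp add: K_def)
      have "\<bar>inner (w s) z\<bar> \<le> K / r * exp (r * s)" if "s \<in> {0..T}" for s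
      proof (rule exp_bound[OF d2[OF y] inner_S_perp[OF init(2) z0] _ r(1) that K])
        fix s assume s: "s \<in> {0..T}"
        have "\<bar>inner (v s) y\<bar> \<le> M * norm y * (1 / 2) ^ j * exp (r * s)" by (rule Suc(1)[OF yN(1) s])
        also have "\<dots> \<le> M * ((real N + 1) * norm z) * (1 / 2) ^ j * exp (r * s)"
          using yN(2) M0 by (intro mult_right_mono mult_left_mono) auto
        finally have "\<bar>c s\<bar> * \<bar>inner (v s) y\<bar> \<le> \<kappa> * (M * ((real N + 1) * norm z) * (1 / 2) ^ j * exp (r * s))"
          using c s by (intro mult_mono) auto
        then show "\<bar>- (c s * inner (v s) y)\<bar> \<le> K * exp (r * s)" by (simp add: abs_mult K_def mult.assoc)
      qed
      then have "\<bar>inner (v t) z\<bar> \<le> K / r / r * exp (r * t)"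
        using K r(1) by (intro exp_bound[OF d1[OF y] inner_S_perp[OF init(1) z0] _ r(1) Suc(3)]) auto
      also have "K / r / r = M * norm z * (1 / 2) ^ Suc j"
      proof -
        have "K = r * r * (M * norm z * (1 / 2) ^ Suc j)" by (simp add: r(2) K_def)
        then show ?thesis using r(1) by simp
      qed
      finally show ?thesis .
    qed
    \<comment> \<open>The equation can be tested only with vectors from the domain of
      \<open>A\<close>; both sides of the bound are continuous in \<open>z\<close>, so density
      removes this restriction.\<close>
    obtain f where f: "\<And>j. f j \<in> cut_perp N" "\<And>j. f j \<in> Domain A" "f \<longlonglongrightarrow> z"
      using cut_perp_dense[OF Suc(2)] by blast
    show ?case
    proof (rule LIMSEQ_le)
      show "(\<lambda>i. \<bar>inner (v t) (f i)\<bar>) \<longlonglongrightarrow> \<bar>inner (v t) z\<bar>" by (intro tendsto_intros f(3))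
      show "(\<lambda>i. M * norm (f i) * (1 / 2) ^ Suc j * exp (r * t)) \<longlonglongrightarrow> M * norm z * (1 / 2) ^ Suc j * exp (r * t)"
        by (intro tendsto_intros f(3))
      show "\<exists>N. \<forall>n\<ge>N. \<bar>inner (v t) (f n)\<bar> \<le> M * norm (f n) * (1 / 2) ^ Suc j * exp (r * t)"
        using dom[OF f(1,2)] by blast
    qed
  qed
  have "(\<lambda>j. M * norm z * (1 / 2) ^ j * exp (r * t)) \<longlonglongrightarrow> M * norm z * 0 * exp (r * t)"
    by (intro tendsto_intros LIMSEQ_realpow_zero) auto
  then have "\<bar>inner (v t) z\<bar> \<le> M * norm z * 0 * exp (r * t)"
    by (rule LIMSEQ_le_const) (use claim[OF z t] in blast)
  then show "inner (v t) z = 0" by simp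
qed

text \<open>The competing solution is first shown to take values in \<open>S\<close>. Only then is
  \<open>|A^(1/2) v|^2\<close> the series of its coefficients, so that the difference of the two
  values of \<open>m\<close> has the form required by \<open>stability\<close>, here with initial
  distance 0.\<close>

lemma uniqueness:
  assumes sol: "kirchhoff_solution A m \<alpha> u0 u1 v"
    and U: "\<And>k t. t \<ge> 0 \<Longrightarrow> (U k has_real_derivative V k t) (at t within {0..})"
    and V: "\<And>k t. t \<ge> 0 \<Longrightarrow> (V k has_real_derivative - ((lam k)\<^sup>2 * c t * U k t)) (at t within {0..})"
    and U0: "\<And>k. U k 0 = inner u0 (e k)" and V0: "\<And>k. V k 0 = inner u1 (e k)"
    and ceq: "\<And>t. t \<ge> 0 \<Longrightarrow> c t = m (\<Sum>k. (lam k)\<^sup>2 * (U k t)\<^sup>2)"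
    and enb: "\<And>T. \<exists>C\<ge>0. \<forall>t\<in>{0..T}. \<forall>k. en k (U k t) (V k t) \<le> C * en k (inner u0 (e k)) (inner u1 (e k))"
    and clip: "\<And>T. \<exists>K\<ge>0. \<forall>s\<in>{0..T}. \<forall>t\<in>{0..T}. \<bar>c s - c t\<bar> \<le> K * \<bar>s - t\<bar>"
    and cb: "\<exists>\<mu>\<ge>1. \<forall>t\<ge>0. \<nu> \<le> c t \<and> c t \<le> \<mu>"
    and T: "T \<ge> 0"
  shows "v T = synth (\<lambda>k. U k T)"
proof -
  have \<alpha>0: "\<alpha> > 0" "\<alpha> + 1/2 > 0" "\<alpha> + 1/2 \<ge> 1/2" using alpha by simp_all
  have C1: "C1_dom (pow \<alpha>) v" and C0: "C0_dom (pow (\<alpha> + 1/2)) v" and weak: "weak_kirchhoff_solution A m v"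
    and v0: "v 0 = u0" and v1: "(v has_vector_derivative u1) (at 0 within {0..})"
    using sol by (simp_all add: kirchhoff_solution_def op_power_eq)
  obtain w where w: "C0_dom (pow \<alpha>) w"
    and q: "\<And>t. t \<ge> 0 \<Longrightarrow> ((\<lambda>s. graph_norm (pow \<alpha>) ((1 / (s - t)) *\<^sub>R (v s - v t) - w t)) \<longlongrightarrow> 0) (at t within {0..})"
    using C1 unfolding C1_dom_def by blast
  have vd: "(v has_vector_derivative w t) (at t within {0..})" if t: "t \<ge> 0" for t
    unfolding has_vector_derivative_iff_quotient
    by (rule tendsto_sandwich[OF _ _ tendsto_const q[OF t]]) (auto simp: graph_norm_ge(1))
  have d1: "((\<lambda>s. inner (v s) z) has_real_derivative inner (w t) z) (at t within {0..})" if "t \<ge> 0" for t z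
    unfolding has_real_derivative_iff_has_vector_derivative
    by (rule bounded_linear.has_vector_derivative[OF bounded_linear_inner_left vd[OF that]])
  \<comment> \<open>\<open>C1_dom\<close> only provides some derivative \<open>w\<close>; at time 0
    it agrees with the prescribed derivative by uniqueness of one-sided derivatives.\<close>
  have w0: "w 0 = u1"
  proof -
    have "inner (w 0) z = inner u1 z" for z
      using has_real_derivative_unique_atLeast[OF _ d1[of 0 z]
          bounded_linear.has_vector_derivative[OF bounded_linear_inner_left v1, of z, folded has_real_derivative_iff_has_vector_derivative]]
      by simp
    then show ?thesis using vector_eq_rdot by blast
  qed
  define cv where "cv t = m ((norm (op_apply (pow (1/2)) (v t)))\<^sup>2)" for t
  have d2: "((\<lambda>s. inner (w s) z) has_real_derivative - (cv t * inner (v t) y)) (at t within {0..})"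
    if zy: "(z, y) \<in> A" and t: "t \<ge> 0" for z y t
  proof -
    have "z \<in> Domain A" using zy by blast
    with weak obtain \<phi>' \<phi>'' where \<phi>: "\<And>t. t \<ge> 0 \<Longrightarrow> ((\<lambda>s. inner (v s) z) has_real_derivative \<phi>' t) (at t within {0..})"
      "\<And>t. t \<ge> 0 \<Longrightarrow> (\<phi>' has_real_derivative \<phi>'' t) (at t within {0..})"
      "\<And>t. t \<ge> 0 \<Longrightarrow> \<phi>'' t + cv t * inner (v t) y = 0"
      unfolding weak_kirchhoff_solution_def op_power_eq cv_def using op_apply_A[OF zy] by metis
    have eq: "\<phi>' s = inner (w s) z" if "s \<ge> 0" for s
      by (rule has_real_derivative_unique_atLeast[OF that \<phi>(1)[OF that] d1[OF that]])
    have "\<phi>'' t = - (cv t * inner (v t) y)" using \<phi>(3)[OF t] by linarith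
    then show ?thesis
      using has_field_derivative_transform_within[OF \<phi>(2)[OF t] zero_less_one, of "\<lambda>s. inner (w s) z"] t eq by simp
  qed
  obtain Mv where Mv: "\<And>t. t \<in> {0..T} \<Longrightarrow> norm (v t) \<le> Mv" "\<And>t. t \<in> {0..T} \<Longrightarrow> norm (op_apply (pow (\<alpha> + 1/2)) (v t)) \<le> Mv"
    using C0_dom_bounded[OF C0, of T] by blast
  obtain Mw where Mw: "\<And>t. t \<in> {0..T} \<Longrightarrow> norm (w t) \<le> Mw" "\<And>t. t \<in> {0..T} \<Longrightarrow> norm (op_apply (pow \<alpha>) (w t)) \<le> Mw"
    using C0_dom_bounded[OF w, of T] by blast
  note vp = C0_dom_continuous(3)[OF C0] and wp = C0_dom_continuous(3)[OF w]
  have vh: "(v t, op_apply (pow (1/2)) (v t)) \<in> pow (1/2)" if "t \<ge> 0" for t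
    using weak that unfolding weak_kirchhoff_solution_def op_power_eq by (auto intro: pow_op_apply)
  have sq_le: "(norm x)\<^sup>2 \<le> r\<^sup>2" if "norm x \<le> r" for x :: 'a and r using that by (intro power_mono) auto
  define Rv where "Rv = 8 * Mv\<^sup>2 + 2 * Mv\<^sup>2"
  have Rv: "(norm (op_apply (pow (1/2)) (v t)))\<^sup>2 \<le> Rv" if t: "t \<in> {0..T}" for t
  proof -
    have t0: "t \<ge> 0" using t by simp
    have "(norm (op_apply (pow (1/2)) (v t)))\<^sup>2 \<le> 8 * (norm (v t))\<^sup>2 + 2 * (norm (op_apply (pow (\<alpha> + 1/2)) (v t)))\<^sup>2"
      by (rule norm_pow_half_le[OF \<alpha>0(3) vh[OF t0] vp[OF t0]])
    then show ?thesis using sq_le[OF Mv(1)[OF t]] sq_le[OF Mv(2)[OF t]] unfolding Rv_def by linarith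
  qed
  have Rv0: "Rv \<ge> 0" by (simp add: Rv_def)
  obtain \<mu>v where \<mu>v: "\<mu>v \<ge> 1" "\<And>s. 0 \<le> s \<Longrightarrow> s \<le> Rv \<Longrightarrow> m s \<le> \<mu>v" using m_upper[OF Rv0] by blast
  have cvb: "\<bar>cv t\<bar> \<le> \<mu>v" if "t \<in> {0..T}" for t
    using \<mu>v(2)[OF _ Rv[OF that]] m_pos[of "(norm (op_apply (pow (1/2)) (v t)))\<^sup>2"] by (simp add: cv_def)
  have vS: "v t \<in> S" if "t \<in> {0..T}" for t
    by (rule solution_in_S[where w=w and c=cv, OF d1 d2 _ _ \<mu>v(1) cvb Mv(1) that])
      (use u0(2) u1(2) v0 w0 in auto)
  define x where "x k t = inner (v t) (e k)" for k t
  define z where "z k t = inner (w t) (e k)" for k t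
  have x': "(x k has_real_derivative z k t) (at t within {0..})" if "t \<ge> 0" for k t
    unfolding x_def[abs_def] z_def by (rule d1[OF that])
  have z': "(z k has_real_derivative - ((lam k)\<^sup>2 * cv t * x k t)) (at t within {0..})" if "t \<ge> 0" for k t
    using d2[OF eig that, of k] by (simp add: x_def z_def[abs_def] mult_ac)
  have wt_half': "(wt (1/2) k)\<^sup>2 = (lam k)\<^sup>2" for k
    unfolding wt_sq using lam_nonneg[of k] by simp
  have xh: "(\<Sum>k<n. (lam k)\<^sup>2 * (x k t)\<^sup>2) \<le> (norm (op_apply (pow (1/2)) (v t)))\<^sup>2" if "t \<ge> 0" for n t
    using bessel[where x="op_apply (pow (1/2)) (v t)" and n=n] pow_coeff[OF _ vh[OF that]]
    by (simp add: power_mult_distrib wt_half' x_def)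
  have sv: "(norm (op_apply (pow (1/2)) (v t)))\<^sup>2 = (\<Sum>k. (lam k)\<^sup>2 * (x k t)\<^sup>2)" if t: "t \<in> {0..T}" for t
  proof -
    have t0: "t \<ge> 0" using t by simp
    have c: "inner (op_apply (pow (1/2)) (v t)) (e k) = wt (1/2) k * x k t" for k
      using pow_coeff[OF _ vh[OF t0]] by (simp add: x_def)
    have s: "summable (\<lambda>k. (wt (1/2) k * x k t)\<^sup>2)"
      using summable_coeff[of "op_apply (pow (1/2)) (v t)"] by (simp only: c)
    have "(v t, synth (\<lambda>k. wt (1/2) k * x k t)) \<in> pow (1/2)"
      using pow_synth[OF _ summable_coeff s[unfolded x_def]] synth_coeff[OF vS[OF t]] by (simp add: x_def)
    from op_apply_pow[OF this] norm_synth_sums[OF s] show ?thesis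
      by (simp add: sums_iff power_mult_distrib wt_half')
  qed
  obtain C where C: "C \<ge> 0" "\<And>t k. t \<in> {0..T} \<Longrightarrow> en k (U k t) (V k t) \<le> C * en k (inner u0 (e k)) (inner u1 (e k))"
    using enb[of T] by blast
  obtain K where K: "K \<ge> 0" "\<And>s t. s \<in> {0..T} \<Longrightarrow> t \<in> {0..T} \<Longrightarrow> \<bar>c s - c t\<bar> \<le> K * \<bar>s - t\<bar>"
    using clip[of T] by blast
  obtain \<mu> where \<mu>: "\<mu> \<ge> 1" "\<And>t. t \<ge> 0 \<Longrightarrow> \<nu> \<le> c t \<and> c t \<le> \<mu>" using cb by blast
  define B1 where "B1 = C * (\<Sum>k. (1 + lam k) * en k (inner u0 (e k)) (inner u1 (e k)))"
  have B1: "(\<Sum>k<n. (1 + lam k) * en k (U k t) (V k t)) \<le> B1" if t: "t \<in> {0..T}" for n t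
    unfolding B1_def by (intro weighted_en_sum_le C t)
  \<comment> \<open>The first part bounds the weight \<open>lam^(4 \<alpha>)\<close>, which
    dominates \<open>lam\<close> for all modes but possibly mode 0; the part with
    \<open>1 + lam 0\<close> takes care of that one.\<close>
  define B2 where "B2 = 2 * (Mw\<^sup>2 + Mv\<^sup>2) + (1 + lam 0) * (Mw\<^sup>2 + Rv)"
  have B2: "(\<Sum>k<n. (1 + lam k) * en k (x k t) (z k t)) \<le> B2" if t: "t \<in> {0..T}" for n t
  proof -
    have t0: "t \<ge> 0" using t by simp
    have le: "1 + lam k \<le> 2 * lam k powr (4 * \<alpha>) + (1 + lam 0)" for k
    proof (cases "k = 0")
      case False
      then have l1: "1 \<le> lam k" using lam_ge[of k] by linarith
      then have "lam k powr 1 \<le> lam k powr (4 * \<alpha>)" using alpha by (intro powr_mono) auto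
      then show ?thesis using l1 lam_nonneg[of 0] by simp
    qed simp
    have "(\<Sum>k<n. (1 + lam k) * en k (x k t) (z k t)) \<le>
      (\<Sum>k<n. 2 * ((wt \<alpha> k * z k t)\<^sup>2 + (wt (\<alpha> + 1/2) k * x k t)\<^sup>2) + (1 + lam 0) * ((z k t)\<^sup>2 + (lam k)\<^sup>2 * (x k t)\<^sup>2))"
    proof (rule sum_mono)
      fix k
      have "(1 + lam k) * en k (x k t) (z k t) \<le> (2 * lam k powr (4 * \<alpha>) + (1 + lam 0)) * en k (x k t) (z k t)"
        by (intro mult_right_mono le en_nonneg)
      also have "\<dots> = 2 * (lam k powr (4 * \<alpha>) * en k (x k t) (z k t)) + (1 + lam 0) * en k (x k t) (z k t)"
        by (simp only: distrib_right mult.assoc)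
      also have "lam k powr (4 * \<alpha>) * en k (x k t) (z k t) = (wt \<alpha> k * z k t)\<^sup>2 + (wt (\<alpha> + 1/2) k * x k t)\<^sup>2"
        by (simp only: power_mult_distrib wt_half[OF \<alpha>0(1)] wt_sq[of \<alpha>] en_def distrib_left mult.assoc)
      finally show "(1 + lam k) * en k (x k t) (z k t) \<le>
        2 * ((wt \<alpha> k * z k t)\<^sup>2 + (wt (\<alpha> + 1/2) k * x k t)\<^sup>2) + (1 + lam 0) * ((z k t)\<^sup>2 + (lam k)\<^sup>2 * (x k t)\<^sup>2)"
        by (simp only: en_def)
    qed
    also have "\<dots> = 2 * ((\<Sum>k<n. (wt \<alpha> k * z k t)\<^sup>2) + (\<Sum>k<n. (wt (\<alpha> + 1/2) k * x k t)\<^sup>2)) +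
      (1 + lam 0) * ((\<Sum>k<n. (z k t)\<^sup>2) + (\<Sum>k<n. (lam k)\<^sup>2 * (x k t)\<^sup>2))"
      by (simp only: sum.distrib sum_distrib_left[symmetric])
    also have "\<dots> \<le> B2"
    proof -
      have 1: "(\<Sum>k<n. (wt \<alpha> k * z k t)\<^sup>2) \<le> Mw\<^sup>2"
        using bessel[where x="op_apply (pow \<alpha>) (w t)" and n=n] sq_le[OF Mw(2)[OF t]] pow_coeff[OF \<alpha>0(1) wp[OF t0]]
        by (simp add: z_def)
      have 2: "(\<Sum>k<n. (wt (\<alpha> + 1/2) k * x k t)\<^sup>2) \<le> Mv\<^sup>2"
        using bessel[where x="op_apply (pow (\<alpha> + 1/2)) (v t)" and n=n] sq_le[OF Mv(2)[OF t]] pow_coeff[OF \<alpha>0(2) vp[OF t0]]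
        by (simp add: x_def)
      have 3: "(\<Sum>k<n. (z k t)\<^sup>2) \<le> Mw\<^sup>2"
        using bessel[where x="w t" and n=n] sq_le[OF Mw(1)[OF t]] by (simp add: z_def)
      have 4: "(\<Sum>k<n. (lam k)\<^sup>2 * (x k t)\<^sup>2) \<le> Rv" using xh[OF t0, of n] Rv[OF t] by linarith
      show ?thesis unfolding B2_def
        using 1 2 3 4 lam_nonneg[of 0] by (intro add_mono mult_left_mono) auto
    qed
    finally show ?thesis .
  qed
  define B where "B = max B1 B2"
  have B0: "B \<ge> 0" using B1[of 0 0] T by (simp add: B_def le_max_iff_disj)
  have sig: "(\<Sum>k. (lam k)\<^sup>2 * (f k)\<^sup>2) \<in> {0..B}"
    if b: "\<And>n. (\<Sum>k<n. (1 + lam k) * en k (f k) (g k)) \<le> B" for f g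
  proof -
    have le: "(\<Sum>k<n. (lam k)\<^sup>2 * (f k)\<^sup>2) \<le> B" for n
    proof -
      have "(\<Sum>k<n. (lam k)\<^sup>2 * (f k)\<^sup>2) \<le> (\<Sum>k<n. (1 + lam k) * en k (f k) (g k))"
      proof (rule sum_mono)
        fix k
        have "(lam k)\<^sup>2 * (f k)\<^sup>2 \<le> 1 * en k (f k) (g k)" by (simp add: en_def)
        also have "\<dots> \<le> (1 + lam k) * en k (f k) (g k)" using lam_nonneg[of k] by (intro mult_right_mono en_nonneg) auto
        finally show "(lam k)\<^sup>2 * (f k)\<^sup>2 \<le> (1 + lam k) * en k (f k) (g k)" .
      qed
      then show ?thesis using b[of n] by linarith
    qed
    have s: "summable (\<lambda>k. (lam k)\<^sup>2 * (f k)\<^sup>2)" by (rule summableI_nonneg_bounded[OF _ le]) simp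
    show ?thesis using suminf_le_const[OF s le] suminf_nonneg[OF s] by simp
  qed
  obtain L where L: "L \<ge> 0" "\<And>r s. r \<in> {0..B} \<Longrightarrow> s \<in> {0..B} \<Longrightarrow> \<bar>m r - m s\<bar> \<le> L * \<bar>r - s\<bar>"
    using m_lip[OF B0] by blast
  have B1': "(\<Sum>k<n. (1 + lam k) * en k (U k t) (V k t)) \<le> B" and B2': "(\<Sum>k<n. (1 + lam k) * en k (x k t) (z k t)) \<le> B"
    if "t \<in> {0..T}" for n t
    using B1[OF that, of n] B2[OF that, of n] by (simp_all add: B_def)
  have cd: "\<bar>c t - cv t\<bar> \<le> L * \<bar>(\<Sum>k. (lam k)\<^sup>2 * (U k t)\<^sup>2) - (\<Sum>k. (lam k)\<^sup>2 * (x k t)\<^sup>2)\<bar>" if t: "t \<in> {0..T}" for t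
    unfolding cv_def sv[OF t] using t ceq[of t] L(2)[OF sig[OF B1'[OF t]] sig[OF B2'[OF t]]] by simp
  have zero: "en k (U k t - x k t) (V k t - z k t) = 0" if t: "t \<in> {0..T}" for k t
  proof -
    have "(\<Sum>k<Suc k. en k (U k t - x k t) (V k t - z k t) / (1 + lam k)) \<le>
      3 / 2 * \<mu> / \<nu> * exp (4 * (K / \<nu> + 1 + 4 * L\<^sup>2 * B\<^sup>2 / \<nu>) * T) * 0"
    proof (rule stability[OF U V x' z' K \<mu>(1) _ _ cd B1' B2' _ t])
      show "(\<Sum>k<n. en k (U k 0 - x k 0) (V k 0 - z k 0) / (1 + lam k)) \<le> 0" for n
        by (simp add: U0 V0 x_def z_def v0 w0 en_def)
    qed (use \<mu>(2) in auto)
    moreover have "en k (U k t - x k t) (V k t - z k t) / (1 + lam k) \<le>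
      (\<Sum>k<Suc k. en k (U k t - x k t) (V k t - z k t) / (1 + lam k))"
      using weight_pos by (intro member_le_sum) (auto simp: en_nonneg less_imp_le)
    ultimately have "en k (U k t - x k t) (V k t - z k t) / (1 + lam k) \<le> 0" by simp
    then have "en k (U k t - x k t) (V k t - z k t) \<le> 0" using weight_pos[of k] by (simp add: divide_le_0_iff)
    then show ?thesis using en_nonneg[of k "U k t - x k t" "V k t - z k t"] by linarith
  qed
  have "U k T = x k T" for k
  proof -
    \<comment> \<open>If \<open>lam k = 0\<close>, vanishing energy only identifies the velocities.
      The positions then agree because the initial values do.\<close>
    have d: "((\<lambda>t. U k t - x k t) has_real_derivative 0) (at t within {0..T})" if t: "t \<in> {0..T}" for t
    proof -
      have "(V k t - z k t)\<^sup>2 + (lam k)\<^sup>2 * (U k t - x k t)\<^sup>2 = 0" using zero[OF t, of k] by (simp add: en_def)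
      then have "V k t - z k t = 0" by (simp add: sum_power2_eq_zero_iff add_nonneg_eq_0_iff)
      moreover have "((\<lambda>t. U k t - x k t) has_real_derivative V k t - z k t) (at t within {0..})"
        using t by (intro DERIV_diff U x') auto
      ultimately show ?thesis using has_field_derivative_subset[of _ 0 t "{0..}" "{0..T}"] by auto
    qed
    have "norm ((U k T - x k T) - (U k 0 - x k 0)) \<le> 0 * norm (T - 0)"
      by (rule field_differentiable_bound[of "{0..T}" "\<lambda>t. U k t - x k t" "\<lambda>t. 0"]) (use T d in auto)
    then show ?thesis by (simp add: U0 x_def v0)
  qed
  then show ?thesis using synth_coeff[OF vS[of T]] T by (simp add: x_def)
qed

end

theorem theorem4p2:
  fixes A :: "'a::{real_inner, complete_space} operator"
    and e :: "nat \<Rightarrow> 'a"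
    and lam :: "nat \<Rightarrow> real"
    and m :: "real \<Rightarrow> real"
    and \<alpha> :: real
    and u0 u1 :: 'a
    and S :: "'a set"
  assumes "separable_space (euclidean :: 'a topology)"
    and "self_adjoint A"
    and "nonnegative_operator A"
    and "\<And>i j. inner (e i) (e j) = (if i = j then 1 else 0)"
    and "\<And>k. lam k \<ge> 0"
    and "\<And>k. lam (Suc k) \<ge> exp (lam k)"
    and "\<And>k. (e k, (lam k)\<^sup>2 *\<^sub>R e k) \<in> A"
    and "S = closure (span (range e))"
    and "\<And>s. s \<ge> 0 \<Longrightarrow> m s > 0"
    and "\<And>s. s \<ge> 0 \<Longrightarrow> \<exists>r>0. \<exists>L. L-lipschitz_on (ball s r \<inter> {0..}) m"
    and "(INF s\<in>{0..}. m s) > 0"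
    and "\<alpha> > 1/4"
    and "u0 \<in> Domain (op_power A (\<alpha> + 1/2))"
    and "u1 \<in> Domain (op_power A \<alpha>)"
    and "u0 \<in> S" and "u1 \<in> S"
  shows "\<exists>u. kirchhoff_solution A m \<alpha> u0 u1 u \<and>
           (\<forall>v. kirchhoff_solution A m \<alpha> u0 u1 v \<longrightarrow> (\<forall>t\<ge>0. v t = u t))"
proof -
  have "\<exists>E. is_spectral_measure A E"
    using assms(13) unfolding op_power_def functional_calculus_def by (auto split: if_splits)
  define E where "E = (SOME E. is_spectral_measure A E)"
  have E: "is_spectral_measure A E"
    unfolding E_def using \<open>\<exists>E. is_spectral_measure A E\<close> by (rule someI_ex)
  have op: "op_power A \<beta> = spectral_integral E (\<lambda>s. if \<beta> = 0 then 1 else s powr \<beta>)" for \<beta>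
    unfolding op_power_def functional_calculus_def E_def using \<open>\<exists>E. is_spectral_measure A E\<close> by simp
  interpret spectral_setting E e lam A
    using E assms(4-7) by unfold_locales (auto simp: is_spectral_measure_def)
  \<comment> \<open>The minimum with 1 is the normalization under which \<open>\<nu>\<close> also
    bounds the coefficient 1 of the kinetic energy from below.\<close>
  define \<nu> where "\<nu> = min 1 (INF s\<in>{0..}. m s)"
  have bdd: "bdd_below (m ` {0..})"
    using assms(9) by (intro bdd_belowI[of _ 0]) (auto simp: less_imp_le)
  have m_lip: "\<exists>L\<ge>0. \<forall>x\<in>{0..R}. \<forall>y\<in>{0..R}. \<bar>m x - m y\<bar> \<le> L * \<bar>x - y\<bar>" if "R \<ge> 0" for R
  proof -
    \<comment> \<open>The local Lipschitz condition of the library has a time parameter, for which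
      the singleton \<open>{0}\<close> is used; compactness of \<open>{0..R}\<close> then yields one
      constant.\<close>
    have ll: "local_lipschitz {0::real} {0..R} (\<lambda>_. m)"
    proof (rule local_lipschitzI)
      fix t x :: real assume x: "x \<in> {0..R}"
      then obtain r L where rL: "r > 0" "L-lipschitz_on (ball x r \<inter> {0..}) m" using assms(10)[of x] by auto
      have "L-lipschitz_on (cball x (r / 2) \<inter> {0..R}) m"
        by (rule lipschitz_on_subset[OF rL(2)]) (use rL(1) in auto)
      then show "\<exists>u>0. \<exists>L. \<forall>t\<in>cball t u \<inter> {0}. L-lipschitz_on (cball x u \<inter> {0..R}) m"
        using rL(1) by (intro exI[of _ "r / 2"]) auto
    qed
    obtain L where "\<And>t. t \<in> {0::real} \<Longrightarrow> L-lipschitz_on {0..R} m"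
      by (rule local_lipschitz_compact_implies_lipschitz[OF ll]) auto
    then have "L-lipschitz_on {0..R} m" by simp
    then show ?thesis
      unfolding lipschitz_on_def dist_real_def by blast
  qed
  interpret kirchhoff_setting E e lam A m \<nu> \<alpha> u0 u1
  proof unfold_locales
    show "subspace A" "closure (Domain A) = UNIV"
      using assms(2) by (auto simp: self_adjoint_def linear_operator_def densely_defined_def)
    show "op_power A \<beta> = pow \<beta>" for \<beta> by (simp add: op pow_def)
    show "0 < \<nu>" "\<nu> \<le> 1" using assms(11) by (auto simp: \<nu>_def)
    show "\<nu> \<le> m s" if "s \<ge> 0" for s
      using cINF_lower[OF bdd, of s] that by (auto simp: \<nu>_def)
    show "u0 \<in> Domain (pow (\<alpha> + 1/2))" "u1 \<in> Domain (pow \<alpha>)"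
      using assms(13,14) by (simp_all add: op pow_def)
    show "u0 \<in> orthonormal_sequence.S e" "u1 \<in> orthonormal_sequence.S e"
      using assms(8,15,16) by (simp_all add: S_def)
  qed (use m_lip assms(12) in auto)
  obtain U V c where sol: "kirchhoff_solution A m \<alpha> u0 u1 (\<lambda>t. synth (\<lambda>k. U k t))"
    and U: "\<And>k t. t \<ge> 0 \<Longrightarrow> (U k has_real_derivative V k t) (at t within {0..})"
    "\<And>k t. t \<ge> 0 \<Longrightarrow> (V k has_real_derivative - ((lam k)\<^sup>2 * c t * U k t)) (at t within {0..})"
    "\<And>k. U k 0 = inner u0 (e k)" "\<And>k. V k 0 = inner u1 (e k)"
    "\<And>t. t \<ge> 0 \<Longrightarrow> c t = m (\<Sum>k. (lam k)\<^sup>2 * (U k t)\<^sup>2)"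
    "\<And>T. \<exists>C\<ge>0. \<forall>t\<in>{0..T}. \<forall>k. en k (U k t) (V k t) \<le> C * en k (inner u0 (e k)) (inner u1 (e k))"
    "\<And>T. \<exists>K\<ge>0. \<forall>s\<in>{0..T}. \<forall>t\<in>{0..T}. \<bar>c s - c t\<bar> \<le> K * \<bar>s - t\<bar>"
    "\<exists>\<mu>\<ge>1. \<forall>t\<ge>0. \<nu> \<le> c t \<and> c t \<le> \<mu>"
    by (rule existence) (rule that; assumption)
  show ?thesis
  proof (intro exI[of _ "\<lambda>t. synth (\<lambda>k. U k t)"] conjI allI impI)
    fix v t assume "kirchhoff_solution A m \<alpha> u0 u1 v" and "(t::real) \<ge> 0"
    then show "v t = synth (\<lambda>k. U k t)" by (intro uniqueness[OF _ U])
  qed (rule sol)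
qed

end
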